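(* Let $N\geq 2$, $l\in\{1,\dots,N-1\}$, and let $\Omega\subset\mathbb{R}^N$ be a bounded domain of $N-l$ revolutions. Let $p>1$ and let $k\geq 1$ be an integer. Then the following inequalities are satisfied: $$\lambda_2(p;\Omega)\leq\dots\leq\lambda_{N-l+2}(p;\Omega)\leq\tau_1(p;\Omega);$$ $$\lambda_{2k}(p;\Omega)\leq\lambda_{2k+1}(p;\Omega)\leq\tau_k(p;\Omega).$$
   Context: Spherical coordinates in $\mathbb{R}^N$: $x_1=r\cos\theta_1$, $x_2=r\sin\theta_1\cos\theta_2$, ..., $x_{N-1}=r\sin\theta_1\cdots\sin\theta_{N-2}\cos\theta_{N-1}$, $x_N=r\sin\theta_1\cdots\sin\theta_{N-2}\sin\theta_{N-1}$, with $r\in[0,+\infty)$, $(\theta_1,\dots,\theta_{N-2})\in[0,\pi]^{N-2}$, $\theta_{N-1}\in[0,2\pi)$. For $l\in\{1,\dots,N-1\}$, $\Omega\subset\mathbb{R}^N$ is a bounded domain of $N-l$ revolutions if $\Omega$ is a bounded domain and there exists a set $\mathcal{O}\subset[0,+\infty)\times[0,\pi]^{l-1}$ such that $$\Omega=\{x\in\mathbb{R}^N : (r,\theta_1,\dots,\theta_{l-1})\in\mathcal{O},\ (\theta_l,\dots,\theta_{N-2})\in[0,\pi]^{N-l-1},\ \theta_{N-1}\in[0,2\pi)\}.$$ Let $p>1$. For a bounded open set $U\subset\mathbb{R}^N$, the first eigenvalue of the Dirichlet $p$-Laplacian is $$\lambda_1(p;U)=\min\Big\{\int_U|\nabla u|^p\,dx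 : u\in W^{1,p}_0(U),\ \|u\|_{L^p(U)}=1\Big\}.$$ Variational eigenvalues. Let $\mathcal{S}_p=\{u\in W^{1,p}_0(\Omega): \|u\|_{L^p(\Omega)}=1\}$. A set $\mathcal{A}\subset W^{1,p}_0(\Omega)$ is symmetric if $u\in\mathcal{A}$ implies $-u\in\mathcal{A}$. Its Krasnosel'skii genus is $\gamma(\mathcal{A})=\inf\{k\in\mathbb{N} : \text{there exists a continuous odd map } f:\mathcal{A}\to S^{k-1}\}$, with $\gamma(\mathcal{A})=+\infty$ if no such $k$ exists; here $S^{k-1}$ is the $(k-1)$-dimensional sphere and $\mathbb{N}=\{1,2,\dots\}$. Let $\Gamma_k(p)$ be the collection of all $\mathcal{A}\subset\mathcal{S}_p$ that are symmetric, compact (in $W_0^{1,p}(\Omega)$) and satisfy $\gamma(\mathcal{A})\geq k$. Define $$\lambda_k(p;\Omega)=\inf_{\mathcal{A}\in\Gamma_k(p)}\ \max_{u\in\mathcal{A}}\int_\Omega|\nabla u|^p\,dx,\qquad k\in\mathbb{N}.$$ Symmetric eigenvalues. For $k\in\mathbb{N}$ let $$\mathcal{W}_1(k)=\Big\{x\in\Omega : 0<\theta_{N-1}<\frac{\pi}{k}\Big\},\qquad \tau_k(p;\Omega)=\lambda_1(p;\mathcal{W}_1(k)).$$ *)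

theory Defs
  imports "HOL-Analysis.Analysis" "HOL-Library.Extended_Nat"
begin

section \<open>Spherical coordinates and domains of revolution\<close>

text \<open>
  Points of N-dimensional space are vectors \<open>x :: real ^ 'n\<close> with \<open>N = CARD('n)\<close>. An enumeration
  \<open>e\<close>, mapping \<open>{1..N}\<close> bijectively onto the index type, fixes the order of the coordinates:
  the coordinate \<open>x\<^sub>i\<close> is \<open>x $ e i\<close>. Only the values of \<open>\<theta>\<close> on \<open>{1..N-1}\<close> matter.
\<close>

definition spherical_coords ::
    "(nat \<Rightarrow> 'n::finite) \<Rightarrow> real ^ 'n \<Rightarrow> real \<Rightarrow> (nat \<Rightarrow> real) \<Rightarrow> bool" where
  "spherical_coords e x r \<theta> \<longleftrightarrow>
     0 \<le> r \<and>
     (\<forall>i\<in>{1..CARD('n) - 2}. \<theta> i \<in> {0..pi}) \<and>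
     \<theta> (CARD('n) - 1) \<in> {0..<2 * pi} \<and>
     (\<forall>i\<in>{1..CARD('n) - 1}. x $ e i = r * (\<Prod>j\<in>{1..<i}. sin (\<theta> j)) * cos (\<theta> i)) \<and>
     x $ e CARD('n) = r * (\<Prod>j\<in>{1..<CARD('n)}. sin (\<theta> j))"

text \<open>
  Spherical coordinates are not unique at points where the product of \<open>r\<close> and some of the sines
  vanishes, so the set-builder condition is read as: \<open>x\<close> has some spherical coordinates of the
  required form, i.e. \<open>\<Omega>\<close> is the image of the coordinate set. Tuples
  \<open>(\<theta>\<^sub>1, \<dots>, \<theta>\<^sub>l\<^sub>-\<^sub>1)\<close> are extensional functions on \<open>{1..<l}\<close>; the ranges of the remaining,
  free angles are part of \<^const>\<open>spherical_coords\<close>.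
\<close>

definition bounded_domain :: "(real ^ 'n::finite) set \<Rightarrow> bool" where
  "bounded_domain \<Omega> \<longleftrightarrow> open \<Omega> \<and> connected \<Omega> \<and> \<Omega> \<noteq> {} \<and> bounded \<Omega>"

text \<open>For \<open>N = CARD('n)\<close>, these are the bounded domains of \<open>N - l\<close> revolutions.\<close>

definition domain_of_revolutions ::
    "(nat \<Rightarrow> 'n::finite) \<Rightarrow> nat \<Rightarrow> (real ^ 'n) set \<Rightarrow> bool" where
  "domain_of_revolutions e l \<Omega> \<longleftrightarrow>
     bounded_domain \<Omega> \<and>
     (\<exists>Q \<subseteq> {0..} \<times> ({1..<l} \<rightarrow>\<^sub>E {0..pi}).
        \<Omega> = {x. \<exists>r \<theta>. spherical_coords e x r \<theta> \<and> (r, restrict \<theta> {1..<l}) \<in> Q})"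

text \<open>
  The angle \<open>\<theta>\<^sub>N\<^sub>-\<^sub>1\<close> is undetermined exactly where \<open>x\<^sub>N\<^sub>-\<^sub>1 = x\<^sub>N = 0\<close>. The wedge has to be an open set
  and must not contain these points; since \<open>\<theta>\<^sub>N\<^sub>-\<^sub>1 = 0\<close> is admissible there, quantifying
  over all spherical coordinates of \<open>x\<close> excludes them. Elsewhere \<open>\<theta>\<^sub>N\<^sub>-\<^sub>1\<close> is unique.
\<close>

definition wedge :: "(nat \<Rightarrow> 'n::finite) \<Rightarrow> (real ^ 'n) set \<Rightarrow> nat \<Rightarrow> (real ^ 'n) set" where
  "wedge e \<Omega> k =
     {x \<in> \<Omega>. \<forall>r \<theta>. spherical_coords e x r \<theta> \<longrightarrow>
        0 < \<theta> (CARD('n) - 1) \<and> \<theta> (CARD('n) - 1) < pi / real k}"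


section \<open>Sobolev spaces\<close>

primrec Ck :: "nat \<Rightarrow> (real ^ 'n::finite \<Rightarrow> real) \<Rightarrow> bool" where
  "Ck 0 f \<longleftrightarrow> continuous_on UNIV f"
| "Ck (Suc m) f \<longleftrightarrow>
     (\<forall>x. f differentiable (at x)) \<and> (\<forall>i. Ck m (\<lambda>x. frechet_derivative f (at x) (axis i 1)))"

definition test_functions :: "(real ^ 'n::finite) set \<Rightarrow> (real ^ 'n \<Rightarrow> real) set" where
  "test_functions U =
     {\<phi>. (\<forall>m. Ck m \<phi>) \<and> compact (closure {x. \<phi> x \<noteq> 0}) \<and> closure {x. \<phi> x \<noteq> 0} \<subseteq> U}"

text \<open>
  Elements of Lebesgue and Sobolev spaces are represented by functions on the whole space, of which
  only the almost-everywhere class on \<open>U\<close> is relevant.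
\<close>

definition Lp_space ::
    "real \<Rightarrow> (real ^ 'n::finite) set \<Rightarrow> (real ^ 'n \<Rightarrow> 'b::euclidean_space) set" where
  "Lp_space p U =
     {u \<in> borel_measurable (lebesgue_on U). integrable (lebesgue_on U) (\<lambda>x. norm (u x) powr p)}"

definition Lp_norm ::
    "real \<Rightarrow> (real ^ 'n::finite) set \<Rightarrow> (real ^ 'n \<Rightarrow> 'b::euclidean_space) \<Rightarrow> real" where
  "Lp_norm p U u = (LINT x|lebesgue_on U. norm (u x) powr p) powr (1 / p)"

definition locally_integrable ::
    "(real ^ 'n::finite) set \<Rightarrow> (real ^ 'n \<Rightarrow> 'b::euclidean_space) \<Rightarrow> bool" where
  "locally_integrable U u \<longleftrightarrow> (\<forall>K. compact K \<and> K \<subseteq> U \<longrightarrow> integrable (lebesgue_on K) u)"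

definition weak_gradient ::
    "(real ^ 'n::finite) set \<Rightarrow> (real ^ 'n \<Rightarrow> real) \<Rightarrow> (real ^ 'n \<Rightarrow> real ^ 'n) \<Rightarrow> bool" where
  "weak_gradient U u v \<longleftrightarrow>
     locally_integrable U u \<and> locally_integrable U v \<and>
     (\<forall>\<phi>\<in>test_functions U. \<forall>i.
        (LINT x|lebesgue_on U. u x * frechet_derivative \<phi> (at x) (axis i 1)) =
        - (LINT x|lebesgue_on U. v x $ i * \<phi> x))"

text \<open>
  A weak gradient is unique up to null sets, so the choice does not affect the integrals below.
\<close>

definition grad ::
    "(real ^ 'n::finite) set \<Rightarrow> (real ^ 'n \<Rightarrow> real) \<Rightarrow> real ^ 'n \<Rightarrow> real ^ 'n" where
  "grad U u = (SOME v. weak_gradient U u v)"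

definition W1p :: "real \<Rightarrow> (real ^ 'n::finite) set \<Rightarrow> (real ^ 'n \<Rightarrow> real) set" where
  "W1p p U = {u \<in> Lp_space p U. \<exists>v \<in> Lp_space p U. weak_gradient U u v}"

definition W1p_norm :: "real \<Rightarrow> (real ^ 'n::finite) set \<Rightarrow> (real ^ 'n \<Rightarrow> real) \<Rightarrow> real" where
  "W1p_norm p U u = Lp_norm p U u + Lp_norm p U (grad U u)"

definition W1p0 :: "real \<Rightarrow> (real ^ 'n::finite) set \<Rightarrow> (real ^ 'n \<Rightarrow> real) set" where
  "W1p0 p U =
     {u \<in> W1p p U. \<forall>\<epsilon>>0. \<exists>\<phi>\<in>test_functions U. W1p_norm p U (\<lambda>x. u x - \<phi> x) < \<epsilon>}"

text \<open>
  The norm topology on \<^const>\<open>W1p0\<close>, given by a pseudometric because functions that agree almost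
  everywhere on \<open>U\<close> are not identified. Continuous maps into Hausdorff spaces factor through the
  quotient by this identification, and a set of functions is compact iff its image in the
  quotient is; hence compactness and genus have their usual meaning.
\<close>

definition W1p0_open ::
    "real \<Rightarrow> (real ^ 'n::finite) set \<Rightarrow> (real ^ 'n \<Rightarrow> real) set \<Rightarrow> bool" where
  "W1p0_open p U S \<longleftrightarrow>
     S \<subseteq> W1p0 p U \<and>
     (\<forall>u\<in>S. \<exists>\<epsilon>>0. \<forall>w\<in>W1p0 p U. W1p_norm p U (\<lambda>x. w x - u x) < \<epsilon> \<longrightarrow> w \<in> S)"

definition W1p0_topology ::
    "real \<Rightarrow> (real ^ 'n::finite) set \<Rightarrow> (real ^ 'n \<Rightarrow> real) topology" where
  "W1p0_topology p U = topology (W1p0_open p U)"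

lemma istopology_W1p0_open: "istopology (W1p0_open p U)"
  unfolding istopology_def
proof (intro conjI allI impI)
  fix S T assume S: "W1p0_open p U S" and T: "W1p0_open p U T"
  show "W1p0_open p U (S \<inter> T)"
    unfolding W1p0_open_def
  proof (intro conjI ballI)
    show "S \<inter> T \<subseteq> W1p0 p U"
      using S by (auto simp: W1p0_open_def)
  next
    fix u assume u: "u \<in> S \<inter> T"
    obtain a where a: "a > 0" "\<forall>w\<in>W1p0 p U. W1p_norm p U (\<lambda>x. w x - u x) < a \<longrightarrow> w \<in> S"
      using S u by (auto simp: W1p0_open_def)
    obtain b where b: "b > 0" "\<forall>w\<in>W1p0 p U. W1p_norm p U (\<lambda>x. w x - u x) < b \<longrightarrow> w \<in> T"
      using T u by (auto simp: W1p0_open_def)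
    show "\<exists>\<epsilon>>0. \<forall>w\<in>W1p0 p U. W1p_norm p U (\<lambda>x. w x - u x) < \<epsilon> \<longrightarrow> w \<in> S \<inter> T"
      by (rule exI[of _ "min a b"]) (use a b in auto)
  qed
next
  fix \<K> assume *: "\<forall>K\<in>\<K>. W1p0_open p U K"
  show "W1p0_open p U (\<Union>\<K>)"
    unfolding W1p0_open_def
  proof (intro conjI ballI)
    show "\<Union>\<K> \<subseteq> W1p0 p U"
      using * by (auto simp: W1p0_open_def)
  next
    fix u assume "u \<in> \<Union>\<K>"
    then obtain K where K: "K \<in> \<K>" "u \<in> K"
      by blast
    with * obtain a where
      "a > 0" "\<forall>w\<in>W1p0 p U. W1p_norm p U (\<lambda>x. w x - u x) < a \<longrightarrow> w \<in> K"
      unfolding W1p0_open_def by meson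
    with K show "\<exists>\<epsilon>>0. \<forall>w\<in>W1p0 p U. W1p_norm p U (\<lambda>x. w x - u x) < \<epsilon> \<longrightarrow> w \<in> \<Union>\<K>"
      by blast
  qed
qed

lemma openin_W1p0_topology: "openin (W1p0_topology p U) S \<longleftrightarrow> W1p0_open p U S"
  unfolding W1p0_topology_def by (simp add: istopology_W1p0_open topology_inverse')

lemma topspace_W1p0_topology: "topspace (W1p0_topology p U) = W1p0 p U"
proof -
  have "W1p0_open p U (W1p0 p U)"
    by (auto simp: W1p0_open_def intro: exI[of _ "1::real"])
  then show ?thesis
    by (auto simp: topspace_def openin_W1p0_topology W1p0_open_def)
qed


section \<open>Eigenvalues of the Dirichlet p-Laplacian\<close>

definition energy :: "real \<Rightarrow> (real ^ 'n::finite) set \<Rightarrow> (real ^ 'n \<Rightarrow> real) \<Rightarrow> real" where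
  "energy p U u = (LINT x|lebesgue_on U. norm (grad U u x) powr p)"

definition unit_sphere_W1p0 :: "real \<Rightarrow> (real ^ 'n::finite) set \<Rightarrow> (real ^ 'n \<Rightarrow> real) set" where
  "unit_sphere_W1p0 p U = {u \<in> W1p0 p U. Lp_norm p U u = 1}"

text \<open>
  Minima and maxima over sets of energies are taken as infima and suprema in the extended reals;
  they agree whenever the extremum is attained, as it is for the sets in question.
\<close>

definition first_eigenvalue :: "real \<Rightarrow> (real ^ 'n::finite) set \<Rightarrow> ereal" where
  "first_eigenvalue p U = (INF u \<in> unit_sphere_W1p0 p U. ereal (energy p U u))"

definition symmetric_set :: "('a \<Rightarrow> real) set \<Rightarrow> bool" where
  "symmetric_set A \<longleftrightarrow> (\<forall>u\<in>A. (\<lambda>x. - u x) \<in> A)"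

text \<open>
  The sphere of dimension \<open>k - 1\<close> is \<^term>\<open>nsphere (k - 1)\<close>, whose points are real sequences
  supported on \<open>{..<k}\<close>.
\<close>

definition genus ::
    "real \<Rightarrow> (real ^ 'n::finite) set \<Rightarrow> (real ^ 'n \<Rightarrow> real) set \<Rightarrow> enat" where
  "genus p U A =
     Inf {enat k | k. 1 \<le> k \<and>
       (\<exists>f. continuous_map (subtopology (W1p0_topology p U) A) (nsphere (k - 1)) f \<and>
            (\<forall>u\<in>A. f (\<lambda>x. - u x) = (\<lambda>i. - f u i)))}"

text \<open>
  The empty set has genus 1 under this definition, but has no maximal energy; it is
  excluded, which is relevant for \<open>k = 1\<close> only.
\<close>

definition Gamma_sets ::
    "real \<Rightarrow> (real ^ 'n::finite) set \<Rightarrow> nat \<Rightarrow> (real ^ 'n \<Rightarrow> real) set set" where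
  "Gamma_sets p U k =
     {A. A \<subseteq> unit_sphere_W1p0 p U \<and> A \<noteq> {} \<and> symmetric_set A \<and>
         compactin (W1p0_topology p U) A \<and> enat k \<le> genus p U A}"

definition variational_eigenvalue :: "real \<Rightarrow> (real ^ 'n::finite) set \<Rightarrow> nat \<Rightarrow> ereal" where
  "variational_eigenvalue p U k =
     (INF A \<in> Gamma_sets p U k. SUP u \<in> A. ereal (energy p U u))"

definition symmetric_eigenvalue ::
    "(nat \<Rightarrow> 'n::finite) \<Rightarrow> real \<Rightarrow> (real ^ 'n) set \<Rightarrow> nat \<Rightarrow> ereal" where
  "symmetric_eigenvalue e p \<Omega> k = first_eigenvalue p (wedge e \<Omega> k)"

end

theory Submission
  imports Defs "HOL-Homology.Homology"
begin

text \<open>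
  Take a test function \<open>\<phi>\<close> on the wedge whose Rayleigh quotient is close to the first eigenvalue. The \<open>2 k\<close>
  copies of \<open>\<phi>\<close> rotated by \<open>\<theta> + i \<pi> / k\<close> have disjoint supports, so all their linear combinations have the same
  Rayleigh quotient. An odd map from this family to the sphere of dimension \<open>2 k - 1\<close> would, for \<open>\<theta> = 0\<close>, be an odd
  self-map of the sphere of coefficients, of odd degree by Borsuk's theorem; but letting \<open>\<theta>\<close> run to \<open>\<pi> / k\<close> makes it
  homotopic to its composition with a cyclic shift of an even number of coordinates, which has degree \<open>-1\<close>.

  For \<open>k = 1\<close>, the half-domain can be turned in every direction \<open>v\<close> of the sphere of dimension \<open>N - l\<close>. Since \<open>\<phi>\<close> need
  not be symmetric about the axis, a continuous choice of functions \<open>\<psi> v\<close> supported in the half-spaces is glued from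
  finitely many reflected copies of \<open>\<phi>\<close> by power means, which do not increase the Rayleigh quotient. The same
  convexity contracts \<open>\<psi>\<close> to a constant, so the odd map \<open>v \<mapsto> \<psi> v - \<psi> (- v)\<close>, which is homotopic to \<open>\<psi>\<close>, would be
  null-homotopic after composition with an odd map into the sphere of dimension \<open>N - l\<close>.
\<close>

section \<open>Odd maps of spheres\<close>

text \<open>Genus at least \<open>n\<close> means that no odd map into the sphere of dimension
  \<open>n - 2\<close> exists. A sphere of coefficients or directions of dimension \<open>d\<close>
  by itself only yields genus \<open>d + 1\<close>. The one additional index comes from the homotopy
  parameter: it excludes odd maps into a sphere of the same dimension \<open>d\<close>, where
  degrees are available. The families of functions need not be embedded spheres, so odd maps are
  pulled back to the parameter space.

  Working with a test function leaves a strict gap between its Rayleigh quotient and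
  \<open>C\<close>. This gap pays for the smoothing of the power means, while a common compact
  support makes continuity in the Sobolev norm a matter of joint continuity.

  The induction behind Borsuk's theorem compares the degree of an odd map with that of its
  restriction to the equator, which must be preserved. Pushing the image of the equator into the
  equator requires a direction missed by it. The image of a merely continuous map might leave no
  such direction, whence the detour through Lipschitz maps.\<close>

definition sph :: "nat \<Rightarrow> (nat \<Rightarrow> real) set" where
  "sph n = {x. (\<Sum>i\<le>n. (x i)\<^sup>2) = 1 \<and> (\<forall>i>n. x i = 0)}"

text \<open>Degrees are defined for the abstract topology \<open>nsphere n\<close>, whereas
  continuity is handled by \<open>continuous_on\<close> for sets of sequences; this equation
  connects the two.\<close>

lemma nsphere_eq_top_of_set: "nsphere n = top_of_set (sph n)"
  by (simp add: nsphere sph_def euclidean_product_topology)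

lemma sph_coord_le_1:
  assumes "x \<in> sph n"
  shows "\<bar>x i\<bar> \<le> 1"
proof (cases "i \<le> n")
  case True
  then have "(x i)\<^sup>2 \<le> (\<Sum>i\<le>n. (x i)\<^sup>2)"
    by (intro member_le_sum) auto
  then show ?thesis
    using assms by (simp add: sph_def abs_square_le_1)
qed (use assms in \<open>auto simp: sph_def\<close>)

lemma uminus_in_sph: "x \<in> sph n \<Longrightarrow> (\<lambda>i. - x i) \<in> sph n"
  by (simp add: sph_def)

lemma continuous_on_coord:
  fixes f :: "'b::topological_space \<Rightarrow> 'i \<Rightarrow> 'a::topological_space"
  assumes "continuous_on S f"
  shows "continuous_on S (\<lambda>x. f x i)"
  using assms by (rule continuous_on_product_then_coordinatewise)

lemma continuous_on_apply: "continuous_on S (\<lambda>x. x i)"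
  using continuous_on_product_coordinates by (rule continuous_on_subset) simp

lemma closed_sph: "closed (sph n)"
proof -
  have "sph n = (\<lambda>x. \<Sum>i\<le>n. (x i)\<^sup>2) -` {1} \<inter> (\<Inter>i\<in>{n<..}. (\<lambda>x. x i) -` {0})"
    by (auto simp: sph_def)
  moreover have "closed ((\<lambda>x::nat \<Rightarrow> real. \<Sum>i\<le>n. (x i)\<^sup>2) -` {1})"
    by (intro closed_vimage continuous_intros continuous_on_apply closed_singleton)
  moreover have "closed ((\<lambda>x::nat \<Rightarrow> real. x i) -` {0})" for i
    by (intro closed_vimage continuous_intros continuous_on_apply closed_singleton)
  ultimately show ?thesis
    by (auto intro!: closed_Int)
qed

text \<open>The ambient space is an infinite product, so compactness comes from the Tychonoff cube
  of sequences with values in \<open>{-1..1}\<close>, of which the sphere is a closed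
  subset.\<close>

lemma compact_sph: "compact (sph n)"
proof -
  have "compact (PiE UNIV (\<lambda>_::nat. {-1..1::real}))"
    using compactin_PiE[of "\<lambda>_::nat. euclideanreal" UNIV "\<lambda>_. {-1..1}"]
    by (simp add: euclidean_product_topology)
  moreover have "sph n \<subseteq> PiE UNIV (\<lambda>_::nat. {-1..1::real})"
    using sph_coord_le_1 by (fastforce simp: abs_le_iff)
  ultimately show ?thesis
    using closed_sph compact_Int_closed[of _ "sph n"] by (metis inf.absorb2 inf_commute)
qed

lemma sph_nonempty: "sph n \<noteq> {}"
  using in_topspace_nsphere[of n] by (auto simp: nsphere_eq_top_of_set)

lemma sph_mono: "m \<le> n \<Longrightarrow> sph m \<subseteq> sph n"
proof
  fix x assume mn: "m \<le> n" and x: "x \<in> sph m"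
  have "(\<Sum>i\<le>n. (x i)\<^sup>2) = (\<Sum>i\<le>m. (x i)\<^sup>2)"
    using mn x by (intro sum.mono_neutral_right) (auto simp: sph_def)
  then show "x \<in> sph n"
    using mn x by (auto simp: sph_def)
qed

lemma Brouwer_degree2_homotopy_on:
  fixes h :: "real \<times> (nat \<Rightarrow> real) \<Rightarrow> nat \<Rightarrow> real"
  assumes "continuous_on ({0..1} \<times> sph n) h" "\<And>t x. t \<in> {0..1} \<Longrightarrow> x \<in> sph n \<Longrightarrow> h (t, x) \<in> sph n"
  shows "Brouwer_degree2 n (\<lambda>x. h (0, x)) = Brouwer_degree2 n (\<lambda>x. h (1, x))"
proof (rule Brouwer_degree2_homotopic)
  have h: "continuous_map (prod_topology (top_of_set {0..1}) (nsphere n)) (nsphere n) h"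
    unfolding nsphere_eq_top_of_set prod_topology_subtopology_eu using assms by auto
  show "homotopic_with (\<lambda>x. True) (nsphere n) (nsphere n) (\<lambda>x. h (0, x)) (\<lambda>x. h (1, x))"
    unfolding homotopic_with_def using h by blast
qed

text \<open>Radial projection. The norm involves only the coordinates up to \<open>n\<close>; the
  others have to be 0 for the result to lie in \<open>sph n\<close>.\<close>

definition sph_normalize :: "nat \<Rightarrow> (nat \<Rightarrow> real) \<Rightarrow> nat \<Rightarrow> real" where
  "sph_normalize n y i = y i / sqrt (\<Sum>j\<le>n. (y j)\<^sup>2)"

lemma sum_squares_pos_iff: "(\<Sum>j\<le>n. (y j)\<^sup>2) > 0 \<longleftrightarrow> (\<exists>j\<le>n. y j \<noteq> (0::real))" for n :: nat
proof
  show "(\<Sum>j\<le>n. (y j)\<^sup>2) > 0 \<Longrightarrow> \<exists>j\<le>n. y j \<noteq> 0"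
    by (metis atMost_iff less_irrefl power_zero_numeral sum.neutral zero_less_power2)
  show "\<exists>j\<le>n. y j \<noteq> 0 \<Longrightarrow> (\<Sum>j\<le>n. (y j)\<^sup>2) > 0"
    by (auto intro: sum_pos2)
qed

lemma sph_normalize_in_sph:
  assumes "\<exists>j\<le>n. y j \<noteq> 0" "\<And>i. i > n \<Longrightarrow> y i = 0"
  shows "sph_normalize n y \<in> sph n"
proof -
  define q where "q = (\<Sum>j\<le>n. (y j)\<^sup>2)"
  have "q > 0"
    using assms(1) unfolding q_def sum_squares_pos_iff .
  have "(\<Sum>i\<le>n. (sph_normalize n y i)\<^sup>2) = (\<Sum>i\<le>n. (y i)\<^sup>2 / q)"
    using \<open>q > 0\<close> by (simp add: sph_normalize_def power_divide flip: q_def)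
  also have "\<dots> = q / q"
    unfolding q_def by (rule sum_divide_distrib[symmetric])
  finally show ?thesis
    using \<open>q > 0\<close> assms(2) by (simp add: sph_def sph_normalize_def)
qed

lemma sph_normalize_id: "x \<in> sph n \<Longrightarrow> sph_normalize n x = x"
  by (auto simp: sph_def sph_normalize_def)

lemma sph_normalize_uminus: "sph_normalize n (\<lambda>i. - y i) = (\<lambda>i. - sph_normalize n y i)"
  by (simp add: sph_normalize_def fun_eq_iff)

lemma continuous_on_sph_normalize:
  assumes "continuous_on S h" "\<And>x. x \<in> S \<Longrightarrow> \<exists>j\<le>n. h x j \<noteq> 0"
  shows "continuous_on S (\<lambda>x. sph_normalize n (h x))"
proof (rule continuous_on_coordinatewise_then_product)
  fix i
  show "continuous_on S (\<lambda>x. sph_normalize n (h x) i)"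
    unfolding sph_normalize_def
  proof (intro continuous_intros continuous_on_coord[OF assms(1)] ballI)
    fix x assume "x \<in> S"
    then show "sqrt (\<Sum>j\<le>n. (h x j)\<^sup>2) \<noteq> 0"
      using assms(2)[of x] sum_squares_pos_iff[of "h x" n] by simp
  qed
qed

text \<open>Radial projection turns a homotopy without zeros into one of self-maps of the sphere, so
  interpolation and pushing can be done in the ambient space.\<close>

lemma Brouwer_degree2_homotopy_nonvanishing:
  fixes h :: "real \<times> (nat \<Rightarrow> real) \<Rightarrow> nat \<Rightarrow> real"
  assumes "continuous_on ({0..1} \<times> sph n) h"
    and "\<And>t x. t \<in> {0..1} \<Longrightarrow> x \<in> sph n \<Longrightarrow> \<exists>j\<le>n. h (t, x) j \<noteq> 0"
    and "\<And>t x i. t \<in> {0..1} \<Longrightarrow> x \<in> sph n \<Longrightarrow> i > n \<Longrightarrow> h (t, x) i = 0"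
  shows "Brouwer_degree2 n (\<lambda>x. sph_normalize n (h (0, x))) =
         Brouwer_degree2 n (\<lambda>x. sph_normalize n (h (1, x)))"
proof (rule Brouwer_degree2_homotopy_on[where h = "\<lambda>z. sph_normalize n (h z)"])
  show "continuous_on ({0..1} \<times> sph n) (\<lambda>z. sph_normalize n (h z))"
    using assms(1,2) by (intro continuous_on_sph_normalize) auto
  show "sph_normalize n (h (t, x)) \<in> sph n" if "t \<in> {0..1}" "x \<in> sph n" for t x
    using assms(2,3)[OF that] by (rule sph_normalize_in_sph)
qed

section \<open>Lipschitz approximation and general position\<close>

text \<open>Stone-Weierstrass: on the compact sphere the Lipschitz functions form an algebra that
  contains the constants and, through the coordinates, separates points.\<close>

lemma lipschitz_approximation_on_sph:
  assumes "continuous_on (sph n) f" "e > 0"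
  shows "\<exists>g L. (\<forall>x\<in>sph n. \<forall>y\<in>sph n. \<bar>g x - g y\<bar> \<le> L * (\<Sum>i\<le>n. \<bar>x i - y i\<bar>)) \<and>
           continuous_on (sph n) g \<and> (\<forall>x\<in>sph n. \<bar>f x - g x\<bar> < e)"
proof -
  define d where "d x y = (\<Sum>i\<le>n. \<bar>x i - y i\<bar>)" for x y :: "nat \<Rightarrow> real"
  have d_nonneg: "d x y \<ge> 0" for x y
    by (simp add: d_def sum_nonneg)
  define P where "P g \<longleftrightarrow> (\<exists>L\<ge>0. \<forall>x\<in>sph n. \<forall>y\<in>sph n. \<bar>g x - g y\<bar> \<le> L * d x y) \<and> continuous_on (sph n) g" for g
  have PI: "P g" if "L \<ge> 0" "\<And>x y. x \<in> sph n \<Longrightarrow> y \<in> sph n \<Longrightarrow> \<bar>g x - g y\<bar> \<le> L * d x y"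
    "continuous_on (sph n) g" for g L
    using that unfolding P_def by blast
  have "\<exists>g. P g \<and> (\<forall>x\<in>sph n. \<bar>f x - g x\<bar> < e)"
  proof (rule Stone_Weierstrass_HOL[OF compact_sph _ _ _ _ _ assms])
    show "P (\<lambda>x. c)" for c
      by (rule PI[of 0]) auto
    show "P g \<Longrightarrow> continuous_on (sph n) g" for g
      by (simp add: P_def)
    show "P (\<lambda>x. g x + h x)" if "P g \<and> P h" for g h
    proof -
      from that obtain L M where
        L: "L \<ge> 0" "\<And>x y. x \<in> sph n \<Longrightarrow> y \<in> sph n \<Longrightarrow> \<bar>g x - g y\<bar> \<le> L * d x y" "continuous_on (sph n) g"
        and M: "M \<ge> 0" "\<And>x y. x \<in> sph n \<Longrightarrow> y \<in> sph n \<Longrightarrow> \<bar>h x - h y\<bar> \<le> M * d x y" "continuous_on (sph n) h"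
        unfolding P_def by auto
      show ?thesis
      proof (rule PI[of "L + M"])
        show "\<bar>g x + h x - (g y + h y)\<bar> \<le> (L + M) * d x y" if "x \<in> sph n" "y \<in> sph n" for x y
          using L(2)[OF that] M(2)[OF that] unfolding distrib_right by linarith
      qed (use L M in \<open>auto intro: continuous_on_add\<close>)
    qed
    show "P (\<lambda>x. g x * h x)" if "P g \<and> P h" for g h
    proof -
      from that obtain L M where
        L: "L \<ge> 0" "\<forall>x\<in>sph n. \<forall>y\<in>sph n. \<bar>g x - g y\<bar> \<le> L * d x y" "continuous_on (sph n) g"
        and M: "M \<ge> 0" "\<forall>x\<in>sph n. \<forall>y\<in>sph n. \<bar>h x - h y\<bar> \<le> M * d x y" "continuous_on (sph n) h"
        unfolding P_def by auto
      obtain A where A: "A > 0" "\<And>x. x \<in> sph n \<Longrightarrow> \<bar>g x\<bar> \<le> A"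
        using compact_imp_bounded[OF compact_continuous_image[OF L(3) compact_sph]]
        unfolding bounded_pos by auto
      obtain B where B: "B > 0" "\<And>x. x \<in> sph n \<Longrightarrow> \<bar>h x\<bar> \<le> B"
        using compact_imp_bounded[OF compact_continuous_image[OF M(3) compact_sph]]
        unfolding bounded_pos by auto
      have "\<bar>g x * h x - g y * h y\<bar> \<le> (A * M + L * B) * d x y" if "x \<in> sph n" "y \<in> sph n" for x y
      proof -
        have "\<bar>g x * h x - g y * h y\<bar> = \<bar>g x * (h x - h y) + (g x - g y) * h y\<bar>"
          by (simp add: algebra_simps)
        also have "\<dots> \<le> \<bar>g x\<bar> * \<bar>h x - h y\<bar> + \<bar>g x - g y\<bar> * \<bar>h y\<bar>"
          by (metis abs_mult abs_triangle_ineq)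
        also have "\<dots> \<le> A * (M * d x y) + (L * d x y) * B"
          using that A B L M d_nonneg by (intro add_mono mult_mono) auto
        finally show ?thesis by (simp add: algebra_simps)
      qed
      then show ?thesis
        using A B L M by (intro PI[of "A * M + L * B"] continuous_on_mult) auto
    qed
    show "\<exists>g. P g \<and> g x \<noteq> g y" if xy: "x \<in> sph n \<and> y \<in> sph n \<and> x \<noteq> y" for x y
    proof -
      obtain i where i: "x i \<noteq> y i"
        using xy by (metis ext)
      \<comment> \<open>The distance \<open>d\<close> only sees coordinates up to \<open>n\<close>,
        so the separating coordinate has to be one of these.\<close>
      moreover have "x j = y j" if "j > n" for j
        using xy that by (simp add: sph_def)
      ultimately have "i \<le> n"
        by (meson not_le)
      then have "\<bar>u i - v i\<bar> \<le> 1 * d u v" for u v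
        unfolding d_def by (auto intro: member_le_sum[of i "{..n}" "\<lambda>i. \<bar>u i - v i\<bar>"])
      then have "P (\<lambda>x. x i)"
        by (intro PI[of 1] continuous_on_apply) auto
      with i show ?thesis by blast
    qed
  qed
  then show ?thesis
    unfolding P_def d_def by blast
qed

text \<open>The reverse triangle inequality. For multiples \<open>r x\<close> and
  \<open>r' x'\<close> of unit vectors it bounds the difference of the radii by the l1
  distance.\<close>

lemma L2_diff_le_l1:
  fixes n :: nat and y z :: "nat \<Rightarrow> real"
  shows "\<bar>sqrt (\<Sum>i\<le>n. (y i)\<^sup>2) - sqrt (\<Sum>i\<le>n. (z i)\<^sup>2)\<bar> \<le> (\<Sum>i\<le>n. \<bar>y i - z i\<bar>)"
proof -
  have *: "L2_set y {..n} \<le> L2_set z {..n} + L2_set (\<lambda>i. y i - z i) {..n}" for y z :: "nat \<Rightarrow> real"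
    using L2_set_triangle_ineq[of z "\<lambda>i. y i - z i" "{..n}"] by simp
  have "L2_set (\<lambda>i. z i - y i) {..n} = L2_set (\<lambda>i. y i - z i) {..n}"
    by (simp add: L2_set_def power2_commute)
  moreover have "L2_set (\<lambda>i. y i - z i) {..n} \<le> (\<Sum>i\<le>n. \<bar>y i - z i\<bar>)"
    by (rule L2_set_le_sum_abs)
  ultimately have "\<bar>L2_set y {..n} - L2_set z {..n}\<bar> \<le> (\<Sum>i\<le>n. \<bar>y i - z i\<bar>)"
    using *[of y z] *[of z y] by linarith
  then show ?thesis
    by (simp add: L2_set_def)
qed

text \<open>
  The cone over a Lipschitz image of the \<open>n\<close>-sphere is the Lipschitz image of a space of dimension
  \<open>n + 1\<close>, so it meets too few points of a fine grid in dimension \<open>n + 2\<close>.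
\<close>

lemma lipschitz_sph_cone_misses_point:
  assumes L: "\<And>x y i. x \<in> sph n \<Longrightarrow> y \<in> sph n \<Longrightarrow> i \<le> Suc n \<Longrightarrow>
                \<bar>P x i - P y i\<bar> \<le> L * (\<Sum>j\<le>n. \<bar>x j - y j\<bar>)"
    and B: "\<And>x i. x \<in> sph n \<Longrightarrow> i \<le> Suc n \<Longrightarrow> \<bar>P x i\<bar> \<le> B"
    and c: "c > 0" "\<And>x. x \<in> sph n \<Longrightarrow> \<exists>i\<le>Suc n. \<bar>P x i\<bar> \<ge> c"
    and nonneg: "L \<ge> 0" "B \<ge> 0"
  obtains a :: "nat \<Rightarrow> real" where "\<And>i. i \<le> Suc n \<Longrightarrow> a i > 0"
    "\<And>x r. x \<in> sph n \<Longrightarrow> r \<ge> 0 \<Longrightarrow> \<exists>i\<le>Suc n. a i \<noteq> r * P x i"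
proof -
  \<comment> \<open>A Lipschitz constant for the map taking \<open>r x\<close> to
    \<open>r P x\<close>: \<open>B\<close> pays for the change of radius, the rest for the change of
    direction, where \<open>n + 1\<close> bounds the l1 norm of a unit vector.\<close>
  define K where "K = B + L * (real n + 1) + L"
  have cone: "\<bar>r * P x i - r' * P x' i\<bar> \<le> K * (\<Sum>j\<le>n. \<bar>r * x j - r' * x' j\<bar>)"
    if "r' \<le> r" "0 \<le> r'" "x \<in> sph n" "x' \<in> sph n" "i \<le> Suc n" for r r' x x' i
  proof -
    let ?D = "\<Sum>j\<le>n. \<bar>r * x j - r' * x' j\<bar>"
    have norm: "sqrt (\<Sum>i\<le>n. (s * z i)\<^sup>2) = s" if "z \<in> sph n" "s \<ge> 0" for s z
      using that by (simp add: power_mult_distrib sph_def flip: sum_distrib_left)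
    have "\<bar>r - r'\<bar> \<le> ?D"
      using L2_diff_le_l1[where n = n and y = "\<lambda>i. r * x i" and z = "\<lambda>i. r' * x' i"] that by (simp add: norm)
    have "(\<Sum>j\<le>n. \<bar>x j\<bar>) \<le> (\<Sum>j\<le>n. 1)"
      using sph_coord_le_1[OF that(3)] by (intro sum_mono) auto
    then have x1: "(\<Sum>j\<le>n. \<bar>x j\<bar>) \<le> real n + 1"
      by simp
    have "r' * (\<Sum>j\<le>n. \<bar>x j - x' j\<bar>) = (\<Sum>j\<le>n. \<bar>r' * x j - r' * x' j\<bar>)"
      using that by (simp add: sum_distrib_left abs_mult flip: right_diff_distrib)
    also have "\<dots> \<le> (\<Sum>j\<le>n. \<bar>r - r'\<bar> * \<bar>x j\<bar> + \<bar>r * x j - r' * x' j\<bar>)"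
    proof (rule sum_mono)
      fix j
      have "\<bar>r' * x j - r' * x' j\<bar> \<le> \<bar>(r - r') * x j\<bar> + \<bar>r * x j - r' * x' j\<bar>"
        by (simp add: left_diff_distrib)
      then show "\<bar>r' * x j - r' * x' j\<bar> \<le> \<bar>r - r'\<bar> * \<bar>x j\<bar> + \<bar>r * x j - r' * x' j\<bar>"
        by (simp add: abs_mult)
    qed
    also have "\<dots> = \<bar>r - r'\<bar> * (\<Sum>j\<le>n. \<bar>x j\<bar>) + ?D"
      by (simp add: sum.distrib sum_distrib_left)
    also have "\<dots> \<le> ?D * (real n + 1) + ?D"
      using \<open>\<bar>r - r'\<bar> \<le> ?D\<close> x1 by (intro add_mono mult_mono) (auto simp: sum_nonneg)
    finally have *: "r' * (\<Sum>j\<le>n. \<bar>x j - x' j\<bar>) \<le> ?D * (real n + 1) + ?D" .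
    have "\<bar>r * P x i - r' * P x' i\<bar> = \<bar>(r - r') * P x i + r' * (P x i - P x' i)\<bar>"
      by (simp add: algebra_simps)
    also have "\<dots> \<le> \<bar>r - r'\<bar> * \<bar>P x i\<bar> + r' * \<bar>P x i - P x' i\<bar>"
      using \<open>0 \<le> r'\<close> by (metis abs_mult abs_of_nonneg abs_triangle_ineq)
    also have "\<dots> \<le> ?D * B + r' * (L * (\<Sum>j\<le>n. \<bar>x j - x' j\<bar>))"
      using \<open>\<bar>r - r'\<bar> \<le> ?D\<close> that by (intro add_mono mult_mono L B mult_left_mono) (auto simp: sum_nonneg)
    also have "\<dots> = ?D * B + L * (r' * (\<Sum>j\<le>n. \<bar>x j - x' j\<bar>))"
      by simp
    also have "\<dots> \<le> ?D * B + L * (?D * (real n + 1) + ?D)"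
      using * nonneg by (intro add_mono mult_left_mono) auto
    also have "\<dots> = K * ?D"
      by (simp add: K_def algebra_simps)
    finally show ?thesis .
  qed
  note missing = that
  \<comment> \<open>Cells of side \<open>1 / (M T)\<close> will be so small that points of the cone
    over one cell have images closer than the grid mesh \<open>1 / M\<close>.\<close>
  obtain T :: nat where T: "K * (real n + 1) < T"
    using reals_Archimedean2 by blast
  \<comment> \<open>\<open>D\<close> bounds the relevant radii: if \<open>r P x\<close> lies in the
    unit cube, then \<open>r * c <= 1\<close>.\<close>
  obtain D :: nat where D: "1 / c < D"
    using reals_Archimedean2 by blast
  have "K \<ge> 0"
    using nonneg by (simp add: K_def)
  then have T0: "T > 0"
    using T by (metis add_nonneg_nonneg linorder_not_less mult_nonneg_nonneg not_gr0 of_nat_0 of_nat_0_le_iff zero_le_one)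
  have D0: "D > 0"
    using c(1) D by (metis not_gr0 less_asym of_nat_0 zero_less_divide_1_iff)
  \<comment> \<open>The grid has \<open>M ^ (n + 2)\<close> points, but there are at most
    \<open>(3 M T D) ^ (n + 1)\<close> cells. If every grid point were hit, \<open>M\<close> could
    not exceed \<open>(3 T D) ^ (n + 1)\<close>.\<close>
  define M where "M = (3 * T * D) ^ Suc n + 1"
  have M0: "M > 0" by (simp add: M_def)
  \<comment> \<open>\<open>q\<close> encodes the grid point with coordinates \<open>q i / M\<close>;
    they start at 1 because the missed point must have positive coordinates.\<close>
  define Q where "Q = PiE {..Suc n} (\<lambda>_. {1..M})"
  show thesis
  proof (rule ccontr)
    assume "\<not> thesis"
    then have no: "\<exists>x r. x \<in> sph n \<and> r \<ge> 0 \<and> (\<forall>i\<le>Suc n. a i = r * P x i)"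
      if "\<And>i. i \<le> Suc n \<Longrightarrow> a i > 0" for a :: "nat \<Rightarrow> real"
      using missing[of a] that \<open>\<not> thesis\<close> by meson
    have "\<forall>q. \<exists>x r. q \<in> Q \<longrightarrow> x \<in> sph n \<and> r \<ge> 0 \<and> (\<forall>i\<le>Suc n. real (q i) / real M = r * P x i)"
    proof
      fix q
      show "\<exists>x r. q \<in> Q \<longrightarrow> x \<in> sph n \<and> r \<ge> 0 \<and> (\<forall>i\<le>Suc n. real (q i) / real M = r * P x i)"
      proof (cases "q \<in> Q")
        case True
        then have "real (q i) / real M > 0" if "i \<le> Suc n" for i
          using that M0 by (auto simp: Q_def PiE_iff Suc_le_eq)
        then show ?thesis
          using no[of "\<lambda>i. real (q i) / real M"] by blast
      qed blast
    qed
    then have "\<exists>X R. \<forall>q\<in>Q. X q \<in> sph n \<and> R q \<ge> 0 \<and> (\<forall>i\<le>Suc n. real (q i) / real M = R q * P (X q) i)"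
      by metis
    then obtain X R where "\<forall>q\<in>Q. X q \<in> sph n \<and> R q \<ge> 0 \<and> (\<forall>i\<le>Suc n. real (q i) / real M = R q * P (X q) i)"
      by blast
    then have X: "X q \<in> sph n" "R q \<ge> 0"
      and XR: "\<And>i. i \<le> Suc n \<Longrightarrow> real (q i) / real M = R q * P (X q) i" if "q \<in> Q" for q
      using that by auto
    define cell where "cell q = (\<lambda>i\<in>{..n}. \<lfloor>R q * X q i * real M * real T\<rfloor>)" for q
    define Z where "Z = M * T * D"
    have cell_in: "cell q \<in> PiE {..n} (\<lambda>_. {- int Z..int Z})" if q: "q \<in> Q" for q
    proof -
      obtain i where i: "i \<le> Suc n" "\<bar>P (X q) i\<bar> \<ge> c"
        using c(2) X[OF q] by blast
      have "R q * c \<le> R q * \<bar>P (X q) i\<bar>"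
        using i X[OF q] by (intro mult_left_mono) auto
      also have "\<dots> = \<bar>real (q i) / real M\<bar>"
        using XR[OF q i(1)] X[OF q] by (simp add: abs_mult)
      also have "\<dots> \<le> 1"
        using q i M0 by (auto simp: Q_def PiE_iff)
      finally have "R q \<le> real D"
        using D c(1) by (smt (verit, best) mult_le_cancel_right_pos nonzero_divide_eq_eq)
      have "\<bar>R q * X q i * real M * real T\<bar> \<le> real Z" for i
      proof -
        have "\<bar>R q * X q i * real M * real T\<bar> = (R q * \<bar>X q i\<bar>) * (real M * real T)"
          using X[OF q] by (simp add: abs_mult)
        also have "\<dots> \<le> (real D * 1) * (real M * real T)"
          using \<open>R q \<le> real D\<close> X[OF q] sph_coord_le_1 by (intro mult_mono mult_right_mono) auto
        finally show ?thesis by (simp add: Z_def mult_ac)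
      qed
      then have "- real Z \<le> R q * X q i * real M * real T \<and> R q * X q i * real M * real T \<le> real Z" for i
        using abs_le_iff by (metis minus_le_iff)
      then have "- int Z \<le> \<lfloor>R q * X q i * real M * real T\<rfloor> \<and> \<lfloor>R q * X q i * real M * real T\<rfloor> \<le> int Z" for i
        by (simp add: le_floor_iff floor_le_iff) (smt (verit, best))
      then show ?thesis
        by (auto simp: cell_def)
    qed
    \<comment> \<open>Grid points whose preimages share a cell are closer than the mesh in every
      coordinate, hence equal.\<close>
    have inj: "inj_on cell Q"
    proof (rule inj_onI)
      fix q q' assume q: "q \<in> Q" "q' \<in> Q" "cell q = cell q'"
      have near: "\<bar>R q * X q j - R q' * X q' j\<bar> \<le> 1 / (real M * real T)" if "j \<le> n" for j
      proof -
        have "\<lfloor>R q * X q j * real M * real T\<rfloor> = \<lfloor>R q' * X q' j * real M * real T\<rfloor>"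
          using fun_cong[OF q(3), of j] that by (simp add: cell_def)
        then have "\<bar>R q * X q j * real M * real T - R q' * X q' j * real M * real T\<bar> \<le> 1"
          by linarith
        then have "\<bar>(R q * X q j - R q' * X q' j) * (real M * real T)\<bar> \<le> 1"
          by (simp add: algebra_simps)
        then have "\<bar>R q * X q j - R q' * X q' j\<bar> * (real M * real T) \<le> 1"
          by (simp add: abs_mult)
        then show ?thesis
          using M0 T0 by (simp add: field_simps)
      qed
      have "(\<Sum>j\<le>n. \<bar>R q * X q j - R q' * X q' j\<bar>) \<le> (\<Sum>j\<le>n. 1 / (real M * real T))"
        by (intro sum_mono near) auto
      then have D1: "(\<Sum>j\<le>n. \<bar>R q * X q j - R q' * X q' j\<bar>) \<le> (real n + 1) / (real M * real T)"
        by (simp add: add.commute)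
      have "q i = q' i" if i: "i \<le> Suc n" for i
      proof -
        have "\<bar>R q * P (X q) i - R q' * P (X q') i\<bar> \<le> K * (\<Sum>j\<le>n. \<bar>R q * X q j - R q' * X q' j\<bar>)"
        proof (cases "R q' \<le> R q")
          case True
          then show ?thesis using cone X q i by blast
        next
          case False
          then show ?thesis
            using cone[of "R q" "R q'" "X q'" "X q" i] X q i by (simp add: abs_minus_commute)
        qed
        also have "\<dots> \<le> K * ((real n + 1) / (real M * real T))"
          using D1 \<open>K \<ge> 0\<close> by (rule mult_left_mono)
        also have "\<dots> = (K * (real n + 1)) / (real M * real T)"
          by simp
        also have "\<dots> < real T / (real M * real T)"
          using T M0 T0 by (intro divide_strict_right_mono) auto
        also have "\<dots> = 1 / real M"
          using T0 by simp
        finally have "\<bar>real (q i) / real M - real (q' i) / real M\<bar> < 1 / real M"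
          using XR[OF q(1) i] XR[OF q(2) i] by simp
        then have "\<bar>real (q i) - real (q' i)\<bar> < 1"
          using M0 by (simp add: divide_simps flip: diff_divide_distrib)
        then show ?thesis by linarith
      qed
      then show "q = q'"
        using q by (intro PiE_ext[of q "{..Suc n}" _ q']) (auto simp: Q_def)
    qed
    have "card Q \<le> card (PiE {..n} (\<lambda>_. {- int Z..int Z}))"
      using cell_in by (intro card_inj_on_le[OF inj]) (auto intro: finite_PiE)
    moreover have "card {- int Z..int Z} = 2 * Z + 1"
      by simp
    ultimately have "M ^ Suc (Suc n) \<le> (2 * Z + 1) ^ Suc n"
      by (simp only: Q_def card_PiE finite_atMost prod_constant card_atMost card_atLeastAtMost) simp
    also have "\<dots> \<le> (3 * Z) ^ Suc n"
      using M0 T0 D0 by (intro power_mono) (auto simp: Z_def Suc_le_eq)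
    also have "\<dots> = M ^ Suc n * (3 * T * D) ^ Suc n"
      by (simp add: Z_def power_mult_distrib mult_ac)
    finally have "M \<le> (3 * T * D) ^ Suc n"
      using M0 by simp
    then show False
      by (simp add: M_def)
  qed
qed

text \<open>Taking the odd part of an approximation costs nothing: \<open>f\<close> is its own odd
  part, and the antipodal map preserves the distance.\<close>

lemma odd_lipschitz_approximation_on_sph:
  assumes f: "continuous_on (sph n) f" and odd: "\<And>x. x \<in> sph n \<Longrightarrow> f (\<lambda>i. - x i) = - f x" and "e > 0"
  shows "\<exists>g L. (\<forall>x\<in>sph n. \<forall>y\<in>sph n. \<bar>g x - g y\<bar> \<le> L * (\<Sum>i\<le>n. \<bar>x i - y i\<bar>)) \<and>
           continuous_on (sph n) g \<and> (\<forall>x. g (\<lambda>i. - x i) = - g x) \<and> (\<forall>x\<in>sph n. \<bar>f x - g x\<bar> < e)"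
proof -
  obtain g L where g: "\<And>x y. x \<in> sph n \<Longrightarrow> y \<in> sph n \<Longrightarrow> \<bar>g x - g y\<bar> \<le> L * (\<Sum>i\<le>n. \<bar>x i - y i\<bar>)"
    "continuous_on (sph n) g" "\<And>x. x \<in> sph n \<Longrightarrow> \<bar>f x - g x\<bar> < e"
    using lipschitz_approximation_on_sph[OF f \<open>e > 0\<close>] by blast
  define h where "h x = (g x - g (\<lambda>i. - x i)) / 2" for x
  have "\<bar>h x - h y\<bar> \<le> L * (\<Sum>i\<le>n. \<bar>x i - y i\<bar>)" if "x \<in> sph n" "y \<in> sph n" for x y
    using g(1)[OF that] g(1)[OF that[THEN uminus_in_sph]]
    by (simp add: h_def abs_minus_commute field_simps)
  moreover have "continuous_on (sph n) h"
    unfolding h_def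
    by (intro continuous_intros g continuous_on_compose2[OF g(2), where f = "\<lambda>x i. - x i"]
        continuous_on_coordinatewise_then_product continuous_on_apply)
      (auto simp: uminus_in_sph)
  moreover have "\<bar>f x - h x\<bar> < e" if "x \<in> sph n" for x
    using g(3)[OF that] g(3)[OF uminus_in_sph[OF that]] odd[OF that]
    by (simp add: h_def field_simps)
  moreover have "h (\<lambda>i. - x i) = - h x" for x
    by (simp add: h_def field_simps)
  ultimately show ?thesis
    by (intro exI[of _ h] exI[of _ L] conjI ballI allI) auto
qed

text \<open>
  A Lipschitz approximation of \<open>f\<close> misses some line on the equator, so it can be pushed off that line
  along a direction that moves the image of the equator into the equatorial hyperplane. The cut-off
  \<open>cut\<close> is 1 on the equator and vanishes where the pushed map would vanish.
\<close>

lemma odd_map_homotopic_equator_preserving: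
  assumes f: "continuous_on (sph (Suc n)) f" "f ` sph (Suc n) \<subseteq> sph (Suc n)"
    and odd: "\<And>x. x \<in> sph (Suc n) \<Longrightarrow> f (\<lambda>i. - x i) = (\<lambda>i. - f x i)"
  obtains g where "continuous_on (sph (Suc n)) g" "g ` sph (Suc n) \<subseteq> sph (Suc n)"
    "\<And>x. x \<in> sph (Suc n) \<Longrightarrow> g (\<lambda>i. - x i) = (\<lambda>i. - g x i)" "g ` sph n \<subseteq> sph n"
    "Brouwer_degree2 (Suc n) f = Brouwer_degree2 (Suc n) g"
proof -
  define m where "m = Suc n"
  \<comment> \<open>A unit vector with \<open>m + 1\<close> coordinates has one of modulus at least
    \<open>1 / (m + 1) = 2 * e\<close>. An approximation within \<open>e\<close> in each coordinate,
    and the whole segment leading to it, therefore avoids 0.\<close>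
  define e where "e = 1 / (2 * (real m + 1))"
  have e: "e > 0" by (simp add: e_def)
  define A where "A i g L \<longleftrightarrow> (\<forall>x\<in>sph m. \<forall>y\<in>sph m. \<bar>g x - g y\<bar> \<le> L * (\<Sum>i\<le>m. \<bar>x i - y i\<bar>)) \<and>
      continuous_on (sph m) g \<and> (\<forall>x. g (\<lambda>i. - x i) = - g x) \<and> (\<forall>x\<in>sph m. \<bar>f x i - g x\<bar> < e)" for i g L
  have "\<exists>g L. A i g L" for i
    unfolding A_def
    using f odd e by (intro odd_lipschitz_approximation_on_sph continuous_on_coord[of _ f]) (auto simp: m_def)
  then obtain G L where "\<And>i. A i (G i) (L i)"
    by metis
  then have
    GL: "\<And>i x y. x \<in> sph m \<Longrightarrow> y \<in> sph m \<Longrightarrow> \<bar>G i x - G i y\<bar> \<le> L i * (\<Sum>i\<le>m. \<bar>x i - y i\<bar>)"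
    and Gc: "\<And>i. continuous_on (sph m) (G i)"
    and Godd: "\<And>i x. G i (\<lambda>i. - x i) = - G i x"
    and Gapp: "\<And>i x. x \<in> sph m \<Longrightarrow> \<bar>f x i - G i x\<bar> < e"
    by (simp_all add: A_def)
  define P where "P x = (\<lambda>i. if i \<le> m then G i x else 0)" for x
  have Pc: "continuous_on (sph m) P"
  proof (rule continuous_on_coordinatewise_then_product)
    show "continuous_on (sph m) (\<lambda>x. P x i)" for i
      using Gc by (cases "i \<le> m") (simp_all add: P_def)
  qed
  have Podd: "P (\<lambda>i. - x i) = (\<lambda>i. - P x i)" for x
    by (auto simp: P_def Godd)
  have Papp: "\<bar>f x i - P x i\<bar> < e" if "x \<in> sph m" for x i
  proof (cases "i \<le> m")
    case False
    have "f x \<in> sph m"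
      using f(2) that by (auto simp: m_def)
    with False e show ?thesis
      by (simp add: P_def sph_def)
  qed (use Gapp[OF that, of i] in \<open>simp add: P_def\<close>)
  have big: "\<exists>i\<le>m. \<bar>f x i\<bar> \<ge> 2 * e" if x: "x \<in> sph m" for x
  proof (rule ccontr)
    assume "\<not> ?thesis"
    then have lt: "\<And>i. i \<le> m \<Longrightarrow> \<bar>f x i\<bar> < 2 * e" by force
    have fx: "f x \<in> sph m" using f x by (auto simp: m_def)
    have "1 = (\<Sum>i\<le>m. (f x i)\<^sup>2)"
      using fx by (simp add: sph_def)
    also have "\<dots> \<le> (\<Sum>i\<le>m. \<bar>f x i\<bar>)"
    proof (rule sum_mono)
      fix i
      have "\<bar>f x i\<bar> * \<bar>f x i\<bar> \<le> \<bar>f x i\<bar> * 1"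
        using sph_coord_le_1[OF fx] by (intro mult_left_mono) auto
      then show "(f x i)\<^sup>2 \<le> \<bar>f x i\<bar>"
        by (simp add: power2_eq_square)
    qed
    also have "\<dots> < (\<Sum>i\<le>m. 2 * e)"
      using lt by (intro sum_strict_mono) auto
    also have "\<dots> = 1"
      by (simp add: e_def)
    finally show False by simp
  qed
  have Pbig: "\<exists>i\<le>m. \<bar>P x i\<bar> \<ge> e" if x: "x \<in> sph m" for x
    using big[OF x] Papp[OF x] by (smt (verit, best))
  define L' where "L' = (\<Sum>i\<le>m. \<bar>L i\<bar>)"
  have L': "\<bar>P x i - P y i\<bar> \<le> L' * (\<Sum>j\<le>n. \<bar>x j - y j\<bar>)" if "x \<in> sph n" "y \<in> sph n" "i \<le> Suc n" for x y i
  proof -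
    have xy: "x \<in> sph m" "y \<in> sph m"
      using that sph_mono[of n m] by (auto simp: m_def)
    have "\<bar>P x i - P y i\<bar> \<le> L i * (\<Sum>i\<le>m. \<bar>x i - y i\<bar>)"
      using GL[OF xy, of i] that by (simp add: P_def m_def)
    also have "\<dots> = L i * (\<Sum>i\<le>n. \<bar>x i - y i\<bar>)"
      using that by (simp add: m_def sph_def)
    also have "\<dots> \<le> L' * (\<Sum>i\<le>n. \<bar>x i - y i\<bar>)"
    proof (rule mult_right_mono)
      have "\<bar>L i\<bar> \<le> L'"
        unfolding L'_def using that by (intro member_le_sum) (auto simp: m_def)
      then show "L i \<le> L'" by simp
    qed (simp add: sum_nonneg)
    finally show ?thesis .
  qed
  have B: "\<bar>P x i\<bar> \<le> 1 + e" if "x \<in> sph n" for x i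
  proof -
    have x: "x \<in> sph m" using that sph_mono[of n m] by (auto simp: m_def)
    then have "\<bar>f x i\<bar> \<le> 1"
      using f by (intro sph_coord_le_1[of _ m]) (auto simp: m_def)
    then show ?thesis using Papp[OF x, of i] by linarith
  qed
  obtain a where a: "\<And>i. i \<le> Suc n \<Longrightarrow> a i > 0"
    and miss: "\<And>x r. x \<in> sph n \<Longrightarrow> r \<ge> 0 \<Longrightarrow> \<exists>i\<le>Suc n. a i \<noteq> r * P x i"
  proof (rule lipschitz_sph_cone_misses_point[of n P L' "1 + e" e])
    show "\<exists>i\<le>Suc n. e \<le> \<bar>P x i\<bar>" if "x \<in> sph n" for x
      using Pbig[of x] that sph_mono[of n m] by (auto simp: m_def)
  qed (use L' B e in \<open>auto simp: L'_def sum_nonneg\<close>)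
  \<comment> \<open>For negative \<open>r\<close> the antipode of \<open>x\<close> takes over, as
    \<open>P\<close> is odd: \<open>a\<close> lies off the whole line through \<open>P x\<close>,
    not only off the ray.\<close>
  have miss': "\<exists>i\<le>m. a i \<noteq> r * P x i" if x: "x \<in> sph n" for x r
  proof (cases "r \<ge> 0")
    case True
    then show ?thesis using miss[OF x] unfolding m_def by blast
  next
    case False
    then obtain i where "i \<le> Suc n" "a i \<noteq> - r * P (\<lambda>i. - x i) i"
      using miss[OF uminus_in_sph[OF x], of "-r"] by auto
    then show ?thesis
      by (auto simp: m_def Podd)
  qed
  define a' where "a' i = (if i \<le> m then a i / a m else 0)" for i
  have am: "a m > 0" using a by (simp add: m_def)
  \<comment> \<open>Since \<open>a' m = 1\<close>, this is the projection of \<open>P x\<close>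
    along \<open>a\<close> onto the hyperplane where coordinate \<open>m\<close> vanishes.\<close>
  define Q where "Q x i = P x i - P x m * a' i" for x i
  \<comment> \<open>A zero on the equator would make \<open>P x\<close> a nonzero multiple of
    \<open>a\<close>, which the choice of \<open>a\<close> excludes.\<close>
  have Q0: "\<exists>i\<le>m. Q x i \<noteq> 0" if "x \<in> sph n" for x
  proof (rule ccontr)
    assume *: "\<not> ?thesis"
    have Q: "P x i = P x m / a m * a i" if "i \<le> m" for i
    proof -
      have "Q x i = 0"
        using * that by blast
      then show ?thesis
        using that by (simp add: Q_def a'_def)
    qed
    have "x \<in> sph m"
      using that sph_mono[of n m] by (auto simp: m_def)
    then have "P x m \<noteq> 0"
      using Pbig[of x] Q e by fastforce
    then have "a i = a m / P x m * P x i" if "i \<le> m" for i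
      using Q[OF that] am by simp
    then show False
      using miss'[OF \<open>x \<in> sph n\<close>] by blast
  qed
  define q where "q x = (\<Sum>i\<le>m. (Q x i)\<^sup>2)" for x
  define cut where "cut x = q x / (q x + (x m)\<^sup>2)" for x
  have sph_n: "x \<in> sph n" if "x \<in> sph m" "x m = 0" for x
    using topspace_nsphere_minus1[of x m] that by (simp add: nsphere_eq_top_of_set m_def)
  have qpos: "q x + (x m)\<^sup>2 > 0" if "x \<in> sph m" for x
  proof (cases "x m = 0")
    case True
    then have "q x > 0"
      unfolding q_def using Q0 sph_n that by (subst sum_squares_pos_iff) auto
    then show ?thesis by (simp add: add_pos_nonneg)
  qed (simp add: add_nonneg_pos q_def sum_nonneg)
  have Qc: "continuous_on (sph m) (\<lambda>x. Q x i)" for i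
    unfolding Q_def by (intro continuous_intros continuous_on_coord[OF Pc])
  have cut_cont: "continuous_on (sph m) cut"
    unfolding cut_def q_def
    by (intro continuous_intros Qc continuous_on_apply) (use qpos in \<open>force simp: q_def\<close>)
  define h1 where "h1 = (\<lambda>(t, x) i. (1 - t) * f x i + t * P x i)"
  define h2 where "h2 = (\<lambda>(t, x) i. P x i - t * cut x * P x m * a' i)"
  have h1nz: "\<exists>i\<le>m. h1 (t, x) i \<noteq> 0" if t: "t \<in> {0..1}" and x: "x \<in> sph m" for t x
  proof -
    obtain i where i: "i \<le> m" "\<bar>f x i\<bar> \<ge> 2 * e" using big[OF x] by blast
    have "h1 (t, x) i = f x i - t * (f x i - P x i)"
      by (simp add: h1_def algebra_simps)
    moreover have "\<bar>t * (f x i - P x i)\<bar> \<le> 1 * e"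
      unfolding abs_mult using t Papp[OF x, of i] by (intro mult_mono) auto
    ultimately have "h1 (t, x) i \<noteq> 0"
      using i e by linarith
    with i show ?thesis by blast
  qed
  \<comment> \<open>At a zero, coordinate \<open>m\<close> forces \<open>t * cut x = 1\<close>; then
    \<open>Q x\<close> vanishes, so \<open>cut x\<close> is 0, a contradiction.\<close>
  have h2nz: "\<exists>i\<le>m. h2 (t, x) i \<noteq> 0" if t: "t \<in> {0..1}" and x: "x \<in> sph m" for t x
  proof (rule ccontr)
    assume "\<not> ?thesis"
    then have "\<forall>i\<le>m. h2 (t, x) i = 0"
      by blast
    then have *: "P x i = t * cut x * P x m * a' i" if "i \<le> m" for i
    proof -
      have "h2 (t, x) i = 0"
        using \<open>\<forall>i\<le>m. h2 (t, x) i = 0\<close> that by blast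
      then show ?thesis
        unfolding h2_def prod.case by (rule eq_iff_diff_eq_0[THEN iffD2])
    qed
    have am': "a' m = 1" using am by (simp add: a'_def)
    obtain i where i: "i \<le> m" "\<bar>P x i\<bar> \<ge> e"
      using Pbig[OF x] by blast
    have "P x m \<noteq> 0"
    proof
      assume "P x m = 0"
      then have "P x i = 0"
        by (subst *[OF i(1)]) simp
      with i(2) e show False by simp
    qed
    then have "t * cut x = 1"
      using *[of m] am' by simp
    then have "Q x i = 0" if "i \<le> m" for i
      unfolding Q_def *[OF that] using \<open>t * cut x = 1\<close> by simp
    then have "cut x = 0"
      by (simp add: cut_def q_def)
    with \<open>t * cut x = 1\<close> show False by simp
  qed
  have f_m: "continuous_on (sph m) f" "\<And>x. x \<in> sph m \<Longrightarrow> f x \<in> sph m"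
    using f by (auto simp: m_def)
  have snd_c: "continuous_on ({0..1} \<times> sph m) (\<lambda>z. F (snd z))" if "continuous_on (sph m) F"
    for F :: "(nat \<Rightarrow> real) \<Rightarrow> 'b::topological_space"
    by (rule continuous_on_compose2[OF that]) (auto intro: continuous_intros)
  have d1: "Brouwer_degree2 m (\<lambda>x. sph_normalize m (h1 (0, x))) = Brouwer_degree2 m (\<lambda>x. sph_normalize m (h1 (1, x)))"
  proof (rule Brouwer_degree2_homotopy_nonvanishing)
    show "continuous_on ({0..1} \<times> sph m) h1"
      unfolding h1_def case_prod_unfold
      by (intro continuous_on_coordinatewise_then_product continuous_intros snd_c continuous_on_coord[OF f_m(1)] continuous_on_coord[OF Pc])
    show "h1 (t, x) i = 0" if "x \<in> sph m" "i > m" for t x i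
      using f_m(2)[OF that(1)] that by (simp add: h1_def P_def sph_def)
  qed (use h1nz in auto)
  have d2: "Brouwer_degree2 m (\<lambda>x. sph_normalize m (h2 (0, x))) = Brouwer_degree2 m (\<lambda>x. sph_normalize m (h2 (1, x)))"
  proof (rule Brouwer_degree2_homotopy_nonvanishing)
    show "continuous_on ({0..1} \<times> sph m) h2"
      unfolding h2_def case_prod_unfold
      by (intro continuous_on_coordinatewise_then_product continuous_intros snd_c cut_cont continuous_on_coord[OF Pc])
    show "h2 (t, x) i = 0" if "x \<in> sph m" "i > m" for t x i
      using that by (simp add: h2_def P_def a'_def)
  qed (use h2nz in auto)
  define g where "g x = sph_normalize m (h2 (1, x))" for x
  show thesis
  proof (rule that[of g]; (unfold m_def[symmetric])?)
    show "continuous_on (sph m) g"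
      unfolding g_def
    proof (rule continuous_on_sph_normalize)
      show "continuous_on (sph m) (\<lambda>x. h2 (1, x))"
        unfolding h2_def case_prod_unfold
        by (auto intro!: continuous_on_coordinatewise_then_product continuous_intros cut_cont continuous_on_coord[OF Pc])
    qed (rule h2nz, auto)
    show "g ` sph m \<subseteq> sph m"
    proof clarify
      fix x assume "x \<in> sph m"
      then show "g x \<in> sph m"
        unfolding g_def by (intro sph_normalize_in_sph h2nz) (auto simp: h2_def P_def a'_def)
    qed
    show "g (\<lambda>i. - x i) = (\<lambda>i. - g x i)" if "x \<in> sph m" for x
    proof -
      have "Q (\<lambda>i. - x i) i = - Q x i" for i
        by (simp add: Q_def Podd)
      then have "cut (\<lambda>i. - x i) = cut x"
        by (simp add: cut_def q_def)
      then have "h2 (1, \<lambda>i. - x i) = (\<lambda>i. - h2 (1, x) i)"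
        by (simp add: h2_def Podd)
      then show ?thesis
        by (simp add: g_def sph_normalize_uminus)
    qed
    show "g ` sph n \<subseteq> sph n"
    proof (clarify)
      fix x assume x: "x \<in> sph n"
      then have xm: "x \<in> sph m" "x m = 0"
        using sph_mono[of n m] by (auto simp: m_def sph_def)
      then have "g x \<in> sph m"
        using \<open>g ` sph m \<subseteq> sph m\<close> by auto
      moreover have "cut x = 1"
        using qpos[OF xm(1)] xm by (simp add: cut_def)
      then have "g x m = 0"
        using am by (simp add: g_def sph_normalize_def h2_def a'_def)
      ultimately show "g x \<in> sph n" by (rule sph_n)
    qed
    have "Brouwer_degree2 m f = Brouwer_degree2 m (\<lambda>x. sph_normalize m (h1 (0, x)))"
      by (rule Brouwer_degree2_eq) (auto simp: h1_def nsphere_eq_top_of_set sph_normalize_id f_m)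
    also have "\<dots> = Brouwer_degree2 m (\<lambda>x. sph_normalize m (h2 (0, x)))"
      unfolding d1 by (simp add: h1_def h2_def)
    also have "\<dots> = Brouwer_degree2 m g"
      unfolding d2 g_def ..
    finally show "Brouwer_degree2 m f = Brouwer_degree2 m g" .
  qed
qed

text \<open>Borsuk's theorem by induction on the dimension: once the map is deformed to preserve the
  equator, its degree has the parity of the degree of its restriction. An odd self-map of the two
  points of \<open>sph 0\<close> is the identity or the reflection.\<close>

theorem odd_Brouwer_degree2_of_odd_map:
  assumes "continuous_on (sph n) f" "f ` sph n \<subseteq> sph n"
    and "\<And>x. x \<in> sph n \<Longrightarrow> f (\<lambda>i. - x i) = (\<lambda>i. - f x i)"
  shows "odd (Brouwer_degree2 n f)"
  using assms
proof (induction n arbitrary: f)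
  case 0
  define p :: "nat \<Rightarrow> real" where "p = (\<lambda>i. if i = 0 then 1 else 0)"
  have sph0: "sph 0 = {p, \<lambda>i. - p i}"
  proof -
    have "x = p \<or> x = (\<lambda>i. - p i)" if "x \<in> sph 0" for x
      using that by (auto simp: sph_def p_def fun_eq_iff power2_eq_1_iff)
    moreover have "p \<in> sph 0"
      by (simp add: sph_def p_def)
    ultimately show ?thesis
      using uminus_in_sph by blast
  qed
  then consider "f p = p" | "f p = (\<lambda>i. - p i)"
    using 0(2) by blast
  then show ?case
  proof cases
    case 1
    then have "Brouwer_degree2 0 f = Brouwer_degree2 0 id"
      using 0(3)[of p] sph0 by (intro Brouwer_degree2_eq) (auto simp: nsphere_eq_top_of_set)
    then show ?thesis by simp
  next
    case 2
    then have "Brouwer_degree2 0 f = Brouwer_degree2 0 (\<lambda>x i. if i = 0 then -x i else x i)"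
      using 0(3)[of p] sph0 by (intro Brouwer_degree2_eq) (auto simp: nsphere_eq_top_of_set p_def)
    then show ?thesis by (simp add: Brouwer_degree2_reflection)
  qed
next
  case (Suc n)
  obtain g where g: "continuous_on (sph (Suc n)) g" "g ` sph (Suc n) \<subseteq> sph (Suc n)"
    "\<And>x. x \<in> sph (Suc n) \<Longrightarrow> g (\<lambda>i. - x i) = (\<lambda>i. - g x i)" "g ` sph n \<subseteq> sph n"
    "Brouwer_degree2 (Suc n) f = Brouwer_degree2 (Suc n) g"
    using odd_map_homotopic_equator_preserving[OF Suc.prems] by blast
  have "odd (Brouwer_degree2 n g)"
    using g sph_mono[of n "Suc n"]
    by (intro Suc.IH) (auto intro: continuous_on_subset)
  moreover have "even (Brouwer_degree2 (Suc n) g - Brouwer_degree2 (Suc n - Suc 0) g)"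
    using g by (intro Borsuk_odd_mapping_degree_step) (auto simp: nsphere_eq_top_of_set)
  ultimately show ?case
    using g(5) by simp
qed

section \<open>Degree of a cyclic shift of the coordinates\<close>

definition transpose_coords :: "nat \<Rightarrow> (nat \<Rightarrow> real) \<Rightarrow> nat \<Rightarrow> real" where
  "transpose_coords j x = x \<circ> Transposition.transpose 0 j"

lemma transpose_coords_in_sph:
  assumes "j \<le> n" "x \<in> sph n"
  shows "transpose_coords j x \<in> sph n"
proof -
  have "(\<Sum>i\<le>n. (x (Transposition.transpose 0 j i))\<^sup>2) = (\<Sum>i\<le>n. (x i)\<^sup>2)"
    using assms(1) by (intro sum.permute[symmetric, unfolded o_def] permutes_swap_id) auto
  then show ?thesis
    using assms by (auto simp: transpose_coords_def sph_def Transposition.transpose_def)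
qed

lemma continuous_on_transpose_coords: "continuous_on S (transpose_coords j)"
  unfolding transpose_coords_def o_def
  by (intro continuous_on_coordinatewise_then_product continuous_on_apply)

text \<open>A path of reflections in the plane of coordinates \<open>0\<close> and \<open>j\<close>
  leads from the sign change of coordinate \<open>0\<close> to the swap.\<close>

lemma Brouwer_degree2_transpose_coords:
  assumes j: "0 < j" "j \<le> n"
  shows "Brouwer_degree2 n (transpose_coords j) = -1"
proof -
  define h :: "real \<times> (nat \<Rightarrow> real) \<Rightarrow> nat \<Rightarrow> real" where
    "h = (\<lambda>(t, x) i. if i = 0 then - cos (t * (pi / 2)) * x 0 + sin (t * (pi / 2)) * x j
       else if i = j then sin (t * (pi / 2)) * x 0 + cos (t * (pi / 2)) * x j else x i)"
  have "Brouwer_degree2 n (\<lambda>x. h (0, x)) = Brouwer_degree2 n (\<lambda>x. h (1, x))"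
  proof (rule Brouwer_degree2_homotopy_on)
    show "continuous_on ({0..1} \<times> sph n) h"
    proof (rule continuous_on_coordinatewise_then_product)
      fix i
      consider "i = 0" | "i \<noteq> 0" "i = j" | "i \<noteq> 0" "i \<noteq> j" by blast
      then show "continuous_on ({0..1} \<times> sph n) (\<lambda>z. h z i)"
        by cases (auto simp: h_def case_prod_unfold intro!: continuous_intros continuous_on_coord[OF continuous_on_snd])
    qed
    show "h (t, x) \<in> sph n" if x: "x \<in> sph n" for t x
    proof -
      have split: "(\<Sum>i\<le>n. F i) = F 0 + F j + (\<Sum>i\<in>{..n} - {0, j}. F i)" for F :: "nat \<Rightarrow> real"
        using j by (subst sum.subset_diff[of "{0, j}"]) auto
      define c s where "c = cos (t * (pi / 2))" and "s = sin (t * (pi / 2))"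
      have cs: "c\<^sup>2 + s\<^sup>2 = 1"
        by (simp add: c_def s_def)
      have "(- c * x 0 + s * x j)\<^sup>2 + (s * x 0 + c * x j)\<^sup>2 = (c\<^sup>2 + s\<^sup>2) * ((x 0)\<^sup>2 + (x j)\<^sup>2)"
        by (simp add: power2_eq_square algebra_simps)
      moreover have "h (t, x) = (\<lambda>i. if i = 0 then - c * x 0 + s * x j else if i = j then s * x 0 + c * x j else x i)"
        unfolding h_def c_def s_def by simp
      ultimately have "(\<Sum>i\<le>n. (h (t, x) i)\<^sup>2) = (\<Sum>i\<le>n. (x i)\<^sup>2)"
        using j unfolding split cs by simp
      then show ?thesis
        using x j by (auto simp: sph_def h_def)
    qed
  qed
  also have "(\<lambda>x. h (1, x)) = transpose_coords j"
    using j by (auto simp: h_def transpose_coords_def Transposition.transpose_def fun_eq_iff)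
  also have "(\<lambda>x. h (0, x)) = (\<lambda>x i. if i = 0 then - x i else x i)"
    by (auto simp: h_def fun_eq_iff)
  finally show ?thesis
    by (simp add: Brouwer_degree2_reflection)
qed

definition cycle_coords :: "nat \<Rightarrow> (nat \<Rightarrow> real) \<Rightarrow> nat \<Rightarrow> real" where
  "cycle_coords m x i = (if i = 0 then x m else if i \<le> m then x (i - 1) else x i)"

lemma cycle_coords_0: "cycle_coords 0 = id"
  by (auto simp: cycle_coords_def fun_eq_iff)

text \<open>Each further coordinate in the cycle costs one transposition, hence a factor -1 in the
  degree.\<close>

lemma cycle_coords_Suc: "cycle_coords (Suc m) = transpose_coords (Suc m) \<circ> cycle_coords m"
  by (auto simp: cycle_coords_def transpose_coords_def Transposition.transpose_def fun_eq_iff)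

lemma cycle_coords_in_sph:
  assumes "m \<le> n" "x \<in> sph n"
  shows "cycle_coords m x \<in> sph n"
  using assms
  by (induction m) (auto simp: cycle_coords_0 cycle_coords_Suc transpose_coords_in_sph)

lemma continuous_on_cycle_coords: "continuous_on S (cycle_coords m)"
proof (induction m)
  case (Suc m)
  then show ?case
    unfolding cycle_coords_Suc by (rule continuous_on_compose) (rule continuous_on_transpose_coords)
qed (simp add: cycle_coords_0 continuous_on_id)

lemma Brouwer_degree2_cycle_coords:
  assumes "m \<le> n"
  shows "Brouwer_degree2 n (cycle_coords m) = (-1) ^ m"
  using assms
proof (induction m)
  case (Suc m)
  have "Brouwer_degree2 n (cycle_coords (Suc m)) =
      Brouwer_degree2 n (transpose_coords (Suc m)) * Brouwer_degree2 n (cycle_coords m)"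
    unfolding cycle_coords_Suc using Suc.prems
    by (intro Brouwer_degree2_compose)
      (auto simp: nsphere_eq_top_of_set continuous_on_cycle_coords continuous_on_transpose_coords
        cycle_coords_in_sph transpose_coords_in_sph)
  then show ?case
    using Suc by (simp add: Brouwer_degree2_transpose_coords)
qed (simp add: cycle_coords_0)

section \<open>Smooth functions\<close>

text \<open>The gradient as a vector, built from the very partial derivatives that occur in
  \<open>Ck\<close> and \<open>weak_gradient\<close>.\<close>

definition nabla :: "(real ^ 'n::finite \<Rightarrow> real) \<Rightarrow> real ^ 'n \<Rightarrow> real ^ 'n" where
  "nabla f x = (\<chi> i. frechet_derivative f (at x) (axis i 1))"

lemma inner_nabla:
  assumes "f differentiable (at x)"
  shows "nabla f x \<bullet> h = frechet_derivative f (at x) h"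
proof -
  interpret linear "frechet_derivative f (at x)"
    using assms by (rule linear_frechet_derivative)
  have "frechet_derivative f (at x) h = frechet_derivative f (at x) (\<Sum>i\<in>UNIV. h $ i *\<^sub>R axis i 1)"
    using basis_expansion[of h] by (simp add: scalar_mult_eq_scaleR)
  also have "\<dots> = (\<Sum>i\<in>UNIV. h $ i * frechet_derivative f (at x) (axis i 1))"
    by (simp add: sum scaleR)
  finally show ?thesis
    by (simp add: inner_vec_def nabla_def mult.commute)
qed

lemma has_derivative_nabla:
  assumes "f differentiable (at x)"
  shows "(f has_derivative (\<lambda>h. nabla f x \<bullet> h)) (at x)"
  using assms by (simp add: inner_nabla flip: frechet_derivative_works)

lemma nabla_eqI:
  assumes "(f has_derivative (\<lambda>h. g \<bullet> h)) (at x)"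
  shows "nabla f x = g"
  using frechet_derivative_at[OF assms, symmetric]
  by (simp add: nabla_def vec_eq_iff inner_axis)

lemma Ck_Suc_nabla: "Ck (Suc m) f \<longleftrightarrow> (\<forall>x. f differentiable (at x)) \<and> (\<forall>i. Ck m (\<lambda>x. nabla f x $ i))"
  by (simp add: nabla_def)

declare Ck.simps(2) [simp del]

text \<open>The closure properties rest on this criterion: an explicit gradient is exhibited whose
  components are of class \<open>Ck m\<close> by induction.\<close>

lemma Ck_SucI:
  assumes "\<And>x. (f has_derivative (\<lambda>h. g x \<bullet> h)) (at x)" "\<And>i. Ck m (\<lambda>x. g x $ i)"
  shows "Ck (Suc m) f"
proof -
  have "nabla f = g"
    using nabla_eqI[OF assms(1)] by blast
  moreover have "f differentiable (at x)" for x
    using assms(1) unfolding differentiable_def by blast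
  ultimately show ?thesis
    unfolding Ck_Suc_nabla using assms(2) by simp
qed

lemma Ck_SucD: "Ck (Suc m) f \<Longrightarrow> Ck m f"
proof (induction m arbitrary: f)
  case 0
  then show ?case
    by (auto simp: Ck_Suc_nabla intro!: differentiable_imp_continuous_on
        simp: differentiable_on_def)
next
  case (Suc m)
  have "Ck m (\<lambda>x. nabla f x $ i)" for i
    using Suc.prems by (intro Suc.IH) (simp add: Ck_Suc_nabla[of "Suc m"])
  then show ?case
    using Suc.prems by (simp add: Ck_Suc_nabla)
qed

lemma Ck_Suc_has_derivative:
  "Ck (Suc m) f \<Longrightarrow> (f has_derivative (\<lambda>h. nabla f x \<bullet> h)) (at x)"
  by (simp add: Ck_Suc_nabla has_derivative_nabla)

lemma Ck_const: "Ck m (\<lambda>x. c)"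
proof (induction m arbitrary: c)
  case (Suc m)
  show ?case
    by (rule Ck_SucI[where g = "\<lambda>x. 0"]) (auto intro: Suc.IH)
qed simp

lemma Ck_coord: "Ck m (\<lambda>x::real ^ 'n::finite. x $ i)"
proof (cases m)
  case (Suc m')
  have "((\<lambda>x. x $ i) has_derivative (\<lambda>h. axis i 1 \<bullet> h)) (at x)" for x :: "real ^ 'n"
    by (simp add: inner_axis inner_commute[of "axis i 1"])
       (rule bounded_linear_imp_has_derivative[OF bounded_linear_vec_nth])
  then show ?thesis
    unfolding Suc by (rule Ck_SucI) (rule Ck_const)
qed (simp add: continuous_intros)

lemma Ck_add: "Ck m f \<Longrightarrow> Ck m g \<Longrightarrow> Ck m (\<lambda>x. f x + g x)"
proof (induction m arbitrary: f g)
  case 0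
  then show ?case by (auto intro: continuous_on_add)
next
  case (Suc m)
  show ?case
  proof (rule Ck_SucI)
    show "((\<lambda>x. f x + g x) has_derivative (\<lambda>h. (nabla f x + nabla g x) \<bullet> h)) (at x)" for x
      unfolding inner_add_left
      by (rule has_derivative_add) (rule Ck_Suc_has_derivative, fact)+
    show "Ck m (\<lambda>x. (nabla f x + nabla g x) $ i)" for i
      using Suc by (simp add: Ck_Suc_nabla)
  qed
qed

lemma Ck_mult: "Ck m f \<Longrightarrow> Ck m g \<Longrightarrow> Ck m (\<lambda>x. f x * g x)"
proof (induction m arbitrary: f g)
  case 0
  then show ?case by (auto intro: continuous_on_mult)
next
  case (Suc m)
  show ?case
  proof (rule Ck_SucI)
    show "((\<lambda>x. f x * g x) has_derivative (\<lambda>h. (f x *\<^sub>R nabla g x + g x *\<^sub>R nabla f x) \<bullet> h)) (at x)" for x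
      using has_derivative_mult[OF Ck_Suc_has_derivative[OF Suc.prems(1), of x] Ck_Suc_has_derivative[OF Suc.prems(2), of x]]
      by (simp add: inner_add_left mult.commute)
    show "Ck m (\<lambda>x. (f x *\<^sub>R nabla g x + g x *\<^sub>R nabla f x) $ i)" for i
      using Suc.prems[THEN Ck_SucD] Suc.prems by (auto simp: Ck_Suc_nabla intro!: Ck_add Suc.IH)
  qed
qed

lemma Ck_cmult: "Ck m f \<Longrightarrow> Ck m (\<lambda>x. c * f x)"
  by (intro Ck_mult Ck_const)

lemma Ck_uminus: "Ck m f \<Longrightarrow> Ck m (\<lambda>x. - f x)"
  using Ck_cmult[of m f "-1"] by simp

lemma Ck_diff: "Ck m f \<Longrightarrow> Ck m g \<Longrightarrow> Ck m (\<lambda>x. f x - g x)"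
  using Ck_add[OF _ Ck_uminus[of m g], of f] by simp

lemma Ck_sum: "(\<And>i. i \<in> I \<Longrightarrow> Ck m (f i)) \<Longrightarrow> Ck m (\<lambda>x. \<Sum>i\<in>I. f i x)"
  by (induction I rule: infinite_finite_induct) (auto intro: Ck_add simp: Ck_const)

lemma Ck_prod: "(\<And>i. i \<in> I \<Longrightarrow> Ck m (f i)) \<Longrightarrow> Ck m (\<lambda>x. \<Prod>i\<in>I. f i x)"
  by (induction I rule: infinite_finite_induct) (auto intro: Ck_mult simp: Ck_const)

text \<open>The gradient of the composition is the adjoint of \<open>R\<close> applied to the
  gradient of \<open>f\<close> at \<open>R x\<close>. Its components are fixed linear combinations
  of functions covered by the induction hypothesis.\<close>

lemma Ck_compose_linear:
  assumes R: "linear R"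
  shows "Ck m f \<Longrightarrow> Ck m (\<lambda>x. f (R x))"
proof (induction m arbitrary: f)
  case 0
  have "continuous_on UNIV R"
    using R by (rule linear_continuous_on[OF linear_conv_bounded_linear[THEN iffD1]])
  with 0 show ?case
    by (auto intro: continuous_on_compose2)
next
  case (Suc m)
  show ?case
  proof (rule Ck_SucI)
    fix x
    have "((\<lambda>x. f (R x)) has_derivative (\<lambda>h. nabla f (R x) \<bullet> R h)) (at x)"
      by (rule has_derivative_compose[OF linear_imp_has_derivative[OF R] Ck_Suc_has_derivative[OF Suc.prems]])
    moreover have "nabla f (R x) \<bullet> R h = (\<chi> i. \<Sum>j\<in>UNIV. R (axis i 1) $ j * nabla f (R x) $ j) \<bullet> h" for h
    proof -
      have "R h = R (\<Sum>i\<in>UNIV. h $ i *\<^sub>R axis i 1)"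
        using basis_expansion[of h] by (simp add: scalar_mult_eq_scaleR)
      also have "\<dots> = (\<Sum>i\<in>UNIV. h $ i *\<^sub>R R (axis i 1))"
        by (simp add: linear_sum[OF R] linear_scale[OF R])
      finally have "nabla f (R x) \<bullet> R h = (\<Sum>i\<in>UNIV. h $ i * (nabla f (R x) \<bullet> R (axis i 1)))"
        by (simp add: inner_sum_right)
      then show ?thesis
        by (simp add: inner_vec_def mult.commute)
    qed
    ultimately show "((\<lambda>x. f (R x)) has_derivative
        (\<lambda>h. (\<chi> i. \<Sum>j\<in>UNIV. R (axis i 1) $ j * nabla f (R x) $ j) \<bullet> h)) (at x)"
      by simp
  next
    show "Ck m (\<lambda>x. (\<chi> i. \<Sum>j\<in>UNIV. R (axis i 1) $ j * nabla f (R x) $ j) $ i)" for i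
    proof -
      have "Ck m (\<lambda>x. nabla f (R x) $ j)" for j
        using Suc.prems by (intro Suc.IH) (simp add: Ck_Suc_nabla)
      then show ?thesis
        by (simp add: Ck_sum Ck_cmult)
    qed
  qed
qed

lemma has_derivative_real_compose:
  fixes f :: "real ^ 'n::finite \<Rightarrow> real"
  assumes "(G has_real_derivative G') (at (f x))" "(f has_derivative (\<lambda>h. v \<bullet> h)) (at x)"
  shows "((\<lambda>x. G (f x)) has_derivative (\<lambda>h. (G' *\<^sub>R v) \<bullet> h)) (at x)"
  using has_derivative_compose[OF assms(2), of G "\<lambda>t. G' * t"] assms(1)
  by (simp add: has_field_derivative_def)

text \<open>The exponent is arbitrary in the induction because differentiation lowers it by
  1.\<close>

lemma Ck_powr:
  assumes "\<And>x. f x > 0"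
  shows "Ck m f \<Longrightarrow> Ck m (\<lambda>x. f x powr a)"
proof (induction m arbitrary: a)
  case 0
  then show ?case
    using assms by (simp add: continuous_on_powr less_imp_neq[symmetric])
next
  case (Suc m)
  show ?case
  proof (rule Ck_SucI)
    show "((\<lambda>x. f x powr a) has_derivative (\<lambda>h. ((a * f x powr (a - 1)) *\<^sub>R nabla f x) \<bullet> h)) (at x)" for x
      using assms[of x]
      by (intro has_derivative_real_compose Ck_Suc_has_derivative[OF Suc.prems] has_real_derivative_powr)
    show "Ck m (\<lambda>x. ((a * f x powr (a - 1)) *\<^sub>R nabla f x) $ i)" for i
      using Ck_SucD[OF Suc.prems] Suc.prems by (auto simp: Ck_Suc_nabla intro!: Ck_mult Ck_const Suc.IH)
  qed
qed

section \<open>Flat functions and smoothness\<close>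

text \<open>Index 0 gives the usual flat function. Its derivatives stay in the span of the family,
  since index \<open>n\<close> leads to \<open>n + 1\<close> and \<open>n + 2\<close>, so one
  induction covers all orders.\<close>

definition flat_exp :: "nat \<Rightarrow> real \<Rightarrow> real" where
  "flat_exp n t = (if t \<le> 0 then 0 else exp (- 1 / t) / t ^ n)"

text \<open>The term of order \<open>n + 2\<close> of the series bounds \<open>exp (1 / t)\<close>
  from below. Two powers of \<open>t\<close> remain after division by \<open>t ^ n\<close>, enough
  for the difference quotient at 0 to tend to 0.\<close>

lemma flat_exp_le_square: "\<bar>flat_exp n t\<bar> \<le> fact (n + 2) * t\<^sup>2"
proof (cases "t \<le> 0")
  case False
  then have t: "t > 0" by simp
  have "(\<Sum>k\<in>{n + 2}. (1 / t) ^ k /\<^sub>R fact k) \<le> suminf (\<lambda>k. (1 / t) ^ k /\<^sub>R fact k)"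
    using t by (intro sum_le_suminf summable_exp_generic) auto
  then have "(1 / t) ^ (n + 2) / fact (n + 2) \<le> exp (1 / t)"
    by (simp add: exp_def divide_inverse mult.commute)
  then have "1 \<le> exp (1 / t) * (fact (n + 2) * t ^ (n + 2))"
    using t by (simp add: power_divide divide_simps mult_ac del: fact_Suc power_Suc)
  then have "exp (- 1 / t) \<le> fact (n + 2) * t ^ (n + 2)"
    by (simp add: exp_minus divide_simps mult_ac del: fact_Suc power_Suc)
  then have "exp (- 1 / t) / t ^ n \<le> fact (n + 2) * t ^ (n + 2) / t ^ n"
    using t by (intro divide_right_mono) auto
  also have "\<dots> = fact (n + 2) * t\<^sup>2"
    using t by (simp add: power_add power2_eq_square del: fact_Suc)
  finally show ?thesis
    using t by (simp add: flat_exp_def del: fact_Suc)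
qed (simp add: flat_exp_def)

lemma has_real_derivative_flat_exp:
  "(flat_exp n has_real_derivative (flat_exp (n + 2) t - real n * flat_exp (n + 1) t)) (at t)"
proof -
  consider "t < 0" | "t = 0" | "t > 0" by linarith
  then show ?thesis
  proof cases
    case 1
    have "((\<lambda>t. 0) has_real_derivative 0) (at t)"
      by simp
    then have "(flat_exp n has_real_derivative 0) (at t)"
      by (rule has_field_derivative_transform_within_open[of _ _ _ "{..<0}"])
        (use 1 in \<open>auto simp: flat_exp_def\<close>)
    with 1 show ?thesis by (simp add: flat_exp_def)
  next
    case 2
    have "(flat_exp n has_real_derivative 0) (at 0)"
      unfolding has_field_derivative_iff
    proof (rule Lim_null_comparison[where g = "\<lambda>h. fact (n + 2) * \<bar>h\<bar>"])
      have "norm ((flat_exp n h - flat_exp n 0) / (h - 0)) \<le> fact (n + 2) * \<bar>h\<bar>" if "h \<noteq> 0" for h :: real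
      proof -
        have "\<bar>flat_exp n h\<bar> / \<bar>h\<bar> \<le> fact (n + 2) * h\<^sup>2 / \<bar>h\<bar>"
          using flat_exp_le_square[of n h] by (rule divide_right_mono) simp
        also have "\<dots> = fact (n + 2) * \<bar>h\<bar>"
          using that by (simp add: power2_eq_square divide_simps del: fact_Suc)
        finally show ?thesis
          by (simp add: flat_exp_def[of n 0] del: fact_Suc)
      qed
      then show "\<forall>\<^sub>F h in at 0. norm ((flat_exp n h - flat_exp n 0) / (h - 0)) \<le> fact (n + 2) * \<bar>h\<bar>"
        by (auto simp: eventually_at_filter)
      show "((\<lambda>h. fact (n + 2) * \<bar>h\<bar>) \<longlongrightarrow> (0::real)) (at 0)"
        by (auto intro!: tendsto_eq_intros)
    qed
    with 2 show ?thesis by (simp add: flat_exp_def)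
  next
    case 3
    have "((\<lambda>t. exp (- 1 / t) / t ^ n) has_real_derivative (exp (- 1 / t) / t ^ (n + 2) - real n * (exp (- 1 / t) / t ^ (n + 1)))) (at t)"
    proof (rule DERIV_cong)
      have "((\<lambda>t. exp (- 1 / t)) has_real_derivative exp (- 1 / t) * (1 / t\<^sup>2)) (at t)"
        using 3 by (auto intro!: derivative_eq_intros simp: power2_eq_square)
      then show "((\<lambda>t. exp (- 1 / t) / t ^ n) has_real_derivative
          (exp (- 1 / t) * (1 / t\<^sup>2) * t ^ n - exp (- 1 / t) * (real n * t ^ (n - Suc 0))) / (t ^ n * t ^ n)) (at t)"
        using 3 DERIV_pow[of n t UNIV] by (intro DERIV_divide) auto
      have "E * (1 / t\<^sup>2) * t ^ n / (t ^ n * t ^ n) = E / t ^ (n + 2)" for E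
        using 3 by (simp add: power_add power2_eq_square)
      moreover have "E * (real n * t ^ (n - Suc 0)) / (t ^ n * t ^ n) = real n * (E / t ^ (n + 1))" for E
        using 3 by (cases n) simp_all
      ultimately show "(exp (- 1 / t) * (1 / t\<^sup>2) * t ^ n - exp (- 1 / t) * (real n * t ^ (n - Suc 0))) / (t ^ n * t ^ n) =
          exp (- 1 / t) / t ^ (n + 2) - real n * (exp (- 1 / t) / t ^ (n + 1))"
        unfolding diff_divide_distrib by presburger
    qed
    then have "(flat_exp n has_real_derivative (exp (- 1 / t) / t ^ (n + 2) - real n * (exp (- 1 / t) / t ^ (n + 1)))) (at t)"
      by (rule has_field_derivative_transform_within_open[of _ _ _ "{0<..}"])
        (use 3 in \<open>auto simp: flat_exp_def\<close>)
    with 3 show ?thesis by (simp add: flat_exp_def)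
  qed
qed

lemma Ck_flat_exp: "Ck m f \<Longrightarrow> Ck m (\<lambda>x. flat_exp n (f x))"
proof (induction m arbitrary: n)
  case 0
  have "continuous_on UNIV (flat_exp n)"
    using has_real_derivative_flat_exp
    by (meson DERIV_isCont continuous_at_imp_continuous_on)
  with 0 show ?case
    by (auto intro: continuous_on_compose2)
next
  case (Suc m)
  show ?case
  proof (rule Ck_SucI)
    show "((\<lambda>x. flat_exp n (f x)) has_derivative
        (\<lambda>h. ((flat_exp (n + 2) (f x) - real n * flat_exp (n + 1) (f x)) *\<^sub>R nabla f x) \<bullet> h)) (at x)" for x
      by (intro has_derivative_real_compose Ck_Suc_has_derivative[OF Suc.prems] has_real_derivative_flat_exp)
    show "Ck m (\<lambda>x. ((flat_exp (n + 2) (f x) - real n * flat_exp (n + 1) (f x)) *\<^sub>R nabla f x) $ i)" for i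
      using Ck_SucD[OF Suc.prems] Suc.prems by (auto simp: Ck_Suc_nabla intro!: Ck_mult Ck_diff Ck_const Suc.IH)
  qed
qed

definition smooth :: "(real ^ 'n::finite \<Rightarrow> real) \<Rightarrow> bool" where
  "smooth f \<longleftrightarrow> (\<forall>m. Ck m f)"

lemma smooth_has_derivative: "smooth f \<Longrightarrow> (f has_derivative (\<lambda>h. nabla f x \<bullet> h)) (at x)"
  unfolding smooth_def using Ck_Suc_has_derivative by blast

lemma smooth_continuous: "smooth f \<Longrightarrow> continuous_on UNIV f"
  unfolding smooth_def by (metis Ck.simps(1))

lemma smooth_continuous_nabla:
  assumes "smooth f"
  shows "continuous_on UNIV (nabla f)"
proof -
  have "Ck 0 (\<lambda>x. nabla f x $ i)" for i
    using assms by (metis Ck_Suc_nabla smooth_def)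
  then have "continuous_on UNIV (\<lambda>x. \<chi> i. nabla f x $ i)"
    by (intro continuous_on_vec_lambda) simp
  then show ?thesis by simp
qed

lemma nabla_eq_0_outside:
  assumes "closed K" "\<And>x. x \<notin> K \<Longrightarrow> f x = 0" "x \<notin> K"
  shows "nabla f x = 0"
proof (rule nabla_eqI)
  have "((\<lambda>x. 0) has_derivative (\<lambda>h. 0 \<bullet> h)) (at x)"
    by simp
  then show "(f has_derivative (\<lambda>h. 0 \<bullet> h)) (at x)"
    by (rule has_derivative_transform_within_open[of _ _ _ _ "- K"]) (use assms in auto)
qed

lemma test_functionsI:
  assumes "smooth f" "compact K" "K \<subseteq> U" "\<And>x. x \<notin> K \<Longrightarrow> f x = 0"
  shows "f \<in> test_functions U"
proof -
  have "closure {x. f x \<noteq> 0} \<subseteq> K"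
    using assms by (intro closure_minimal compact_imp_closed) auto
  moreover from this have "K \<inter> closure {x. f x \<noteq> 0} = closure {x. f x \<noteq> 0}"
    by (rule inf.absorb2)
  then have "compact (closure {x. f x \<noteq> 0})"
    using compact_Int_closed[OF assms(2), of "closure {x. f x \<noteq> 0}"] by simp
  ultimately show ?thesis
    using assms(1,3) unfolding test_functions_def smooth_def by simp
qed

lemma test_functionsE:
  assumes "f \<in> test_functions U"
  obtains K where "smooth f" "compact K" "K \<subseteq> U" "\<And>x. x \<notin> K \<Longrightarrow> f x = 0" "\<And>x. x \<notin> K \<Longrightarrow> nabla f x = 0"
proof (rule that)
  let ?K = "closure {x. f x \<noteq> 0}"
  show "smooth f" "compact ?K" "?K \<subseteq> U"
    using assms unfolding test_functions_def smooth_def by simp_all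
  have *: "f x = 0" if "x \<notin> ?K" for x
    using that closure_subset[of "{x. f x \<noteq> 0}"] by blast
  then show "f x = 0" if "x \<notin> ?K" for x
    using that .
  show "nabla f x = 0" if "x \<notin> ?K" for x
    by (rule nabla_eq_0_outside[where K = ?K, OF closed_closure * that])
qed

section \<open>Weak gradients\<close>

lemma borel_measurable_lebesgue_continuous:
  fixes f :: "'a::euclidean_space \<Rightarrow> 'b::euclidean_space"
  shows "continuous_on UNIV f \<Longrightarrow> f \<in> borel_measurable lebesgue"
  by (intro measurable_completion borel_measurable_continuous_onI) (simp add: borel_measurable_continuous_onI)

lemma integrable_lborel_compact_support:
  fixes f :: "'a::euclidean_space \<Rightarrow> 'b::euclidean_space"
  assumes "continuous_on UNIV f" "compact K" "\<And>x. x \<notin> K \<Longrightarrow> f x = 0"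
  shows "integrable lborel f"
proof -
  have "integrable lborel (\<lambda>x. indicator K x *\<^sub>R f x)"
    using assms by (intro borel_integrable_compact) (auto intro: continuous_on_subset)
  moreover have "(\<lambda>x. indicator K x *\<^sub>R f x) = f"
    using assms(3) by (auto simp: fun_eq_iff indicator_def)
  ultimately show ?thesis by simp
qed

lemma integrable_compact_support:
  fixes f :: "'a::euclidean_space \<Rightarrow> 'b::euclidean_space"
  assumes "continuous_on UNIV f" "compact K" "\<And>x. x \<notin> K \<Longrightarrow> f x = 0"
  shows "integrable lebesgue f"
  using integrable_lborel_compact_support[OF assms] assms(1)
  by (simp add: integrable_completion borel_measurable_continuous_onI)

lemma integral_lebesgue_lborel:
  fixes f :: "'a::euclidean_space \<Rightarrow> 'b::euclidean_space"
  assumes "continuous_on UNIV f"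
  shows "integral\<^sup>L lebesgue f = integral\<^sup>L lborel f"
  using assms by (intro integral_completion) (simp add: borel_measurable_continuous_onI)

lemma integral_lebesgue_on_support:
  fixes f :: "'a::euclidean_space \<Rightarrow> 'b::euclidean_space"
  assumes "U \<in> sets lebesgue" "\<And>x. x \<notin> U \<Longrightarrow> f x = 0"
  shows "integral\<^sup>L (lebesgue_on U) f = integral\<^sup>L lebesgue f"
proof -
  have "(\<lambda>x. indicator U x *\<^sub>R f x) = f"
    using assms(2) by (auto simp: fun_eq_iff indicator_def)
  then show ?thesis
    using assms(1) by (simp add: integral_restrict_space)
qed

lemma bounded_of_compact_support:
  fixes f :: "'a::euclidean_space \<Rightarrow> 'b::euclidean_space"
  assumes "continuous_on UNIV f" "compact K" "\<And>x. x \<notin> K \<Longrightarrow> f x = 0"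
  obtains B where "B > 0" "\<And>x. norm (f x) \<le> B"
proof -
  have "bounded (f ` K)"
    using assms by (intro compact_imp_bounded compact_continuous_image) (auto intro: continuous_on_subset)
  then obtain B where B: "B > 0" "\<And>x. x \<in> K \<Longrightarrow> norm (f x) \<le> B"
    unfolding bounded_pos by auto
  show thesis
  proof (rule that[OF B(1)])
    show "norm (f x) \<le> B" for x
      using B assms(3)[of x] by (cases "x \<in> K") auto
  qed
qed

lemma smooth_lipschitz:
  assumes "smooth f" "\<And>x. norm (nabla f x) \<le> B"
  shows "\<bar>f x - f y\<bar> \<le> B * norm (x - y)"
proof -
  have "onorm (\<lambda>h. nabla f x \<bullet> h) \<le> B" for x
  proof (rule onorm_le)
    fix h
    have "norm (nabla f x \<bullet> h) \<le> norm (nabla f x) * norm h"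
      by (rule Cauchy_Schwarz_ineq2[folded real_norm_def])
    also have "\<dots> \<le> B * norm h"
      using assms(2) by (rule mult_right_mono) simp
    finally show "norm (nabla f x \<bullet> h) \<le> B * norm h" .
  qed
  then have "norm (f x - f y) \<le> B * norm (x - y)"
    by (intro differentiable_bound[of UNIV f "\<lambda>x h. nabla f x \<bullet> h"] smooth_has_derivative[OF assms(1)]) auto
  then show ?thesis by simp
qed

lemma smooth_difference_quotient_tendsto:
  assumes "smooth f"
  shows "(\<lambda>n. (f (x + (1 / real (Suc n)) *\<^sub>R e) - f x) * real (Suc n)) \<longlonglongrightarrow> nabla f x \<bullet> e"
proof -
  have "((\<lambda>t. x + t *\<^sub>R e) has_derivative (\<lambda>t. t *\<^sub>R e)) (at 0)"
    by (auto intro!: derivative_eq_intros)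
  from has_derivative_compose[OF this, of f "\<lambda>h. nabla f x \<bullet> h"]
  have "((\<lambda>t. f (x + t *\<^sub>R e)) has_derivative (\<lambda>t. t * (nabla f x \<bullet> e))) (at 0)"
    using smooth_has_derivative[OF assms, of x] by simp
  then have "((\<lambda>t. f (x + t *\<^sub>R e)) has_real_derivative (nabla f x \<bullet> e)) (at 0)"
    by (simp add: has_field_derivative_def mult_commute_abs)
  then have lim: "(\<lambda>t. (f (x + t *\<^sub>R e) - f x) / t) \<midarrow>0\<rightarrow> nabla f x \<bullet> e"
    by (simp add: DERIV_def)
  have "filterlim (\<lambda>n. 1 / real (Suc n)) (at 0) sequentially"
    using LIMSEQ_Suc[OF lim_1_over_n]
    by (auto simp: filterlim_at)
  from filterlim_compose[OF lim this] show ?thesis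
    by simp
qed

text \<open>Difference quotients have integral 0 by translation invariance, and they converge to the
  partial derivative under a common integrable bound.\<close>

lemma integral_nabla_eq_0:
  fixes f :: "real ^ 'n::finite \<Rightarrow> real"
  assumes f: "smooth f" and K: "compact K" "\<And>x. x \<notin> K \<Longrightarrow> f x = 0"
  shows "(LINT x|lebesgue. nabla f x $ i) = 0"
proof -
  define e :: "real ^ 'n" where "e = axis i 1"
  define D where "D n x = (f (x + (1 / real (Suc n)) *\<^sub>R e) - f x) * real (Suc n)" for n :: nat and x
  have [measurable]: "f \<in> borel_measurable borel"
    using smooth_continuous[OF f] by (rule borel_measurable_continuous_onI)
  have nabla_meas [measurable]: "(\<lambda>x. nabla f x $ i) \<in> borel_measurable borel"
    using smooth_continuous_nabla[OF f]
    by (intro borel_measurable_continuous_onI continuous_on_component)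
  have nabla_0: "nabla f x = 0" if "x \<notin> K" for x
    by (rule nabla_eq_0_outside[OF compact_imp_closed[OF K(1)] K(2) that])
  obtain B where B: "B > 0" "\<And>x. norm (nabla f x) \<le> B"
    using bounded_of_compact_support[OF smooth_continuous_nabla[OF f] K(1) nabla_0] by blast
  obtain R where R: "\<And>x. x \<in> K \<Longrightarrow> norm x \<le> R"
    using compact_imp_bounded[OF K(1)] unfolding bounded_iff by blast
  have f_int: "integrable lborel f"
    using smooth_continuous[OF f] K by (rule integrable_lborel_compact_support)
  have shift_int: "integrable lborel (\<lambda>x. f (x + c))" for c
  proof -
    have "integrable (distr lborel borel ((+) c)) f"
      using f_int by (simp add: lborel_distr_plus)
    then show ?thesis
      by (subst (asm) integrable_distr_eq) (auto simp: add.commute)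
  qed
  have shift: "(LINT x|lborel. f (x + c)) = integral\<^sup>L lborel f" for c
  proof -
    have "integral\<^sup>L lborel f = integral\<^sup>L (distr lborel borel ((+) c)) f"
      by (simp add: lborel_distr_plus)
    also have "\<dots> = (LINT x|lborel. f (c + x))"
      by (rule integral_distr) auto
    finally show ?thesis by (simp add: add.commute)
  qed
  have D0: "(LINT x|lborel. D n x) = 0" for n
    unfolding D_def by (simp add: shift shift_int f_int del: of_nat_Suc)
  have "(\<lambda>n. LINT x|lborel. D n x) \<longlonglongrightarrow> (LINT x|lborel. nabla f x $ i)"
  \<comment> \<open>The increments have length at most 1, so every quotient vanishes outside this
    ball; inside, the gradient bound \<open>B\<close> controls it.\<close>
  proof (rule integral_dominated_convergence[where w = "\<lambda>x. B * indicator (cball 0 (R + 1)) x"])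
    show "D n \<in> borel_measurable lborel" for n
      unfolding D_def by measurable
    show "integrable lborel (\<lambda>x. B * indicator (cball 0 (R + 1)) x)"
      by (intro integrable_mult_right integrable_real_indicator emeasure_lborel_cball_finite) auto
    show "AE x in lborel. (\<lambda>n. D n x) \<longlonglongrightarrow> nabla f x $ i"
    proof (rule AE_I2)
      fix x
      show "(\<lambda>n. D n x) \<longlonglongrightarrow> nabla f x $ i"
        using smooth_difference_quotient_tendsto[OF f, of x e] by (simp add: D_def e_def inner_axis)
    qed
    show "AE x in lborel. norm (D n x) \<le> B * indicator (cball 0 (R + 1)) x" for n
    proof (rule AE_I2)
      fix x
      show "norm (D n x) \<le> B * indicator (cball 0 (R + 1)) x"
      proof (cases "x \<in> cball 0 (R + 1)")
        case True
        have "norm (D n x) = \<bar>f (x + (1 / real (Suc n)) *\<^sub>R e) - f x\<bar> * real (Suc n)"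
          by (simp add: D_def abs_mult del: of_nat_Suc)
        also have "\<dots> \<le> (B * norm (x + (1 / real (Suc n)) *\<^sub>R e - x)) * real (Suc n)"
          by (intro mult_right_mono smooth_lipschitz[OF f B(2)]) auto
        also have "\<dots> = B"
          by (simp add: e_def del: of_nat_Suc)
        finally show ?thesis using True by simp
      next
        case False
        then have x: "norm x > R + 1" by simp
        define v where "v = (1 / real (Suc n)) *\<^sub>R e"
        have "norm v \<le> 1"
          by (simp add: v_def e_def)
        moreover have "norm x \<le> norm (x + v) + norm v"
          using norm_triangle_ineq4[of "x + v" v] by simp
        ultimately have "norm (x + (1 / real (Suc n)) *\<^sub>R e) > R"
          using x unfolding v_def by linarith
        then have "f (x + (1 / real (Suc n)) *\<^sub>R e) = 0" "f x = 0"
          using R[of "x + (1 / real (Suc n)) *\<^sub>R e"] R[of x] x by (intro K(2); force)+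
        then show ?thesis using B by (simp add: D_def)
      qed
    qed
  qed simp
  then have "(LINT x|lborel. nabla f x $ i) = 0"
    unfolding D0 by (simp add: LIMSEQ_const_iff)
  then show ?thesis
    by (subst integral_completion) auto
qed

lemma smooth_mult: "smooth f \<Longrightarrow> smooth g \<Longrightarrow> smooth (\<lambda>x. f x * g x)"
  by (simp add: smooth_def Ck_mult)

lemma nabla_mult:
  assumes "smooth f" "smooth g"
  shows "nabla (\<lambda>x. f x * g x) x = f x *\<^sub>R nabla g x + g x *\<^sub>R nabla f x"
proof (rule nabla_eqI)
  show "((\<lambda>x. f x * g x) has_derivative (\<lambda>h. (f x *\<^sub>R nabla g x + g x *\<^sub>R nabla f x) \<bullet> h)) (at x)"
    using has_derivative_mult[OF smooth_has_derivative[OF assms(1), of x] smooth_has_derivative[OF assms(2), of x]]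
    by (simp add: inner_add_left mult.commute)
qed

lemma locally_integrable_continuous:
  assumes "continuous_on UNIV f"
  shows "locally_integrable U f"
  unfolding locally_integrable_def
proof (intro allI impI)
  fix C assume C: "compact C \<and> C \<subseteq> U"
  then have [measurable]: "C \<in> sets borel"
    by (simp add: borel_compact)
  have "integrable lborel (\<lambda>x. indicator C x *\<^sub>R f x)"
    using C assms by (intro borel_integrable_compact) (auto intro: continuous_on_subset)
  moreover have [measurable]: "f \<in> borel_measurable borel"
    using assms by (rule borel_measurable_continuous_onI)
  ultimately have "integrable lebesgue (\<lambda>x. indicator C x *\<^sub>R f x)"
    by (subst integrable_completion) auto
  then show "integrable (lebesgue_on C) f"
    by (simp add: integrable_restrict_space)
qed

text \<open>Integration by parts: the product of \<open>f\<close> with a test function has compact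
  support, so its partial derivatives have integral 0.\<close>

lemma weak_gradient_nabla:
  assumes U: "open U" and f: "smooth f"
  shows "weak_gradient U f (nabla f)"
  unfolding weak_gradient_def
proof (intro conjI ballI allI)
  show "locally_integrable U f" "locally_integrable U (nabla f)"
    using smooth_continuous[OF f] smooth_continuous_nabla[OF f] by (auto intro: locally_integrable_continuous)
next
  fix \<psi> i assume "\<psi> \<in> test_functions U"
  then obtain K where \<psi>: "smooth \<psi>" "compact K" "K \<subseteq> U"
    "\<And>x. x \<notin> K \<Longrightarrow> \<psi> x = 0" "\<And>x. x \<notin> K \<Longrightarrow> nabla \<psi> x = 0"
    by (rule test_functionsE) blast
  have Ul: "U \<in> sets lebesgue"
    using U by simp
  have off: "\<psi> x = 0 \<and> nabla \<psi> x = 0" if "x \<notin> U" for x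
    using \<psi> that by blast
  have c: "continuous_on UNIV (\<lambda>x. f x * nabla \<psi> x $ i)" "continuous_on UNIV (\<lambda>x. nabla f x $ i * \<psi> x)"
    using smooth_continuous[OF f] smooth_continuous_nabla[OF f] smooth_continuous[OF \<psi>(1)] smooth_continuous_nabla[OF \<psi>(1)]
    by (auto intro!: continuous_on_mult continuous_on_component)
  have "(LINT x|lebesgue. nabla (\<lambda>x. f x * \<psi> x) x $ i) = 0"
    by (rule integral_nabla_eq_0[OF smooth_mult[OF f \<psi>(1)] \<psi>(2)]) (simp add: \<psi>(4))
  then have "(LINT x|lebesgue. f x * nabla \<psi> x $ i + nabla f x $ i * \<psi> x) = 0"
    unfolding nabla_mult[OF f \<psi>(1)] by (simp add: mult.commute)
  then have "(LINT x|lebesgue. f x * nabla \<psi> x $ i) = - (LINT x|lebesgue. nabla f x $ i * \<psi> x)"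
    by (subst (asm) Bochner_Integration.integral_add)
      (auto intro!: integrable_compact_support[OF _ \<psi>(2)] c simp: \<psi>)
  moreover have "frechet_derivative \<psi> (at x) (axis i 1) = nabla \<psi> x $ i" for x
    by (simp add: nabla_def)
  moreover have "(LINT x|lebesgue_on U. f x * nabla \<psi> x $ i) = (LINT x|lebesgue. f x * nabla \<psi> x $ i)"
    using off by (intro integral_lebesgue_on_support[OF Ul]) simp
  moreover have "(LINT x|lebesgue_on U. nabla f x $ i * \<psi> x) = (LINT x|lebesgue. nabla f x $ i * \<psi> x)"
    using off by (intro integral_lebesgue_on_support[OF Ul]) simp
  ultimately show "(LINT x|lebesgue_on U. f x * frechet_derivative \<psi> (at x) (axis i 1)) =
        - (LINT x|lebesgue_on U. nabla f x $ i * \<psi> x)"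
    by simp
qed

section \<open>The fundamental lemma of the calculus of variations\<close>

text \<open>Boxes generate the Borel sets and are stable under intersection. The sets over which
  \<open>w\<close> integrates to 0 are closed under complements, by \<open>total\<close>, and under
  countable disjoint unions. So they include the sets where \<open>w\<close> is positive and where
  it is negative.\<close>

lemma AE_zero_of_box_integrals_zero:
  fixes w :: "'a::euclidean_space \<Rightarrow> real"
  assumes w: "integrable lborel w" and total: "integral\<^sup>L lborel w = 0"
    and box: "\<And>a b. (LINT x:box a b|lborel. w x) = 0"
  shows "AE x in lborel. w x = 0"
proof -
  have [measurable]: "w \<in> borel_measurable borel"
    using w by auto
  have set_int: "set_integrable lborel A w" if "A \<in> sets borel" for A
    unfolding set_integrable_def using w that by (intro integrable_mult_indicator) auto
  have zero: "(LINT x:A|lborel. w x) = 0" if "A \<in> sets borel" for A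
  proof -
    let ?G = "range (\<lambda>(a, b). box a b :: 'a set)"
    have "Int_stable ?G"
      by (force intro!: Int_stableI simp: box_Int_box)
    moreover have "?G \<subseteq> Pow UNIV" by auto
    moreover have "A \<in> sigma_sets UNIV ?G"
      using that unfolding borel_eq_box by simp
    ultimately show ?thesis
    proof (induction rule: sigma_sets_induct_disjoint)
      case (basic A)
      then show ?case using box by auto
    next
      case empty
      show ?case by (simp add: set_lebesgue_integral_def)
    next
      case (compl A)
      then have A: "A \<in> sets borel"
        by (simp add: borel_eq_box)
      have "(LINT x:UNIV - A|lborel. w x) = (LINT x|lborel. w x - indicator A x *\<^sub>R w x)"
        unfolding set_lebesgue_integral_def
        by (intro Bochner_Integration.integral_cong) (auto simp: indicator_def)
      also have "\<dots> = integral\<^sup>L lborel w - (LINT x:A|lborel. w x)"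
        unfolding set_lebesgue_integral_def
        using w set_int[OF A] by (intro Bochner_Integration.integral_diff) (auto simp: set_integrable_def)
      finally show ?case using compl total by simp
    next
      case (union F)
      then have F: "F i \<in> sets borel" for i
        by (simp add: borel_eq_box subset_eq)
      have "(LINT x:(\<Union>i. F i)|lborel. w x) = suminf (\<lambda>i. LINT x:F i|lborel. w x)"
        using F union by (intro lebesgue_integral_countable_add set_int) (auto simp: disjoint_family_on_def)
      then show ?case using union by simp
    qed
  qed
  have [measurable]: "{x. w x > 0} \<in> sets borel" "{x. w x < 0} \<in> sets borel"
    by measurable
  have pos: "AE x in lborel. indicator {x. w x > 0} x *\<^sub>R w x = 0"
  proof (rule integral_nonneg_eq_0_iff_AE[THEN iffD1])
    show "(LINT x|lborel. indicator {x. w x > 0} x *\<^sub>R w x) = 0"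
      using zero[of "{x. w x > 0}"] by (simp add: set_lebesgue_integral_def)
  qed (use set_int[of "{x. w x > 0}"] in \<open>auto simp: set_integrable_def indicator_def\<close>)
  have neg: "AE x in lborel. - (indicator {x. w x < 0} x *\<^sub>R w x) = 0"
  proof (rule integral_nonneg_eq_0_iff_AE[THEN iffD1])
    show "(LINT x|lborel. - (indicator {x. w x < 0} x *\<^sub>R w x)) = 0"
      using zero[of "{x. w x < 0}"] by (simp add: set_lebesgue_integral_def)
  qed (use set_int[of "{x. w x < 0}"] in \<open>auto simp: set_integrable_def indicator_def\<close>)
  from pos neg show ?thesis
    by eventually_elim (auto simp: indicator_def split: if_splits)
qed

text \<open>For \<open>c > 0\<close> a smooth function that is positive exactly on the open box; it
  tends to the indicator of the box as \<open>c\<close> grows.\<close>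

definition box_bump :: "real ^ 'n::finite \<Rightarrow> real ^ 'n \<Rightarrow> real \<Rightarrow> real ^ 'n \<Rightarrow> real" where
  "box_bump a b c x = (\<Prod>i\<in>UNIV. flat_exp 0 (c * (x $ i - a $ i)) * flat_exp 0 (c * (b $ i - x $ i)))"

lemma flat_exp_0_bounds: "0 \<le> flat_exp 0 t" "flat_exp 0 t \<le> 1"
  by (auto simp: flat_exp_def)

lemma box_bump_bounds: "0 \<le> box_bump a b c x" "box_bump a b c x \<le> 1"
  unfolding box_bump_def
  by (intro prod_nonneg mult_nonneg_nonneg flat_exp_0_bounds ballI)
     (intro prod_le_1 conjI mult_nonneg_nonneg mult_le_one flat_exp_0_bounds)

lemma smooth_box_bump: "smooth (box_bump a b c)"
  unfolding smooth_def box_bump_def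
  by (intro allI Ck_prod Ck_mult Ck_flat_exp Ck_diff Ck_const Ck_coord)

lemma box_bump_eq_0:
  assumes "c \<ge> 0" "x \<notin> box a b"
  shows "box_bump a b c x = 0"
proof -
  obtain i where "x $ i \<le> a $ i \<or> b $ i \<le> x $ i"
    using assms(2) unfolding mem_box_cart(1) by (auto simp: not_less)
  then have "flat_exp 0 (c * (x $ i - a $ i)) * flat_exp 0 (c * (b $ i - x $ i)) = 0"
    using assms(1) by (auto simp: flat_exp_def mult_le_0_iff)
  then show ?thesis
    unfolding box_bump_def by (intro prod_zero) auto
qed

lemma box_bump_tendsto:
  "(\<lambda>n. box_bump a b (real (Suc n)) x) \<longlonglongrightarrow> indicator (box a b) x"
proof (cases "x \<in> box a b")
  case True
  have one: "(\<lambda>n. flat_exp 0 (real (Suc n) * t)) \<longlonglongrightarrow> 1" if "t > 0" for t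
  proof -
    have "(\<lambda>n. exp (- (1 / t) * (1 / real (Suc n)))) \<longlonglongrightarrow> exp (- (1 / t) * 0)"
      by (intro tendsto_intros LIMSEQ_Suc[OF lim_1_over_n])
    moreover have "flat_exp 0 (real (Suc n) * t) = exp (- (1 / t) * (1 / real (Suc n)))" for n
      using that by (simp add: flat_exp_def mult_le_0_iff not_le mult.commute del: of_nat_Suc)
    ultimately show ?thesis by simp
  qed
  have "(\<lambda>n. box_bump a b (real (Suc n)) x) \<longlonglongrightarrow> (\<Prod>i\<in>(UNIV::'a set). 1 * 1)"
    unfolding box_bump_def using True
    by (intro tendsto_prod tendsto_mult one) (auto simp: mem_box_cart(1))
  with True show ?thesis by simp
next
  case False
  then show ?thesis by (simp add: box_bump_eq_0)
qed

text \<open>Bumps converge to indicators of boxes under an integrable bound, so \<open>v\<close>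
  integrates to 0 over boxes whose closure lies in \<open>U\<close>; countably many closed boxes
  cover \<open>U\<close>.\<close>

lemma AE_zero_of_test_integrals_zero:
  fixes v :: "real ^ 'n::finite \<Rightarrow> real"
  assumes U: "open U" and v: "locally_integrable U v"
    and test: "\<And>\<psi>. \<psi> \<in> test_functions U \<Longrightarrow> (LINT x|lebesgue_on U. v x * \<psi> x) = 0"
  shows "AE x in lebesgue. x \<in> U \<longrightarrow> v x = 0"
proof -
  have int_cbox: "integrable lebesgue (\<lambda>x. indicator (cbox a b) x * v x)" if "cbox a b \<subseteq> U" for a b
  proof -
    have "integrable (lebesgue_on (cbox a b)) v"
      using v that compact_cbox[of a b] unfolding locally_integrable_def by blast
    then show ?thesis
      by (simp add: integrable_restrict_space)
  qed
  have int_box: "integrable lebesgue (\<lambda>x. indicator (box a b) x * v x)" if "cbox a b \<subseteq> U" for a b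
  proof -
    have "integrable lebesgue (\<lambda>x. indicator (box a b) x *\<^sub>R (indicator (cbox a b) x * v x))"
      using int_cbox[OF that] by (intro integrable_mult_indicator) auto
    moreover have "(\<lambda>x. indicator (box a b) x *\<^sub>R (indicator (cbox a b) x * v x)) = (\<lambda>x. indicator (box a b) x * v x)"
      using box_subset_cbox[of a b] by (auto simp: indicator_def fun_eq_iff)
    ultimately show ?thesis by simp
  qed
  have box0: "(LINT x|lebesgue. indicator (box a b) x * v x) = 0" if ab: "cbox a b \<subseteq> U" for a b
  proof -
    define s where "s n x = indicator (cbox a b) x * v x * box_bump a b (real (Suc n)) x" for n :: nat and x
    have s0: "(LINT x|lebesgue. s n x) = 0" for n
    proof -
      have off: "box_bump a b (real (Suc n)) x = 0" if "x \<notin> cbox a b" for x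
        using that box_subset_cbox[of a b] by (intro box_bump_eq_0) auto
      have "box_bump a b (real (Suc n)) \<in> test_functions U"
        using smooth_box_bump compact_cbox ab off by (rule test_functionsI)
      then have "0 = (LINT x|lebesgue_on U. v x * box_bump a b (real (Suc n)) x)"
        by (rule test[symmetric])
      also have "\<dots> = (LINT x|lebesgue. v x * box_bump a b (real (Suc n)) x)"
        using U off ab by (intro integral_lebesgue_on_support) (auto simp del: of_nat_Suc)
      also have "\<dots> = (LINT x|lebesgue. s n x)"
        using off unfolding s_def
        by (intro Bochner_Integration.integral_cong refl) (auto simp: indicator_def simp del: of_nat_Suc)
      finally show ?thesis ..
    qed
    have "(\<lambda>n. LINT x|lebesgue. s n x) \<longlonglongrightarrow> (LINT x|lebesgue. indicator (box a b) x * v x)"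
    proof (rule integral_dominated_convergence[where w = "\<lambda>x. \<bar>indicator (cbox a b) x * v x\<bar>"])
      show "(\<lambda>x. indicator (box a b) x * v x) \<in> borel_measurable lebesgue"
        using int_box[OF ab] by auto
      show "s n \<in> borel_measurable lebesgue" for n
        unfolding s_def
        by (rule borel_measurable_times[OF borel_measurable_integrable[OF int_cbox[OF ab]]
              borel_measurable_lebesgue_continuous[OF smooth_continuous[OF smooth_box_bump]]])
      show "integrable lebesgue (\<lambda>x. \<bar>indicator (cbox a b) x * v x\<bar>)"
        using int_cbox[OF ab] by (rule integrable_abs)
      show "AE x in lebesgue. (\<lambda>n. s n x) \<longlonglongrightarrow> indicator (box a b) x * v x"
      proof (rule AE_I2)
        fix x
        have "(\<lambda>n. s n x) \<longlonglongrightarrow> indicator (cbox a b) x * v x * indicator (box a b) x"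
          unfolding s_def by (intro tendsto_mult tendsto_const box_bump_tendsto)
        moreover have "indicator (cbox a b) x * v x * indicator (box a b) x = indicator (box a b) x * v x"
          using box_subset_cbox[of a b] by (auto simp: indicator_def)
        ultimately show "(\<lambda>n. s n x) \<longlonglongrightarrow> indicator (box a b) x * v x"
          by simp
      qed
      show "AE x in lebesgue. norm (s n x) \<le> \<bar>indicator (cbox a b) x * v x\<bar>" for n
      proof (rule AE_I2)
        fix x
        have "norm (s n x) = \<bar>indicator (cbox a b) x * v x\<bar> * box_bump a b (real (Suc n)) x"
          by (simp add: s_def abs_mult box_bump_bounds)
        also have "\<dots> \<le> \<bar>indicator (cbox a b) x * v x\<bar>"
          by (intro mult_left_le box_bump_bounds) auto
        finally show "norm (s n x) \<le> \<bar>indicator (cbox a b) x * v x\<bar>" .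
      qed
    qed
    then show ?thesis
      unfolding s0 by (simp add: LIMSEQ_const_iff)
  qed
  have AE_cbox: "AE x in lebesgue. x \<in> cbox c d \<longrightarrow> v x = 0" if cd: "cbox c d \<subseteq> U" for c d
  proof -
    define w where "w x = indicator (box c d) x * v x" for x
    have w_int: "integrable lebesgue w"
      unfolding w_def by (rule int_box[OF cd])
    \<comment> \<open>\<open>w\<close> is only Lebesgue measurable. The generator argument takes
      place in \<open>lborel\<close>, so a Borel function equal to \<open>w\<close> almost
      everywhere replaces it.\<close>
    obtain w' where w': "w' \<in> borel_measurable lborel" "AE x in lborel. w x = w' x"
      using completion_ex_borel_measurable_real[of w lborel] w_int by auto
    have AE: "AE x in lebesgue. w x = w' x"
      using w'(2) by (rule AE_completion)
    have w'_leb: "w' \<in> borel_measurable lebesgue"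
      using w'(1) by (rule measurable_completion)
    have "integrable lebesgue w'"
      by (rule integrable_cong_AE[THEN iffD1, OF borel_measurable_integrable[OF w_int] w'_leb AE w_int])
    then have w'_int: "integrable lborel w'"
      using w'(1) by (simp add: integrable_completion)
    have box_c: "(LINT x:A|lborel. w' x) = (LINT x|lebesgue. indicator A x * w x)" if "A \<in> sets borel" for A
    proof -
      have "(LINT x:A|lborel. w' x) = (LINT x|lebesgue. indicator A x *\<^sub>R w' x)"
        unfolding set_lebesgue_integral_def using that w'(1)
        by (intro integral_completion[symmetric] borel_measurable_scaleR) auto
      also have "\<dots> = (LINT x|lebesgue. indicator A x * w x)"
      proof (rule integral_cong_AE)
        show "(\<lambda>x. indicat_real A x *\<^sub>R w' x) \<in> borel_measurable lebesgue"
             "(\<lambda>x. indicat_real A x * w x) \<in> borel_measurable lebesgue"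
          using that w'_leb w_int by (auto intro!: borel_measurable_times borel_measurable_indicator)
        show "AE x in lebesgue. indicator A x *\<^sub>R w' x = indicator A x * w x"
          using AE by eventually_elim simp
      qed
      finally show ?thesis .
    qed
    have "AE x in lborel. w' x = 0"
    proof (rule AE_zero_of_box_integrals_zero[OF w'_int])
      have "integral\<^sup>L lborel w' = (LINT x:UNIV|lborel. w' x)"
        by (simp add: set_lebesgue_integral_def)
      also have "\<dots> = 0"
        using box0[OF cd] by (subst box_c) (auto simp: w_def)
      finally show "integral\<^sup>L lborel w' = 0" .
    next
      fix a b
      obtain p q where pq: "box a b \<inter> box c d = box p q"
        using box_Int_box[of a b c d] by blast
      have "(LINT x:box a b|lborel. w' x) = (LINT x|lebesgue. indicator (box p q) x * v x)"
        by (subst box_c) (auto simp: w_def indicator_def mult_ac simp flip: pq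
            intro!: Bochner_Integration.integral_cong)
      also have "\<dots> = 0"
      proof (cases "box p q = {}")
        case False
        have "cbox p q = closure (box p q)"
          using closure_box[OF False] by simp
        also have "\<dots> \<subseteq> cbox c d"
          using pq box_subset_cbox[of c d] by (intro closure_minimal closed_cbox) auto
        finally show ?thesis using cd by (intro box0) auto
      qed simp
      finally show "(LINT x:box a b|lborel. w' x) = 0" .
    qed
    then have "AE x in lebesgue. w' x = 0"
      by (rule AE_completion)
    \<comment> \<open>\<open>w\<close> is cut off on the open box and says nothing about the
      boundary, which is a null set.\<close>
    moreover have "AE x in lebesgue. x \<notin> cbox c d - box c d"
      using negligible_frontier_interval[of c d] unfolding negligible_iff_null_sets
      by (rule AE_not_in)
    ultimately show ?thesis
      using AE by eventually_elim (auto simp: w_def indicator_def)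
  qed
  obtain D where D: "countable D" "D \<subseteq> Pow U" "\<And>X. X \<in> D \<Longrightarrow> \<exists>a b. X = cbox a b" "\<Union>D = U"
    using open_countable_Union_open_cbox[OF U] by metis
  have "AE x in lebesgue. \<forall>X\<in>D. x \<in> X \<longrightarrow> v x = 0"
  proof (rule AE_ball_countable'[OF _ D(1)])
    fix X assume "X \<in> D"
    then obtain a b where "X = cbox a b" "cbox a b \<subseteq> U"
      using D by (metis PowD subsetD)
    then show "AE x in lebesgue. x \<in> X \<longrightarrow> v x = 0"
      using AE_cbox by simp
  qed
  then show ?thesis
    by eventually_elim (use D(4) in blast)
qed

lemma integrable_mult_test_function:
  fixes v :: "real ^ 'n::finite \<Rightarrow> real"
  assumes U: "open U" and v: "locally_integrable U v" and \<psi>: "\<psi> \<in> test_functions U"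
  shows "integrable (lebesgue_on U) (\<lambda>x. v x * \<psi> x)"
proof -
  obtain K where K: "smooth \<psi>" "compact K" "K \<subseteq> U" "\<And>x. x \<notin> K \<Longrightarrow> \<psi> x = 0"
    using test_functionsE[OF \<psi>] by metis
  obtain B where B: "B > 0" "\<And>x. norm (\<psi> x) \<le> B"
    using bounded_of_compact_support[OF smooth_continuous[OF K(1)] K(2) K(4)] by blast
  have int: "integrable lebesgue (\<lambda>x. indicator K x * v x)"
    using v K(2,3) by (auto simp: locally_integrable_def integrable_restrict_space borel_compact)
  have "integrable lebesgue (\<lambda>x. indicator K x * v x * \<psi> x)"
  proof (rule Bochner_Integration.integrable_bound)
    show "integrable lebesgue (\<lambda>x. B * (indicator K x * v x))"
      using int by simp
    show "(\<lambda>x. indicator K x * v x * \<psi> x) \<in> borel_measurable lebesgue"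
      by (rule borel_measurable_times[OF borel_measurable_integrable[OF int]
            borel_measurable_lebesgue_continuous[OF smooth_continuous[OF K(1)]]])
    show "AE x in lebesgue. norm (indicator K x * v x * \<psi> x) \<le> norm (B * (indicator K x * v x))"
    proof (rule AE_I2)
      fix x
      have "\<bar>indicator K x * v x\<bar> * \<bar>\<psi> x\<bar> \<le> \<bar>indicator K x * v x\<bar> * B"
        using B(2)[of x] by (intro mult_left_mono) auto
      then show "norm (indicator K x * v x * \<psi> x) \<le> norm (B * (indicator K x * v x))"
        using B(1) by (simp add: abs_mult mult_ac)
    qed
  qed
  moreover have "indicator K x * v x * \<psi> x = indicator U x *\<^sub>R (v x * \<psi> x)" for x
    using K(3,4) by (auto simp: indicator_def)
  ultimately show ?thesis
    using U by (simp add: integrable_restrict_space)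
qed

lemma locally_integrable_nth:
  fixes v :: "real ^ 'n::finite \<Rightarrow> real ^ 'n"
  assumes "locally_integrable U v"
  shows "locally_integrable U (\<lambda>x. v x $ i)"
  using assms unfolding locally_integrable_def
  by (auto intro: integrable_bounded_linear[OF bounded_linear_vec_nth])

lemma locally_integrable_diff:
  assumes "locally_integrable U u" "locally_integrable U v"
  shows "locally_integrable U (\<lambda>x. u x - v x)"
  using assms unfolding locally_integrable_def by auto

lemma weak_gradient_unique:
  fixes U :: "(real ^ 'n::finite) set"
  assumes U: "open U" and v: "weak_gradient U u v" and w: "weak_gradient U u w"
  shows "AE x in lebesgue. x \<in> U \<longrightarrow> v x = w x"
proof -
  have "AE x in lebesgue. x \<in> U \<longrightarrow> v x $ i - w x $ i = 0" for i
  proof (rule AE_zero_of_test_integrals_zero[OF U])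
    have li: "locally_integrable U (\<lambda>x. v x $ i)" "locally_integrable U (\<lambda>x. w x $ i)"
      using v w by (auto simp: weak_gradient_def intro: locally_integrable_nth)
    then show "locally_integrable U (\<lambda>x. v x $ i - w x $ i)"
      by (rule locally_integrable_diff)
    fix \<psi> assume \<psi>: "\<psi> \<in> test_functions U"
    have "(LINT x|lebesgue_on U. (v x $ i - w x $ i) * \<psi> x) =
        (LINT x|lebesgue_on U. v x $ i * \<psi> x) - (LINT x|lebesgue_on U. w x $ i * \<psi> x)"
      unfolding left_diff_distrib
      by (intro Bochner_Integration.integral_diff integrable_mult_test_function[OF U _ \<psi>] li)
    also have "\<dots> = 0"
    proof -
      have "(LINT x|lebesgue_on U. v x $ i * \<psi> x) = - (LINT x|lebesgue_on U. u x * frechet_derivative \<psi> (at x) (axis i 1))"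
        "(LINT x|lebesgue_on U. w x $ i * \<psi> x) = - (LINT x|lebesgue_on U. u x * frechet_derivative \<psi> (at x) (axis i 1))"
        using v w \<psi> unfolding weak_gradient_def by simp_all
      then show ?thesis by simp
    qed
    finally show "(LINT x|lebesgue_on U. (v x $ i - w x $ i) * \<psi> x) = 0" .
  qed
  then have "AE x in lebesgue. \<forall>i\<in>UNIV. x \<in> U \<longrightarrow> v x $ i - w x $ i = 0"
    by (intro AE_finite_allI) auto
  then show ?thesis
    by eventually_elim (auto simp: vec_eq_iff)
qed

lemma weak_gradient_grad: "weak_gradient U u v \<Longrightarrow> weak_gradient U u (grad U u)"
  unfolding grad_def by (rule someI[where P = "weak_gradient U u"])

lemma grad_AE_eq:
  fixes U :: "(real ^ 'n::finite) set"
  assumes "open U" "weak_gradient U u v"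
  shows "AE x in lebesgue. x \<in> U \<longrightarrow> grad U u x = v x"
  using weak_gradient_unique[OF assms(1) weak_gradient_grad[OF assms(2)] assms(2)] .

lemma weak_gradient_diff:
  fixes U :: "(real ^ 'n::finite) set"
  assumes U: "open U" and u: "weak_gradient U u v" and \<phi>: "smooth \<phi>"
  shows "weak_gradient U (\<lambda>x. u x - \<phi> x) (\<lambda>x. v x - nabla \<phi> x)"
proof -
  have w: "weak_gradient U \<phi> (nabla \<phi>)"
    by (rule weak_gradient_nabla[OF U \<phi>])
  note li = u[unfolded weak_gradient_def] w[unfolded weak_gradient_def]
  show ?thesis
    unfolding weak_gradient_def
  proof (intro conjI ballI allI)
    show "locally_integrable U (\<lambda>x. u x - \<phi> x)" "locally_integrable U (\<lambda>x. v x - nabla \<phi> x)"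
      using li by (auto intro: locally_integrable_diff)
    fix \<psi> i assume \<psi>: "\<psi> \<in> test_functions U"
    obtain K where K: "smooth \<psi>" "compact K" "K \<subseteq> U" "\<And>x. x \<notin> K \<Longrightarrow> \<psi> x = 0" "\<And>x. x \<notin> K \<Longrightarrow> nabla \<psi> x = 0"
      using test_functionsE[OF \<psi>] by metis
    have "(\<lambda>x. nabla \<psi> x $ i) \<in> test_functions U"
    proof (rule test_functionsI[OF _ K(2,3)])
      show "smooth (\<lambda>x. nabla \<psi> x $ i)"
        using K(1) unfolding smooth_def using Ck_Suc_nabla by blast
    qed (simp add: K)
    then have \<psi>': "(\<lambda>x. frechet_derivative \<psi> (at x) (axis i 1)) \<in> test_functions U"
      by (simp add: nabla_def)
    have "(LINT x|lebesgue_on U. (u x - \<phi> x) * frechet_derivative \<psi> (at x) (axis i 1)) =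
      (LINT x|lebesgue_on U. u x * frechet_derivative \<psi> (at x) (axis i 1)) -
      (LINT x|lebesgue_on U. \<phi> x * frechet_derivative \<psi> (at x) (axis i 1))"
      unfolding left_diff_distrib using li
      by (intro Bochner_Integration.integral_diff integrable_mult_test_function[OF U _ \<psi>']) auto
    also have "\<dots> = - ((LINT x|lebesgue_on U. v x $ i * \<psi> x) - (LINT x|lebesgue_on U. nabla \<phi> x $ i * \<psi> x))"
      using li \<psi> by simp
    also have "\<dots> = - (LINT x|lebesgue_on U. (v x - nabla \<phi> x) $ i * \<psi> x)"
      unfolding vector_minus_component left_diff_distrib using li
      by (subst Bochner_Integration.integral_diff)
        (auto intro!: integrable_mult_test_function[OF U _ \<psi>] locally_integrable_nth)
    finally show "(LINT x|lebesgue_on U. (u x - \<phi> x) * frechet_derivative \<psi> (at x) (axis i 1)) =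
      - (LINT x|lebesgue_on U. (v x - nabla \<phi> x) $ i * \<psi> x)" .
  qed
qed

section \<open>Rayleigh quotients of test functions\<close>

text \<open>Functions and gradients may vanish, so the endpoint 0 has to be included. There the
  inequality reduces to \<open>t powr p <= t\<close>.\<close>

lemma powr_convex_nonneg:
  assumes "p \<ge> 1"
  shows "convex_on {0..} (\<lambda>x::real. x powr p)"
proof (rule convex_on_linorderI)
  fix t x y :: real
  assume t: "t > 0" "t < 1" and xy: "x \<in> {0..}" "y \<in> {0..}" "x < y"
  show "((1 - t) *\<^sub>R x + t *\<^sub>R y) powr p \<le> (1 - t) * x powr p + t * y powr p"
  proof (cases "x = 0")
    case True
    have "t powr p \<le> t powr 1"
      using assms t by (intro powr_mono') auto
    then have "t powr p * y powr p \<le> t * y powr p"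
      using t by (intro mult_right_mono) auto
    then show ?thesis
      using True t xy by (simp add: powr_mult)
  next
    case False
    then show ?thesis
      using convex_onD[OF powr_convex[OF assms], of t x y] t xy by simp
  qed
qed simp

text \<open>Convexity, applied to the combination of \<open>a / (1 - s)\<close> and
  \<open>b / s\<close>. For small \<open>s\<close> the factor of \<open>a\<close> is close to 1; the
  large factor of \<open>b\<close> is harmless if \<open>b\<close> is made small after
  \<open>s\<close> has been fixed.\<close>

lemma powr_add_le:
  fixes a b :: real
  assumes "p \<ge> 1" "0 < s" "s < 1" "a \<ge> 0" "b \<ge> 0"
  shows "(a + b) powr p \<le> (1 - s) powr (1 - p) * a powr p + s powr (1 - p) * b powr p"
proof -
  have "((1 - s) *\<^sub>R (a / (1 - s)) + s *\<^sub>R (b / s)) powr p \<le> (1 - s) * (a / (1 - s)) powr p + s * (b / s) powr p"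
    using assms by (intro convex_onD[OF powr_convex_nonneg]) auto
  moreover have "(1 - s) * (a / (1 - s)) powr p = (1 - s) powr (1 - p) * a powr p"
    using assms by (simp add: powr_divide powr_diff)
  moreover have "s * (b / s) powr p = s powr (1 - p) * b powr p"
    using assms by (simp add: powr_divide powr_diff)
  ultimately show ?thesis
    using assms by simp
qed

text \<open>A weak form of Minkowski's inequality, which is all that is needed to pass to limits.\<close>

lemma integral_norm_add_powr_le:
  fixes f g :: "'a \<Rightarrow> 'b::euclidean_space"
  assumes p: "p \<ge> 1" and s: "0 < s" "s < 1"
    and meas: "f \<in> borel_measurable M" "g \<in> borel_measurable M"
    and int: "integrable M (\<lambda>x. norm (f x) powr p)" "integrable M (\<lambda>x. norm (g x) powr p)"
  shows "integrable M (\<lambda>x. norm (f x + g x) powr p)"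
    and "(LINT x|M. norm (f x + g x) powr p) \<le>
      (1 - s) powr (1 - p) * (LINT x|M. norm (f x) powr p) + s powr (1 - p) * (LINT x|M. norm (g x) powr p)"
proof -
  define h where "h x = (1 - s) powr (1 - p) * norm (f x) powr p + s powr (1 - p) * norm (g x) powr p" for x
  have h: "integrable M h"
    unfolding h_def using int by simp
  have le: "norm (f x + g x) powr p \<le> h x" for x
  proof -
    have "norm (f x + g x) powr p \<le> (norm (f x) + norm (g x)) powr p"
      using p by (intro powr_mono2 norm_triangle_ineq) auto
    also have "\<dots> \<le> h x"
      unfolding h_def using p s by (intro powr_add_le) auto
    finally show ?thesis .
  qed
  show int': "integrable M (\<lambda>x. norm (f x + g x) powr p)"
  proof (rule Bochner_Integration.integrable_bound[OF h])
    show "(\<lambda>x. norm (f x + g x) powr p) \<in> borel_measurable M"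
      using meas by measurable
    show "AE x in M. norm (norm (f x + g x) powr p) \<le> norm (h x)"
    proof (rule AE_I2)
      show "norm (norm (f x + g x) powr p) \<le> norm (h x)" for x
        using le[of x] by simp
    qed
  qed
  have "(LINT x|M. norm (f x + g x) powr p) \<le> integral\<^sup>L M h"
    using int' h le by (rule integral_mono)
  also have "\<dots> = (1 - s) powr (1 - p) * (LINT x|M. norm (f x) powr p) + s powr (1 - p) * (LINT x|M. norm (g x) powr p)"
    unfolding h_def using int by simp
  finally show "(LINT x|M. norm (f x + g x) powr p) \<le>
      (1 - s) powr (1 - p) * (LINT x|M. norm (f x) powr p) + s powr (1 - p) * (LINT x|M. norm (g x) powr p)" .
qed

text \<open>\<open>mass\<close> and \<open>dirichlet\<close> integrate over the whole space and use
  the classical gradient, so their values for a test function do not depend on the open set that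
  contains its support.\<close>

definition mass :: "real \<Rightarrow> (real ^ 'n::finite \<Rightarrow> real) \<Rightarrow> real" where
  "mass p f = (LINT x|lebesgue. norm (f x) powr p)"

definition dirichlet :: "real \<Rightarrow> (real ^ 'n::finite \<Rightarrow> real) \<Rightarrow> real" where
  "dirichlet p f = (LINT x|lebesgue. norm (nabla f x) powr p)"

lemma mass_nonneg: "mass p f \<ge> 0"
  by (simp add: mass_def)

lemma dirichlet_nonneg: "dirichlet p f \<ge> 0"
  by (simp add: dirichlet_def)

lemma continuous_on_norm_powr:
  fixes f :: "'a::topological_space \<Rightarrow> 'b::real_normed_vector"
  assumes "continuous_on S f" "p > 0"
  shows "continuous_on S (\<lambda>x. norm (f x) powr p)"
  using assms by (intro continuous_on_powr' continuous_on_norm continuous_on_const) auto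

lemma test_function_integrable_powr:
  assumes "f \<in> test_functions U" "p > 0"
  shows "integrable lebesgue (\<lambda>x. norm (f x) powr p)" "integrable lebesgue (\<lambda>x. norm (nabla f x) powr p)"
proof -
  obtain K where K: "smooth f" "compact K" "K \<subseteq> U" "\<And>x. x \<notin> K \<Longrightarrow> f x = 0" "\<And>x. x \<notin> K \<Longrightarrow> nabla f x = 0"
    using test_functionsE[OF assms(1)] by metis
  show "integrable lebesgue (\<lambda>x. norm (f x) powr p)"
    using smooth_continuous[OF K(1)] assms(2) K(2)
    by (rule integrable_compact_support[OF continuous_on_norm_powr]) (simp add: K)
  show "integrable lebesgue (\<lambda>x. norm (nabla f x) powr p)"
    using smooth_continuous_nabla[OF K(1)] assms(2) K(2)
    by (rule integrable_compact_support[OF continuous_on_norm_powr]) (simp add: K)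
qed

lemma test_function_support:
  assumes "f \<in> test_functions U" "x \<notin> U"
  shows "f x = 0" "nabla f x = 0"
  using test_functionsE[OF assms(1)] assms(2) by (metis subsetD)+

lemma test_functions_smooth: "f \<in> test_functions U \<Longrightarrow> smooth f"
  by (simp add: test_functions_def smooth_def)

lemma integrable_lebesgue_on_open:
  fixes f :: "real ^ 'n::finite \<Rightarrow> real"
  assumes "open U" "integrable lebesgue f"
  shows "integrable (lebesgue_on U) f"
  using integrable_mult_indicator[of U lebesgue f] assms by (simp add: integrable_restrict_space)

lemma borel_measurable_lebesgue_on_continuous:
  fixes f :: "'a::euclidean_space \<Rightarrow> 'b::euclidean_space"
  shows "continuous_on UNIV f \<Longrightarrow> f \<in> borel_measurable (lebesgue_on U)"
  by (intro measurable_restrict_space1 borel_measurable_lebesgue_continuous)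

lemma test_function_Lp_space:
  assumes "open U" "f \<in> test_functions U" "p > 0"
  shows "f \<in> Lp_space p U" "nabla f \<in> Lp_space p U"
  using test_function_integrable_powr[OF assms(2,3)] assms(1)
    smooth_continuous[OF test_functions_smooth[OF assms(2)]] smooth_continuous_nabla[OF test_functions_smooth[OF assms(2)]]
  by (auto simp: Lp_space_def intro: integrable_lebesgue_on_open borel_measurable_lebesgue_on_continuous)

lemma weak_gradient_test_function:
  "open U \<Longrightarrow> f \<in> test_functions U \<Longrightarrow> weak_gradient U f (nabla f)"
  by (intro weak_gradient_nabla test_functions_smooth)

text \<open>\<open>grad\<close> is an arbitrary choice among weak gradients, determined only up to
  null sets; it is measurable because Lebesgue measure is complete.\<close>

lemma borel_measurable_grad:
  fixes U :: "(real ^ 'n::finite) set"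
  assumes U: "open U" and w: "weak_gradient U u v" and v: "v \<in> borel_measurable (lebesgue_on U)"
  shows "grad U u \<in> borel_measurable (lebesgue_on U)"
    and "AE x in lebesgue_on U. grad U u x = v x"
proof -
  show AE: "AE x in lebesgue_on U. grad U u x = v x"
    using grad_AE_eq[OF U w] U by (simp add: AE_restrict_space_iff)
  have "(\<lambda>x. if x \<in> U then v x else 0) \<in> borel_measurable lebesgue"
    using v U by (intro borel_measurable_if_I) auto
  moreover have "AE x in lebesgue. (if x \<in> U then v x else 0) = (if x \<in> U then grad U u x else 0)"
    using grad_AE_eq[OF U w] by eventually_elim simp
  ultimately have "(\<lambda>x. if x \<in> U then grad U u x else 0) \<in> borel_measurable lebesgue"
    by (rule borel_measurable_AE)
  then show "grad U u \<in> borel_measurable (lebesgue_on U)"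
    by (rule borel_measurable_if_D)
qed

lemma integral_norm_grad_powr:
  fixes U :: "(real ^ 'n::finite) set"
  assumes U: "open U" and w: "weak_gradient U u v" and v: "v \<in> borel_measurable (lebesgue_on U)"
  shows "(LINT x|lebesgue_on U. norm (grad U u x) powr p) = (LINT x|lebesgue_on U. norm (v x) powr p)"
    and "integrable (lebesgue_on U) (\<lambda>x. norm (v x) powr p) \<Longrightarrow> integrable (lebesgue_on U) (\<lambda>x. norm (grad U u x) powr p)"
proof -
  have m: "(\<lambda>x. norm (grad U u x) powr p) \<in> borel_measurable (lebesgue_on U)"
    "(\<lambda>x. norm (v x) powr p) \<in> borel_measurable (lebesgue_on U)"
    using borel_measurable_grad(1)[OF U w v] v by measurable
  have AE: "AE x in lebesgue_on U. norm (grad U u x) powr p = norm (v x) powr p"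
    using borel_measurable_grad(2)[OF U w v] by eventually_elim simp
  show "(LINT x|lebesgue_on U. norm (grad U u x) powr p) = (LINT x|lebesgue_on U. norm (v x) powr p)"
    by (rule integral_cong_AE[OF m AE])
  show "integrable (lebesgue_on U) (\<lambda>x. norm (v x) powr p) \<Longrightarrow> integrable (lebesgue_on U) (\<lambda>x. norm (grad U u x) powr p)"
    by (rule integrable_cong_AE[THEN iffD2, OF m AE])
qed

lemma mass_eq_lebesgue_on:
  assumes "open U" "f \<in> test_functions U"
  shows "(LINT x|lebesgue_on U. norm (f x) powr p) = mass p f"
  unfolding mass_def using assms
  by (intro integral_lebesgue_on_support) (auto simp: test_function_support)

lemma dirichlet_eq_lebesgue_on:
  assumes "open U" "f \<in> test_functions U"
  shows "(LINT x|lebesgue_on U. norm (nabla f x) powr p) = dirichlet p f"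
  unfolding dirichlet_def using assms
  by (intro integral_lebesgue_on_support) (auto simp: test_function_support)

lemma energy_test_function:
  assumes "open U" "f \<in> test_functions U" "p > 0"
  shows "energy p U f = dirichlet p f"
  unfolding energy_def dirichlet_eq_lebesgue_on[OF assms(1,2), symmetric]
  using assms test_function_Lp_space[OF assms]
  by (intro integral_norm_grad_powr weak_gradient_test_function) (auto simp: Lp_space_def)

lemma Lp_norm_test_function:
  assumes "open U" "f \<in> test_functions U"
  shows "Lp_norm p U f = mass p f powr (1 / p)"
  unfolding Lp_norm_def mass_eq_lebesgue_on[OF assms] ..

lemma W1p_norm_test_function:
  assumes "open U" "f \<in> test_functions U" "p > 0"
  shows "W1p_norm p U f = mass p f powr (1 / p) + dirichlet p f powr (1 / p)"
  unfolding W1p_norm_def Lp_norm_test_function[OF assms(1,2)]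
  unfolding Lp_norm_def energy_test_function[OF assms, unfolded energy_def] ..

lemma test_functions_zero: "(\<lambda>x. 0) \<in> test_functions U"
  by (rule test_functionsI[of _ "{}"]) (auto simp: smooth_def Ck_const)

lemma test_functions_diff:
  assumes "f \<in> test_functions U" "g \<in> test_functions U"
  shows "(\<lambda>x. f x - g x) \<in> test_functions U"
proof -
  obtain K L where "compact K" "K \<subseteq> U" "\<And>x. x \<notin> K \<Longrightarrow> f x = 0" "compact L" "L \<subseteq> U" "\<And>x. x \<notin> L \<Longrightarrow> g x = 0"
    using test_functionsE[OF assms(1)] test_functionsE[OF assms(2)] by metis
  moreover have "smooth (\<lambda>x. f x - g x)"
    using assms[THEN test_functions_smooth] by (simp add: smooth_def Ck_diff)
  ultimately show ?thesis
    by (intro test_functionsI[of _ "K \<union> L"]) auto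
qed

lemma nabla_zero: "nabla (\<lambda>x. 0) x = 0"
  by (rule nabla_eqI) simp

lemma test_functions_subset_W1p0:
  assumes "open U" "f \<in> test_functions U" "p > 0"
  shows "f \<in> W1p0 p U"
proof -
  have "f \<in> W1p p U"
    using test_function_Lp_space[OF assms] weak_gradient_test_function[OF assms(1,2)]
    by (auto simp: W1p_def)
  moreover have "W1p_norm p U (\<lambda>x. f x - f x) = 0"
    using W1p_norm_test_function[OF assms(1) test_functions_zero assms(3)] assms(3)
    by (simp add: mass_def dirichlet_def nabla_zero)
  ultimately show ?thesis
    using assms(2) unfolding W1p0_def by (auto intro!: bexI[of _ f])
qed

lemma powr_le_cancel_exponent:
  fixes x e :: real
  assumes "x \<ge> 0" "e > 0" "p > 0" "x powr (1 / p) < e"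
  shows "x < e powr p"
proof -
  have "(x powr (1 / p)) powr p < e powr p"
    using assms by (intro powr_less_mono2) auto
  then show ?thesis
    using assms by (simp add: powr_powr)
qed

text \<open>Density of test functions in \<open>W1p0\<close>, where a strict inequality for the
  Rayleigh quotient is stable. The parameter \<open>s\<close> of the weak Minkowski inequality is
  fixed before the distance \<open>e\<close> of the approximation.\<close>

lemma test_function_rayleigh:
  fixes U :: "(real ^ 'n::finite) set"
  assumes U: "open U" and p: "p > 1" and u: "u \<in> unit_sphere_W1p0 p U" and C: "energy p U u < C"
  obtains \<phi> where "\<phi> \<in> test_functions U" "dirichlet p \<phi> < C * mass p \<phi>"
proof -
  define E where "E = energy p U u"
  have E0: "E \<ge> 0" by (simp add: E_def energy_def)
  have C0: "C > 0" using C E0 E_def by simp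
  have uW: "u \<in> W1p0 p U" "Lp_norm p U u = 1"
    using u by (auto simp: unit_sphere_W1p0_def)
  then obtain v where v: "v \<in> Lp_space p U" "weak_gradient U u v" and uL: "u \<in> Lp_space p U"
    by (auto simp: W1p0_def W1p_def)
  let ?M = "lebesgue_on U"
  let ?g = "grad U u"
  have g_meas: "?g \<in> borel_measurable ?M"
    using borel_measurable_grad(1)[OF U v(2)] v(1) by (auto simp: Lp_space_def)
  have g_int: "integrable ?M (\<lambda>x. norm (?g x) powr p)"
    using integral_norm_grad_powr(2)[OF U v(2)] v(1) by (auto simp: Lp_space_def)
  have u_meas: "u \<in> borel_measurable ?M" and u_int: "integrable ?M (\<lambda>x. norm (u x) powr p)"
    using uL by (auto simp: Lp_space_def)
  have u1: "(LINT x|?M. norm (u x) powr p) = 1"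
  proof -
    define X where "X = (LINT x|?M. norm (u x) powr p)"
    have "X \<ge> 0" by (simp add: X_def)
    moreover have "X powr (1 / p) = 1"
      using uW(2) by (simp add: Lp_norm_def X_def)
    ultimately have "X = 1"
      using p by (metis divide_eq_0_iff less_irrefl not_one_less_zero powr_eq_one_iff_gen powr_eq_0_iff less_eq_real_def zero_neq_one one_neq_zero)
    then show ?thesis by (simp add: X_def)
  qed
  \<comment> \<open>Both correction factors tend to 1 as \<open>s\<close> tends to 0, so part of the
    gap between \<open>E\<close> and \<open>C\<close> survives for some \<open>s\<close>.\<close>
  have "((\<lambda>s. C * (1 - s) powr (p - 1) - (1 - s) powr (1 - p) * E) \<longlongrightarrow> C * (1 - 0) powr (p - 1) - (1 - 0) powr (1 - p) * E) (at_right 0)"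
    by (intro tendsto_intros) auto
  moreover have "C * (1 - 0) powr (p - 1) - (1 - 0) powr (1 - p) * E > 0"
    using C by (simp add: E_def)
  ultimately have "\<forall>\<^sub>F s in at_right 0. C * (1 - s) powr (p - 1) - (1 - s) powr (1 - p) * E > 0"
    by (rule order_tendstoD(1))
  moreover have "\<forall>\<^sub>F s in at_right (0::real). s < 1 \<and> s > 0"
    by (auto simp: eventually_at_right_field intro: exI[of _ 1])
  ultimately have "\<forall>\<^sub>F s in at_right 0. (1 - s) powr (1 - p) * E < C * (1 - s) powr (p - 1) \<and> s < 1 \<and> s > 0"
    by eventually_elim simp
  then obtain s where s: "(1 - s) powr (1 - p) * E < C * (1 - s) powr (p - 1)" "s < 1" "s > 0"
    using eventually_happens[of _ "at_right (0::real)"] by auto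
  define a b where "a = (1 - s) powr (1 - p) * E" and "b = C * (1 - s) powr (p - 1)"
  have ab: "a < b" "b > 0" using s C0 by (auto simp: a_def b_def)
  \<comment> \<open>\<open>d\<close> is the error allowed in the mass and in the energy: half of the
    largest value with \<open>a + d <= b * (1 - d)\<close>.\<close>
  define d where "d = (b - a) / (1 + b) / 2"
  have d: "d > 0" using ab by (simp add: d_def)
  have "2 * (d * (1 + b)) = b - a"
    using ab by (simp add: d_def field_simps)
  moreover have "d * (1 + b) > 0" using d ab by simp
  ultimately have d2: "a + d < b * (1 - d)"
    by (simp add: algebra_simps)
  \<comment> \<open>Chosen such that the factor \<open>s powr (1 - p)\<close> turns
    \<open>e powr p\<close> into exactly \<open>d\<close>.\<close>
  define e where "e = (d * s powr (p - 1)) powr (1 / p)"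
  have e: "e > 0" using d s by (simp add: e_def)
  have ep: "s powr (1 - p) * e powr p = d"
  proof -
    have "e powr p = d * s powr (p - 1)"
      using d s p by (simp add: e_def powr_powr)
    then have "s powr (1 - p) * e powr p = d * (s powr (1 - p) * s powr (p - 1))"
      by simp
    also have "s powr (1 - p) * s powr (p - 1) = 1"
      using s by (simp flip: powr_add)
    finally show ?thesis by simp
  qed
  obtain \<phi> where \<phi>: "\<phi> \<in> test_functions U" and near: "W1p_norm p U (\<lambda>x. u x - \<phi> x) < e"
    using uW(1) e by (auto simp: W1p0_def)
  have sm: "smooth \<phi>" using \<phi> by (rule test_functions_smooth)
  define D where "D x = u x - \<phi> x" for x
  have "Lp_norm p U D < e" "Lp_norm p U (grad U D) < e"
  proof -
    have "Lp_norm p U D \<ge> 0" "Lp_norm p U (grad U D) \<ge> 0"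
      by (simp_all add: Lp_norm_def)
    then show "Lp_norm p U D < e" "Lp_norm p U (grad U D) < e"
      using near unfolding W1p_norm_def D_def by linarith+
  qed
  then have D: "(LINT x|?M. norm (D x) powr p) < e powr p" "(LINT x|?M. norm (grad U D x) powr p) < e powr p"
    using e p by (auto simp: Lp_norm_def intro!: powr_le_cancel_exponent)
  note \<phi>L = test_function_Lp_space[OF U \<phi>, of p, unfolded Lp_space_def]
  have \<phi>m: "\<phi> \<in> borel_measurable ?M" "nabla \<phi> \<in> borel_measurable ?M"
    and \<phi>i: "integrable ?M (\<lambda>x. norm (\<phi> x) powr p)" "integrable ?M (\<lambda>x. norm (nabla \<phi> x) powr p)"
    using \<phi>L p by auto
  have Di: "integrable ?M (\<lambda>x. norm (D x) powr p)"
    using integral_norm_add_powr_le(1)[of p s u ?M "\<lambda>x. - \<phi> x"] p s u_meas u_int \<phi>m \<phi>i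
    by (simp add: D_def)
  have Dm: "D \<in> borel_measurable ?M"
    using u_meas \<phi>m unfolding D_def by measurable
  \<comment> \<open>\<open>u\<close> is regarded as a perturbation of \<open>\<phi>\<close> to bound
    the mass of \<open>\<phi>\<close> from below; for the energy the roles are exchanged, which
    gives an upper bound.\<close>
  have "(LINT x|?M. norm (\<phi> x + D x) powr p) \<le>
      (1 - s) powr (1 - p) * (LINT x|?M. norm (\<phi> x) powr p) + s powr (1 - p) * (LINT x|?M. norm (D x) powr p)"
    using p s by (intro integral_norm_add_powr_le \<phi>m \<phi>i Dm Di) auto
  also have "\<dots> \<le> (1 - s) powr (1 - p) * mass p \<phi> + s powr (1 - p) * e powr p"
    using D(1) unfolding mass_eq_lebesgue_on[OF U \<phi>] by (intro add_left_mono mult_left_mono) auto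
  finally have "1 - d \<le> (1 - s) powr (1 - p) * mass p \<phi>"
    using u1 by (simp add: D_def ep)
  then have "(1 - s) powr (p - 1) * (1 - d) \<le> (1 - s) powr (p - 1) * ((1 - s) powr (1 - p) * mass p \<phi>)"
    by (intro mult_left_mono) auto
  also have "\<dots> = mass p \<phi>"
  proof -
    have "(1 - s) powr (p - 1) * (1 - s) powr (1 - p) = 1"
      using s by (simp flip: powr_add)
    then show ?thesis by (simp flip: mult.assoc)
  qed
  finally have mass: "b * (1 - d) \<le> C * mass p \<phi>"
    using C0 by (simp add: b_def)
  define G where "G x = nabla \<phi> x - ?g x" for x
  have Gm: "G \<in> borel_measurable ?M"
    using g_meas \<phi>m unfolding G_def by measurable
  have Gi: "integrable ?M (\<lambda>x. norm (G x) powr p)"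
    using integral_norm_add_powr_le(1)[of p s "nabla \<phi>" ?M "\<lambda>x. - ?g x"] p s g_meas g_int \<phi>m \<phi>i
    by (simp add: G_def)
  have "weak_gradient U D (\<lambda>x. ?g x - nabla \<phi> x)"
    unfolding D_def by (rule weak_gradient_diff[OF U weak_gradient_grad[OF v(2)] sm])
  then have "(LINT x|?M. norm (grad U D x) powr p) = (LINT x|?M. norm (?g x - nabla \<phi> x) powr p)"
    using g_meas \<phi>m by (intro integral_norm_grad_powr[OF U] borel_measurable_diff)
  then have G_small: "(LINT x|?M. norm (G x) powr p) < e powr p"
    using D(2) by (simp add: G_def norm_minus_commute)
  have "(LINT x|?M. norm (?g x + G x) powr p) \<le>
      (1 - s) powr (1 - p) * (LINT x|?M. norm (?g x) powr p) + s powr (1 - p) * (LINT x|?M. norm (G x) powr p)"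
    using p s by (intro integral_norm_add_powr_le g_meas g_int Gm Gi) auto
  also have "\<dots> \<le> a + s powr (1 - p) * e powr p"
    using G_small by (simp add: a_def E_def energy_def mult_left_mono)
  finally have "dirichlet p \<phi> \<le> a + d"
    unfolding G_def ep by (simp add: dirichlet_eq_lebesgue_on[OF U \<phi>])
  with mass d2 have "dirichlet p \<phi> < C * mass p \<phi>"
    by linarith
  with \<phi> show thesis by (rule that)
qed

section \<open>Families of test functions\<close>

text \<open>The integrand is bounded on the compact set \<open>S \<times> K\<close>, so a multiple
  of the indicator of \<open>K\<close> dominates.\<close>

lemma continuous_on_integral_param:
  fixes h :: "'a::metric_space \<Rightarrow> real ^ 'n::finite \<Rightarrow> real"
  assumes S: "compact S" and K: "compact K" "\<And>s x. s \<in> S \<Longrightarrow> x \<notin> K \<Longrightarrow> h s x = 0"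
    and h: "continuous_on (S \<times> UNIV) (\<lambda>z. h (fst z) (snd z))"
  shows "continuous_on S (\<lambda>s. LINT x|lebesgue. h s x)"
proof (rule continuous_on_sequentiallyI)
  fix u a assume u: "\<forall>n. u n \<in> S" "a \<in> S" "u \<longlonglongrightarrow> a"
  have "compact ((\<lambda>z. h (fst z) (snd z)) ` (S \<times> K))"
    using S K(1) by (intro compact_continuous_image continuous_on_subset[OF h] compact_Times) auto
  then have "bounded ((\<lambda>z. h (fst z) (snd z)) ` (S \<times> K))"
    by (rule compact_imp_bounded)
  then obtain B where "\<forall>y\<in>(\<lambda>z. h (fst z) (snd z)) ` (S \<times> K). norm y \<le> B"
    unfolding bounded_iff ..
  from bspec[OF this imageI] have B: "\<bar>h (fst z) (snd z)\<bar> \<le> B" if "z \<in> S \<times> K" for z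
    using that by simp
  have cont: "continuous_on UNIV (h s)" if "s \<in> S" for s
  proof -
    have "continuous_on UNIV (\<lambda>x. (\<lambda>z. h (fst z) (snd z)) (s, x))"
      by (rule continuous_on_compose2[OF h]) (use that in \<open>auto intro!: continuous_intros\<close>)
    then show ?thesis by simp
  qed
  show "(\<lambda>n. LINT x|lebesgue. h (u n) x) \<longlonglongrightarrow> (LINT x|lebesgue. h a x)"
  proof (rule integral_dominated_convergence[where w = "\<lambda>x. B * indicator K x"])
    show "h a \<in> borel_measurable lebesgue" "h (u n) \<in> borel_measurable lebesgue" for n
      using u by (auto intro!: borel_measurable_lebesgue_continuous cont)
    show "integrable lebesgue (\<lambda>x. B * indicator K x)"
      using lmeasurable_compact[OF K(1)] by (intro integrable_mult_right) (simp add: lmeasurable_iff_integrable)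
    show "AE x in lebesgue. (\<lambda>n. h (u n) x) \<longlonglongrightarrow> h a x"
    proof (rule AE_I2)
      fix x
      have "(\<lambda>n. (\<lambda>z. h (fst z) (snd z)) (u n, x)) \<longlonglongrightarrow> (\<lambda>z. h (fst z) (snd z)) (a, x)"
        by (rule continuous_on_tendsto_compose[OF h]) (use u in \<open>auto intro!: tendsto_intros\<close>)
      then show "(\<lambda>n. h (u n) x) \<longlonglongrightarrow> h a x" by simp
    qed
    show "AE x in lebesgue. norm (h (u n) x) \<le> B * indicator K x" for n
    proof (rule AE_I2)
      fix x
      show "norm (h (u n) x) \<le> B * indicator K x"
        using B[of "(u n, x)"] K(2)[of "u n" x] u by (cases "x \<in> K") auto
    qed
  qed
qed

lemma nabla_cmult:
  assumes "smooth f"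
  shows "nabla (\<lambda>x. c * f x) x = c *\<^sub>R nabla f x"
proof (rule nabla_eqI)
  show "((\<lambda>x. c * f x) has_derivative (\<lambda>h. (c *\<^sub>R nabla f x) \<bullet> h)) (at x)"
    using has_derivative_mult_right[OF smooth_has_derivative[OF assms, of x], of c] by simp
qed

lemma nabla_diff:
  assumes "smooth f" "smooth g"
  shows "nabla (\<lambda>x. f x - g x) x = nabla f x - nabla g x"
proof (rule nabla_eqI)
  show "((\<lambda>x. f x - g x) has_derivative (\<lambda>h. (nabla f x - nabla g x) \<bullet> h)) (at x)"
    using has_derivative_diff[OF smooth_has_derivative[OF assms(1), of x] smooth_has_derivative[OF assms(2), of x]]
    by (simp add: inner_diff_left)
qed

lemma smooth_cmult: "smooth f \<Longrightarrow> smooth (\<lambda>x. c * f x)"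
  by (simp add: smooth_def Ck_cmult)

lemma smooth_diff: "smooth f \<Longrightarrow> smooth g \<Longrightarrow> smooth (\<lambda>x. f x - g x)"
  by (simp add: smooth_def Ck_diff)

lemma mass_cmult: "mass p (\<lambda>x. c * f x) = \<bar>c\<bar> powr p * mass p f"
  by (simp add: mass_def abs_mult powr_mult)

lemma dirichlet_cmult: "smooth f \<Longrightarrow> dirichlet p (\<lambda>x. c * f x) = \<bar>c\<bar> powr p * dirichlet p f"
  by (simp add: dirichlet_def nabla_cmult powr_mult)

text \<open>Joint continuity of values and gradients and one support set for all parameters: with
  \<open>K\<close> compact this gives continuity of the parameter map in the Sobolev norm.\<close>

definition smooth_family ::
    "'a::metric_space set \<Rightarrow> (real ^ 'n::finite) set \<Rightarrow> ('a \<Rightarrow> real ^ 'n \<Rightarrow> real) \<Rightarrow> bool" where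
  "smooth_family S K F \<longleftrightarrow> (\<forall>s\<in>S. smooth (F s)) \<and> (\<forall>s\<in>S. \<forall>x. x \<notin> K \<longrightarrow> F s x = 0) \<and>
     continuous_on (S \<times> UNIV) (\<lambda>z. F (fst z) (snd z)) \<and>
     continuous_on (S \<times> UNIV) (\<lambda>z. nabla (F (fst z)) (snd z))"

lemma smooth_familyD:
  assumes "smooth_family S K F" "s \<in> S"
  shows "smooth (F s)" "x \<notin> K \<Longrightarrow> F s x = 0"
  using assms by (auto simp: smooth_family_def)

lemma smooth_family_nabla_eq_0:
  assumes "smooth_family S K F" "compact K" "s \<in> S" "x \<notin> K"
  shows "nabla (F s) x = 0"
  by (rule nabla_eq_0_outside[OF compact_imp_closed[OF assms(2)] _ assms(4)])
    (use smooth_familyD(2)[OF assms(1,3)] in simp)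

lemma smooth_family_test_functions:
  assumes "smooth_family S K F" "compact K" "K \<subseteq> U" "s \<in> S"
  shows "F s \<in> test_functions U"
  by (rule test_functionsI[OF smooth_familyD(1)[OF assms(1,4)] assms(2,3)])
    (use smooth_familyD(2)[OF assms(1,4)] in simp)

lemma smooth_family_cmult:
  assumes F: "smooth_family S K F" and c: "continuous_on S c"
  shows "smooth_family S K (\<lambda>s x. c s * F s x)"
proof -
  have c': "continuous_on (S \<times> UNIV) (\<lambda>z. c (fst z))"
    by (rule continuous_on_compose2[OF c continuous_on_fst[OF continuous_on_id]]) auto
  have "continuous_on (S \<times> UNIV) (\<lambda>z. c (fst z) *\<^sub>R nabla (F (fst z)) (snd z))"
    using F by (intro continuous_on_scaleR c') (simp add: smooth_family_def)
  then have "continuous_on (S \<times> UNIV) (\<lambda>z. nabla (\<lambda>x. c (fst z) * F (fst z) x) (snd z))"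
    by (rule continuous_on_eq) (use F in \<open>auto simp: nabla_cmult smooth_family_def\<close>)
  then show ?thesis
    using F continuous_on_mult[OF c', of "\<lambda>z. F (fst z) (snd z)"]
    unfolding smooth_family_def by (simp add: smooth_cmult)
qed

lemma smooth_family_diff:
  assumes F: "smooth_family S K F" and G: "smooth_family S K G"
  shows "smooth_family S K (\<lambda>s x. F s x - G s x)"
proof -
  have "continuous_on (S \<times> UNIV) (\<lambda>z. nabla (F (fst z)) (snd z) - nabla (G (fst z)) (snd z))"
    using F G by (intro continuous_on_diff) (simp_all add: smooth_family_def)
  then have "continuous_on (S \<times> UNIV) (\<lambda>z. nabla (\<lambda>x. F (fst z) x - G (fst z) x) (snd z))"
    by (rule continuous_on_eq) (use F G in \<open>auto simp: nabla_diff smooth_family_def\<close>)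
  moreover have "continuous_on (S \<times> UNIV) (\<lambda>z. F (fst z) (snd z) - G (fst z) (snd z))"
    using F G by (intro continuous_on_diff) (simp_all add: smooth_family_def)
  ultimately show ?thesis
    using F G unfolding smooth_family_def by (simp add: smooth_diff)
qed

lemma smooth_family_const:
  fixes S :: "'a::metric_space set"
  assumes "smooth f" "\<And>x. x \<notin> K \<Longrightarrow> f x = 0"
  shows "smooth_family S K (\<lambda>_. f)"
proof -
  have "continuous_on (S \<times> UNIV) (\<lambda>z. f (snd z))" "continuous_on (S \<times> UNIV) (\<lambda>z. nabla f (snd z))"
    using continuous_on_compose2[OF smooth_continuous[OF assms(1)] continuous_on_snd[OF continuous_on_id]]
      continuous_on_compose2[OF smooth_continuous_nabla[OF assms(1)] continuous_on_snd[OF continuous_on_id]] by simp_all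
  then show ?thesis
    using assms by (simp add: smooth_family_def)
qed

lemma continuous_on_mass:
  assumes F: "smooth_family S K F" and "compact S" "compact K" "p > 0"
  shows "continuous_on S (\<lambda>s. mass p (F s))"
  unfolding mass_def
proof (rule continuous_on_integral_param[OF assms(2,3)])
  show "continuous_on (S \<times> UNIV) (\<lambda>z. norm (F (fst z) (snd z)) powr p)"
    using F assms(4) by (intro continuous_on_norm_powr) (simp_all add: smooth_family_def)
qed (use smooth_familyD(2)[OF F] in simp)

lemma continuous_on_dirichlet:
  assumes F: "smooth_family S K F" and "compact S" "compact K" "p > 0"
  shows "continuous_on S (\<lambda>s. dirichlet p (F s))"
  unfolding dirichlet_def
proof (rule continuous_on_integral_param[OF assms(2,3)])
  show "continuous_on (S \<times> UNIV) (\<lambda>z. norm (nabla (F (fst z)) (snd z)) powr p)"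
    using F assms(4) by (intro continuous_on_norm_powr) (simp_all add: smooth_family_def)
qed (use smooth_family_nabla_eq_0[OF F assms(3)] in simp)

text \<open>The differences \<open>F s - F s0\<close> form a smooth family again, so their Sobolev
  norm is continuous in \<open>s\<close>, and it is 0 at \<open>s0\<close>.\<close>

lemma continuous_map_smooth_family:
  fixes F :: "'a::metric_space \<Rightarrow> real ^ 'n::finite \<Rightarrow> real"
  assumes F: "smooth_family S K F" and S: "compact S" and K: "compact K" "K \<subseteq> U" and U: "open U" and p: "p > 0"
  shows "continuous_map (top_of_set S) (W1p0_topology p U) F"
  unfolding continuous_map_def
proof (intro conjI allI impI)
  have test: "F s \<in> test_functions U" if "s \<in> S" for s
    using smooth_family_test_functions[OF F K that] .
  have W: "F s \<in> W1p0 p U" if "s \<in> S" for s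
    using test_functions_subset_W1p0[OF U test[OF that] p] .
  then show "F \<in> topspace (top_of_set S) \<rightarrow> topspace (W1p0_topology p U)"
    by (auto simp: topspace_W1p0_topology)
  fix V assume "openin (W1p0_topology p U) V"
  then have V: "W1p0_open p U V"
    by (simp add: openin_W1p0_topology)
  show "openin (top_of_set S) {s \<in> topspace (top_of_set S). F s \<in> V}"
    unfolding openin_contains_ball
  proof (intro conjI ballI)
    fix s0 assume "s0 \<in> {s \<in> topspace (top_of_set S). F s \<in> V}"
    then have s0: "s0 \<in> S" "F s0 \<in> V" by auto
    then obtain e where e: "e > 0" "\<And>w. w \<in> W1p0 p U \<Longrightarrow> W1p_norm p U (\<lambda>x. w x - F s0 x) < e \<Longrightarrow> w \<in> V"
      using V unfolding W1p0_open_def by meson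
    define H where "H s = mass p (\<lambda>x. F s x - F s0 x) powr (1 / p) + dirichlet p (\<lambda>x. F s x - F s0 x) powr (1 / p)" for s
    have Fd: "smooth_family S K (\<lambda>s x. F s x - F s0 x)"
      using smooth_familyD[OF F s0(1)] by (intro smooth_family_diff[OF F] smooth_family_const)
    have "continuous_on S H"
      unfolding H_def
      using p by (intro continuous_on_add continuous_on_powr' continuous_on_const
          continuous_on_mass[OF Fd S K(1)] continuous_on_dirichlet[OF Fd S K(1)])
        (auto simp: mass_nonneg dirichlet_nonneg)
    moreover have "H s0 = 0"
      using p by (simp add: H_def mass_def dirichlet_def nabla_zero)
    ultimately obtain d where d: "d > 0" "\<And>s. s \<in> S \<Longrightarrow> dist s s0 < d \<Longrightarrow> \<bar>H s\<bar> < e"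
      using s0 e(1) unfolding continuous_on_iff dist_real_def by (metis diff_zero)
    have "ball s0 d \<inter> S \<subseteq> {s \<in> topspace (top_of_set S). F s \<in> V}"
    proof
      fix s assume "s \<in> ball s0 d \<inter> S"
      then have s: "s \<in> S" "dist s s0 < d" by (auto simp: dist_commute)
      have "W1p_norm p U (\<lambda>x. F s x - F s0 x) = H s"
        unfolding H_def by (rule W1p_norm_test_function[OF U test_functions_diff[OF test[OF s(1)] test[OF s0(1)]] p])
      then have "W1p_norm p U (\<lambda>x. F s x - F s0 x) < e"
        using d(2)[OF s] by simp
      then show "s \<in> {s \<in> topspace (top_of_set S). F s \<in> V}"
        using e(2)[OF W[OF s(1)]] s(1) by simp
    qed
    then show "\<exists>e>0. ball s0 e \<inter> S \<subseteq> {s \<in> topspace (top_of_set S). F s \<in> V}"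
      using d(1) by blast
  qed auto
qed

text \<open>
  A compact family of test functions with Rayleigh quotients at most \<open>C\<close> bounds an eigenvalue as soon as
  no odd map on the symmetrised family into a sphere can be continuous in the parameter.
\<close>

lemma variational_eigenvalue_le_family:
  fixes F :: "'a::metric_space \<Rightarrow> real ^ 'n::finite \<Rightarrow> real"
  assumes F: "smooth_family S K F" and S: "compact S" "S \<noteq> {}" and K: "compact K" "K \<subseteq> U" and U: "open U" and p: "p > 0"
    and pos: "\<And>s. s \<in> S \<Longrightarrow> mass p (F s) > 0"
    and le: "\<And>s. s \<in> S \<Longrightarrow> dirichlet p (F s) \<le> C * mass p (F s)"
    and no_odd_map: "\<And>f. continuous_on S (\<lambda>s. f (F s)) \<Longrightarrow> (\<And>s. s \<in> S \<Longrightarrow> f (F s) \<in> sph (n - 2)) \<Longrightarrow>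
      (\<And>s. s \<in> S \<Longrightarrow> f (\<lambda>x. - F s x) = (\<lambda>i. - f (F s) i)) \<Longrightarrow> False"
  shows "variational_eigenvalue p U n \<le> ereal C"
proof -
  \<comment> \<open>\<open>mass\<close> is homogeneous of degree \<open>p\<close>; this factor
    normalises it to 1.\<close>
  define c where "c s = mass p (F s) powr (- 1 / p)" for s
  define G where "G s = (\<lambda>x. c s * F s x)" for s
  have c: "continuous_on S c"
    unfolding c_def using pos
    by (intro continuous_on_powr continuous_on_const continuous_on_mass[OF F S(1) K(1) p]) force
  have c_pos: "c s > 0" if "s \<in> S" for s
    using pos[OF that] by (simp add: c_def)
  have cp: "\<bar>c s\<bar> powr p * mass p (F s) = 1" if "s \<in> S" for s
  proof -
    have "\<bar>c s\<bar> powr p = mass p (F s) powr (- 1)"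
      using c_pos[OF that] p by (simp only: abs_of_pos) (simp only: c_def powr_powr, simp)
    then show ?thesis
      using pos[OF that] by (simp add: powr_minus)
  qed
  have Gf: "smooth_family S K G" "smooth_family S K (\<lambda>s x. - G s x)"
    using smooth_family_cmult[OF F c] smooth_family_cmult[OF F continuous_on_minus[OF c]]
    by (simp_all add: G_def[abs_def])
  have Gc: "continuous_map (top_of_set S) (W1p0_topology p U) G"
    "continuous_map (top_of_set S) (W1p0_topology p U) (\<lambda>s x. - G s x)"
    by (rule continuous_map_smooth_family[OF Gf(1) S(1) K U p]
        continuous_map_smooth_family[OF Gf(2) S(1) K U p])+
  define A where "A = G ` S \<union> (\<lambda>s x. - G s x) ` S"
  have unit: "u \<in> unit_sphere_W1p0 p U" "energy p U u \<le> C"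
    if "s \<in> S" "u = (\<lambda>x. a * F s x)" "\<bar>a\<bar> = c s" for u s a
  proof -
    have Fs: "F s \<in> test_functions U" "smooth (F s)"
      using smooth_family_test_functions[OF F K that(1)] smooth_familyD[OF F that(1)] by auto
    have u: "u \<in> test_functions U"
      unfolding that(2)
      by (rule test_functionsI[OF smooth_cmult[OF Fs(2)] K]) (simp add: smooth_familyD[OF F that(1)])
    have ap: "\<bar>a\<bar> powr p * mass p (F s) = 1"
      using cp[OF that(1)] c_pos[OF that(1)] that(3) by simp
    have "mass p u = 1"
      unfolding that(2) mass_cmult by (rule ap)
    then show "u \<in> unit_sphere_W1p0 p U"
      using test_functions_subset_W1p0[OF U u p] Lp_norm_test_function[OF U u]
      by (simp add: unit_sphere_W1p0_def)
    have "energy p U u = \<bar>a\<bar> powr p * dirichlet p (F s)"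
      unfolding energy_test_function[OF U u p] unfolding that(2) by (rule dirichlet_cmult[OF Fs(2)])
    also have "\<dots> \<le> \<bar>a\<bar> powr p * (C * mass p (F s))"
      using le[OF that(1)] by (intro mult_left_mono) auto
    also have "\<dots> = C * (\<bar>a\<bar> powr p * mass p (F s))"
      by simp
    also have "\<dots> = C"
      unfolding ap by simp
    finally show "energy p U u \<le> C" .
  qed
  have A_unit: "u \<in> unit_sphere_W1p0 p U \<and> energy p U u \<le> C" if uA: "u \<in> A" for u
  proof -
    obtain s where s: "s \<in> S" and "u = G s \<or> u = (\<lambda>x. - G s x)"
      using uA unfolding A_def by blast
    then consider "u = (\<lambda>x. c s * F s x)" | "u = (\<lambda>x. (- c s) * F s x)"
      unfolding G_def by fastforce
    then show ?thesis
    proof cases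
      case 1
      then show ?thesis
        using unit[OF s 1] c_pos[OF s] by simp
    next
      case 2
      then show ?thesis
        using unit[OF s 2] c_pos[OF s] by simp
    qed
  qed
  have "compactin (top_of_set S) S"
    using S(1) by (simp add: compactin_subtopology)
  then have compA: "compactin (W1p0_topology p U) A"
    unfolding A_def using Gc by (intro compactin_Un image_compactin)
  have symA: "symmetric_set A"
    unfolding symmetric_set_def
  proof
    fix u assume "u \<in> A"
    then obtain s where s: "s \<in> S" and "u = G s \<or> u = (\<lambda>x. - G s x)"
      unfolding A_def by blast
    then have "(\<lambda>x. - u x) = (\<lambda>x. - G s x) \<or> (\<lambda>x. - u x) = G s"
      by auto
    with s show "(\<lambda>x. - u x) \<in> A"
      unfolding A_def by blast
  qed
  have "enat n \<le> enat k"
    if k: "1 \<le> k" and f: "continuous_map (subtopology (W1p0_topology p U) A) (nsphere (k - 1)) f"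
      and odd: "\<forall>u\<in>A. f (\<lambda>x. - u x) = (\<lambda>i. - f u i)" for k f
  proof (rule ccontr)
    assume "\<not> ?thesis"
    \<comment> \<open>With \<open>k < n\<close> the target sphere, of dimension
      \<open>k - 1\<close>, is contained in the sphere of dimension \<open>n - 2\<close> of
      \<open>no_odd_map\<close>.\<close>
    then have kn: "k - 1 \<le> n - 2" using k by simp
    \<comment> \<open>\<open>no_odd_map\<close> concerns maps defined on functions, not on
      parameters. The normalising factor is therefore recovered from the function itself, in the
      same way for \<open>F s\<close> and its negative.\<close>
    define f' where "f' u = f (\<lambda>x. mass p u powr (- 1 / p) * u x)" for u
    have f'F: "f' (F s) = f (G s)" for s
      by (simp add: f'_def G_def c_def)
    have f'F': "f' (\<lambda>x. - F s x) = f (\<lambda>x. - G s x)" for s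
      using mass_cmult[of p "-1" "F s"] by (simp add: f'_def G_def c_def)
    have "continuous_map (top_of_set S) (subtopology (W1p0_topology p U) A) G"
      unfolding continuous_map_in_subtopology using Gc(1) by (simp add: A_def)
    from continuous_map_compose[OF this f]
    have fG: "continuous_on S (\<lambda>s. f (G s))" "\<And>s. s \<in> S \<Longrightarrow> f (G s) \<in> sph (k - 1)"
      by (auto simp: nsphere_eq_top_of_set o_def)
    show False
    proof (rule no_odd_map[of f'])
      show "continuous_on S (\<lambda>s. f' (F s))"
        unfolding f'F by (rule fG)
      show "f' (F s) \<in> sph (n - 2)" if "s \<in> S" for s
        unfolding f'F using fG(2)[OF that] sph_mono[OF kn] by blast
      show "f' (\<lambda>x. - F s x) = (\<lambda>i. - f' (F s) i)" if "s \<in> S" for s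
        unfolding f'F f'F' using odd that by (simp add: A_def)
    qed
  qed
  then have "enat n \<le> genus p U A"
    unfolding genus_def by (intro Inf_greatest) blast
  then have "A \<in> Gamma_sets p U n"
    using A_unit compA symA S(2) unfolding Gamma_sets_def by (auto simp: A_def)
  then have "variational_eigenvalue p U n \<le> (SUP u \<in> A. ereal (energy p U u))"
    unfolding variational_eigenvalue_def by (rule INF_lower)
  also have "\<dots> \<le> ereal C"
    using A_unit by (intro SUP_least) simp
  finally show ?thesis .
qed

lemma variational_eigenvalue_mono:
  assumes "j \<le> k"
  shows "variational_eigenvalue p U j \<le> variational_eigenvalue p U k"
proof -
  have "Gamma_sets p U k \<subseteq> Gamma_sets p U j"
  proof
    fix A assume A: "A \<in> Gamma_sets p U k"
    then have "enat j \<le> genus p U A"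
      using assms by (auto simp: Gamma_sets_def intro: order_trans[of _ "enat k"])
    with A show "A \<in> Gamma_sets p U j"
      by (simp add: Gamma_sets_def)
  qed
  then show ?thesis
    unfolding variational_eigenvalue_def by (rule INF_superset_mono) simp
qed

text \<open>The hypothesis \<open>le\<close> offers a strict inequality for \<open>\<phi>\<close>,
  so a construction may increase the quotient slightly and still stay below
  \<open>C\<close>.\<close>

lemma le_first_eigenvalue:
  fixes U :: "(real ^ 'n::finite) set"
  assumes U: "open U" and p: "p > 1"
    and le: "\<And>\<phi> C. \<phi> \<in> test_functions U \<Longrightarrow> dirichlet p \<phi> < C * mass p \<phi> \<Longrightarrow> mass p \<phi> > 0 \<Longrightarrow> L \<le> ereal C"
  shows "L \<le> first_eigenvalue p U"
  unfolding first_eigenvalue_def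
proof (rule INF_greatest)
  fix u assume u: "u \<in> unit_sphere_W1p0 p U"
  show "L \<le> ereal (energy p U u)"
  proof (rule ereal_le_epsilon2)
    fix e :: real assume "0 < e"
    then have "energy p U u < energy p U u + e" by simp
    then obtain \<phi> where \<phi>: "\<phi> \<in> test_functions U" "dirichlet p \<phi> < (energy p U u + e) * mass p \<phi>"
      using test_function_rayleigh[OF U p u] by metis
    have "mass p \<phi> \<noteq> 0"
      using \<phi>(2) dirichlet_nonneg[of p \<phi>] by auto
    then have "mass p \<phi> > 0"
      using mass_nonneg[of p \<phi>] by simp
    then have "L \<le> ereal (energy p U u + e)"
      using \<phi> by (intro le)
    then show "L \<le> ereal (energy p U u) + ereal e"
      by simp
  qed
qed

section \<open>Domains of revolution\<close>

text \<open>Downward induction, each step merging a cosine and a sine. The sum of squares of the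
  coordinates from \<open>m\<close> on thus depends only on the radius and the angles before
  \<open>m\<close>.\<close>

lemma spherical_tail_sum_squares:
  fixes X P \<theta> :: "nat \<Rightarrow> real"
  assumes "\<And>i. m \<le> i \<Longrightarrow> i < N \<Longrightarrow> X i = P i * cos (\<theta> i)" "\<And>i. m \<le> i \<Longrightarrow> i < N \<Longrightarrow> P (Suc i) = P i * sin (\<theta> i)"
    and "X N = P N" "m \<le> N"
  shows "(\<Sum>j\<in>{m..N}. (X j)\<^sup>2) = (P m)\<^sup>2"
  using assms(4,1,2,3)
proof (induction rule: inc_induct)
  case base
  then show ?case by simp
next
  case (step i)
  have "(\<Sum>j\<in>{i..N}. (X j)\<^sup>2) = (X i)\<^sup>2 + (\<Sum>j\<in>{Suc i..N}. (X j)\<^sup>2)"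
    using step.hyps by (intro sum.atLeast_Suc_atMost) auto
  also have "(\<Sum>j\<in>{Suc i..N}. (X j)\<^sup>2) = (P (Suc i))\<^sup>2"
    using step.prems by (intro step.IH) auto
  also have "(X i)\<^sup>2 + (P (Suc i))\<^sup>2 = (P i)\<^sup>2 * ((cos (\<theta> i))\<^sup>2 + (sin (\<theta> i))\<^sup>2)"
    using step.prems(1)[of i] step.prems(2)[of i] step.hyps
    by (simp only: power_mult_distrib distrib_left order_refl)
  finally show ?case by simp
qed

text \<open>The arccosine splits off one coordinate at a time and leaves the radius
  \<open>\<rho> * sin t\<close> for the rest; the last two coordinates are ordinary polar
  coordinates.\<close>

lemma spherical_angles_exist:
  fixes Y :: "nat \<Rightarrow> real"
  assumes "m \<le> N" "\<rho> \<ge> 0" "\<rho>\<^sup>2 = (\<Sum>j\<in>{m..Suc N}. (Y j)\<^sup>2)"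
  shows "\<exists>\<theta>. (\<forall>j\<in>{m..<N}. \<theta> j \<in> {0..pi}) \<and> \<theta> N \<in> {0..<2 * pi} \<and>
    (\<forall>j\<in>{m..N}. Y j = \<rho> * (\<Prod>i\<in>{m..<j}. sin (\<theta> i)) * cos (\<theta> j)) \<and>
    Y (Suc N) = \<rho> * (\<Prod>i\<in>{m..<Suc N}. sin (\<theta> i))"
  using assms
proof (induction arbitrary: \<rho> rule: inc_induct)
  case base
  have sq: "\<rho>\<^sup>2 = (Y N)\<^sup>2 + (Y (Suc N))\<^sup>2"
    using base by simp
  obtain t where t: "0 \<le> t" "t < 2 * pi" "Y N = \<rho> * cos t" "Y (Suc N) = \<rho> * sin t"
  proof (cases "\<rho> = 0")
    case True
    then have "Y N = 0" "Y (Suc N) = 0"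
      using sq by (simp_all add: sum_power2_eq_zero_iff)
    then show thesis
      using that[of 0] True by simp
  next
    case False
    have "(Y N / \<rho>)\<^sup>2 + (Y (Suc N) / \<rho>)\<^sup>2 = ((Y N)\<^sup>2 + (Y (Suc N))\<^sup>2) / \<rho>\<^sup>2"
      by (simp add: power_divide add_divide_distrib)
    also have "\<dots> = 1"
      using False by (simp flip: sq)
    finally have "(Y N / \<rho>)\<^sup>2 + (Y (Suc N) / \<rho>)\<^sup>2 = 1" .
    then obtain t where "0 \<le> t" "t < 2 * pi" "Y N / \<rho> = cos t" "Y (Suc N) / \<rho> = sin t"
      using sincos_total_2pi by metis
    then show thesis
      using that[of t] False by (simp add: field_simps)
  qed
  then show ?case
    by (intro exI[of _ "\<lambda>_. t"]) simp
next
  case (step m)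
  define T where "T = (\<Sum>j\<in>{Suc m..Suc N}. (Y j)\<^sup>2)"
  have sum: "\<rho>\<^sup>2 = (Y m)\<^sup>2 + T"
    unfolding T_def using step by (subst step.prems(2), intro sum.atLeast_Suc_atMost) auto
  have T: "T \<ge> 0"
    unfolding T_def by (intro sum_nonneg) simp
  obtain t where t: "0 \<le> t" "t \<le> pi" "Y m = \<rho> * cos t"
  proof (cases "\<rho> = 0")
    case True
    then have "(Y m)\<^sup>2 + T = 0"
      using sum by simp
    then have "(Y m)\<^sup>2 = 0"
      using T by (simp add: add_nonneg_eq_0_iff)
    then show thesis
      using that[of 0] True by simp
  next
    case False
    have "(Y m)\<^sup>2 \<le> \<rho>\<^sup>2"
      using sum T by simp
    then have "\<bar>Y m\<bar> \<le> \<rho>"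
      using step.prems(1) by (simp add: abs_le_square_iff[symmetric])
    then have "\<bar>Y m / \<rho>\<bar> \<le> 1"
      using False step.prems(1) by simp
    then have "- 1 \<le> Y m / \<rho>" "Y m / \<rho> \<le> 1"
      by linarith+
    then show thesis
      using False by (intro that[of "arccos (Y m / \<rho>)"] arccos_lbound arccos_ubound) simp_all
  qed
  have st: "sin t \<ge> 0"
    using t by (intro sin_ge_zero) auto
  have "(\<rho> * sin t)\<^sup>2 = \<rho>\<^sup>2 * (1 - (cos t)\<^sup>2)"
    by (simp add: power_mult_distrib sin_squared_eq)
  also have "\<dots> = \<rho>\<^sup>2 - (Y m)\<^sup>2"
    using t by (simp add: power_mult_distrib algebra_simps)
  also have "\<dots> = (\<Sum>j\<in>{Suc m..Suc N}. (Y j)\<^sup>2)"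
    using sum by (simp add: T_def)
  finally obtain \<theta> where \<theta>: "\<forall>j\<in>{Suc m..<N}. \<theta> j \<in> {0..pi}" "\<theta> N \<in> {0..<2 * pi}"
    "\<forall>j\<in>{Suc m..N}. Y j = \<rho> * sin t * (\<Prod>i\<in>{Suc m..<j}. sin (\<theta> i)) * cos (\<theta> j)"
    "Y (Suc N) = \<rho> * sin t * (\<Prod>i\<in>{Suc m..<Suc N}. sin (\<theta> i))"
    using step.IH[of "\<rho> * sin t"] step.prems(1) st by auto
  define \<theta>' where "\<theta>' = \<theta>(m := t)"
  have prod: "(\<Prod>i\<in>{m..<j}. sin (\<theta>' i)) = sin t * (\<Prod>i\<in>{Suc m..<j}. sin (\<theta> i))" if "m < j" for j
  proof -
    have "(\<Prod>i\<in>{m..<j}. sin (\<theta>' i)) = sin (\<theta>' m) * (\<Prod>i\<in>{Suc m..<j}. sin (\<theta>' i))"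
      using that by (rule prod.atLeast_Suc_lessThan)
    also have "(\<Prod>i\<in>{Suc m..<j}. sin (\<theta>' i)) = (\<Prod>i\<in>{Suc m..<j}. sin (\<theta> i))"
      by (intro prod.cong) (auto simp: \<theta>'_def)
    finally show ?thesis by (simp add: \<theta>'_def)
  qed
  show ?case
  proof (intro exI[of _ \<theta>'] conjI ballI)
    show "\<theta>' j \<in> {0..pi}" if "j \<in> {m..<N}" for j
      using \<theta>(1) t that by (cases "j = m") (auto simp: \<theta>'_def)
    show "\<theta>' N \<in> {0..<2 * pi}"
      using \<theta>(2) step.hyps by (simp add: \<theta>'_def)
    show "Y j = \<rho> * (\<Prod>i\<in>{m..<j}. sin (\<theta>' i)) * cos (\<theta>' j)" if "j \<in> {m..N}" for j
    proof (cases "j = m")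
      case True
      then show ?thesis using t by (simp add: \<theta>'_def)
    next
      case False
      then have "m < j" "j \<in> {Suc m..N}" using that by auto
      then show ?thesis
        using \<theta>(3) by (simp add: prod) (simp add: \<theta>'_def)
    qed
    show "Y (Suc N) = \<rho> * (\<Prod>i\<in>{m..<Suc N}. sin (\<theta>' i))"
      using \<theta>(4) step.hyps by (simp add: prod del: prod.op_ivl_Suc)
  qed
qed

lemma sum_enumerated_coords:
  fixes e :: "nat \<Rightarrow> 'n::finite"
  assumes "bij_betw e {1..CARD('n)} UNIV"
  shows "(\<Sum>i\<in>UNIV. g i) = (\<Sum>j\<in>{1..CARD('n)}. g (e j))"
  using sum.reindex_bij_betw[OF assms, of g] by simp

lemma norm_square_enumerated_coords:
  fixes e :: "nat \<Rightarrow> 'n::finite" and x :: "real ^ 'n"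
  assumes "bij_betw e {1..CARD('n)} UNIV"
  shows "(norm x)\<^sup>2 = (\<Sum>j\<in>{1..CARD('n)}. (x $ e j)\<^sup>2)"
  by (simp add: norm_vec_def L2_set_def sum_nonneg sum_enumerated_coords[OF assms])

lemma spherical_prefix_nonneg:
  fixes e :: "nat \<Rightarrow> 'n::finite" and x :: "real ^ 'n"
  assumes "spherical_coords e x r \<theta>" "m \<le> CARD('n) - 1"
  shows "r * (\<Prod>j\<in>{1..<m}. sin (\<theta> j)) \<ge> 0"
proof -
  have "sin (\<theta> j) \<ge> 0" if "j \<in> {1..<m}" for j
    using assms that by (intro sin_ge_zero) (auto simp: spherical_coords_def)
  then show ?thesis
    using assms(1) by (intro mult_nonneg_nonneg prod_nonneg) (auto simp: spherical_coords_def)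
qed

text \<open>\<open>y\<close> takes over the radius and the angles before \<open>l\<close>. Its
  coordinates from \<open>l\<close> on have the same sum of squares as those of \<open>x\<close>, so
  suitable further angles exist. Orthogonal maps that fix the coordinates before \<open>l\<close>
  therefore preserve the domain.\<close>

lemma domain_of_revolutions_invariant:
  fixes e :: "nat \<Rightarrow> 'n::finite" and x y :: "real ^ 'n"
  assumes N: "CARD('n) \<ge> 2" and e: "bij_betw e {1..CARD('n)} UNIV" and l: "l \<in> {1..CARD('n) - 1}"
    and \<Omega>: "domain_of_revolutions e l \<Omega>"
    and x: "x \<in> \<Omega>" and coords: "\<And>j. 1 \<le> j \<Longrightarrow> j < l \<Longrightarrow> y $ e j = x $ e j" and norm: "norm y = norm x"
  shows "y \<in> \<Omega>"
proof -
  obtain M where M: "CARD('n) = Suc M" "M \<ge> 1"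
    using N by (metis Suc_1 Suc_le_D Suc_le_mono One_nat_def)
  obtain Q where Q: "\<Omega> = {x. \<exists>r \<theta>. spherical_coords e x r \<theta> \<and> (r, restrict \<theta> {1..<l}) \<in> Q}"
    using \<Omega> unfolding domain_of_revolutions_def by blast
  obtain r \<theta> where r: "spherical_coords e x r \<theta>" "(r, restrict \<theta> {1..<l}) \<in> Q"
    using x unfolding Q by blast
  have rD: "0 \<le> r" "\<forall>i\<in>{1..M - 1}. \<theta> i \<in> {0..pi}"
    "\<forall>i\<in>{1..M}. x $ e i = r * (\<Prod>j\<in>{1..<i}. sin (\<theta> j)) * cos (\<theta> i)"
    "x $ e (Suc M) = r * (\<Prod>j\<in>{1..<Suc M}. sin (\<theta> j))"
    using r(1) by (simp_all add: spherical_coords_def M(1))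
  have lM: "1 \<le> l" "l \<le> M" using l M by auto
  define P where "P i = r * (\<Prod>j\<in>{1..<i}. sin (\<theta> j))" for i
  have x_tail: "(\<Sum>j\<in>{l..Suc M}. (x $ e j)\<^sup>2) = (P l)\<^sup>2"
  proof (rule spherical_tail_sum_squares)
    show "x $ e i = P i * cos (\<theta> i)" "P (Suc i) = P i * sin (\<theta> i)" if "l \<le> i" "i < Suc M" for i
      using rD(3) lM that by (simp_all add: P_def)
    show "x $ e (Suc M) = P (Suc M)"
      using rD(4) by (simp add: P_def)
  qed (use lM in auto)
  have split: "(\<Sum>j\<in>{1..Suc M}. g j) = (\<Sum>j\<in>{1..<l}. g j) + (\<Sum>j\<in>{l..Suc M}. g j)" for g :: "nat \<Rightarrow> real"
  proof -
    have "{1..Suc M} = {1..<l} \<union> {l..Suc M}"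
      using lM by auto
    then show ?thesis
      by (simp only: sum.union_disjoint finite_atLeastLessThan finite_atLeastAtMost) (rule sum.union_disjoint, auto)
  qed
  have "(norm y)\<^sup>2 = (norm x)\<^sup>2"
    using norm by simp
  moreover have "(\<Sum>j\<in>{1..<l}. (y $ e j)\<^sup>2) = (\<Sum>j\<in>{1..<l}. (x $ e j)\<^sup>2)"
    using coords by (intro sum.cong) auto
  ultimately have "(P l)\<^sup>2 = (\<Sum>j\<in>{l..Suc M}. (y $ e j)\<^sup>2)"
    using x_tail unfolding norm_square_enumerated_coords[OF e] M(1) split by simp
  moreover have "P l \<ge> 0"
    using spherical_prefix_nonneg[OF r(1), of l] l by (simp add: P_def)
  ultimately obtain \<theta>' where \<theta>': "\<forall>j\<in>{l..<M}. \<theta>' j \<in> {0..pi}" "\<theta>' M \<in> {0..<2 * pi}"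
    "\<forall>j\<in>{l..M}. y $ e j = P l * (\<Prod>i\<in>{l..<j}. sin (\<theta>' i)) * cos (\<theta>' j)"
    "y $ e (Suc M) = P l * (\<Prod>i\<in>{l..<Suc M}. sin (\<theta>' i))"
    using spherical_angles_exist[OF lM(2), of "P l" "\<lambda>j. y $ e j"] by auto
  define \<eta> where "\<eta> j = (if j < l then \<theta> j else \<theta>' j)" for j
  have prod1: "r * (\<Prod>j\<in>{1..<i}. sin (\<eta> j)) = P i" if "i \<le> l" for i
    unfolding P_def using that by (intro arg_cong[of _ _ "(*) r"] prod.cong) (auto simp: \<eta>_def)
  have prod2: "r * (\<Prod>j\<in>{1..<i}. sin (\<eta> j)) = P l * (\<Prod>j\<in>{l..<i}. sin (\<theta>' j))" if "l \<le> i" for i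
  proof -
    have "(\<Prod>j\<in>{1..<i}. sin (\<eta> j)) = (\<Prod>j\<in>{1..<l}. sin (\<eta> j)) * (\<Prod>j\<in>{l..<i}. sin (\<eta> j))"
      using lM that by (intro prod.atLeastLessThan_concat[symmetric]) auto
    also have "(\<Prod>j\<in>{l..<i}. sin (\<eta> j)) = (\<Prod>j\<in>{l..<i}. sin (\<theta>' j))"
      by (intro prod.cong) (auto simp: \<eta>_def)
    finally show ?thesis
      using prod1[of l] by (simp add: mult.assoc[symmetric])
  qed
  have "spherical_coords e y r \<eta>"
    unfolding spherical_coords_def M(1)
  proof (intro conjI ballI)
    show "0 \<le> r" by (rule rD)
    show "\<eta> i \<in> {0..pi}" if "i \<in> {1..Suc M - 2}" for i
    proof (cases "i < l")
      case True
      then show ?thesis using rD(2) that by (simp add: \<eta>_def)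
    next
      case False
      then have "i \<in> {l..<M}" using that by auto
      then show ?thesis using \<theta>'(1) False by (simp add: \<eta>_def)
    qed
    show "\<eta> (Suc M - 1) \<in> {0..<2 * pi}"
      using \<theta>'(2) lM by (simp add: \<eta>_def)
    show "y $ e i = r * (\<Prod>j\<in>{1..<i}. sin (\<eta> j)) * cos (\<eta> i)" if "i \<in> {1..Suc M - 1}" for i
    proof (cases "i < l")
      case True
      then have "x $ e i = P i * cos (\<theta> i)"
        using rD(3) that by (simp add: P_def)
      then show ?thesis
        using True that coords[of i] prod1[of i] by (simp add: \<eta>_def)
    next
      case False
      then have "l \<le> i" "i \<in> {l..M}" using that by auto
      then show ?thesis
        using \<theta>'(3) unfolding prod2[OF \<open>l \<le> i\<close>] by (simp add: \<eta>_def)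
    qed
    show "y $ e (Suc M) = r * (\<Prod>j\<in>{1..<Suc M}. sin (\<eta> j))"
      using \<theta>'(4) prod2[of "Suc M"] lM by simp
  qed
  moreover have "restrict \<eta> {1..<l} = restrict \<theta> {1..<l}"
    by (auto simp: \<eta>_def fun_eq_iff restrict_def)
  ultimately show ?thesis
    unfolding Q using r(2) by (intro CollectI exI[of _ r] exI[of _ \<eta>] conjI) simp_all
qed

lemma spherical_coords_last_two:
  fixes e :: "nat \<Rightarrow> 'n::finite" and x :: "real ^ 'n"
  assumes N: "CARD('n) \<ge> 2" and r: "spherical_coords e x r \<theta>"
  defines "\<rho> \<equiv> r * (\<Prod>j\<in>{1..<CARD('n) - 1}. sin (\<theta> j))"
  shows "x $ e (CARD('n) - 1) = \<rho> * cos (\<theta> (CARD('n) - 1))" "x $ e CARD('n) = \<rho> * sin (\<theta> (CARD('n) - 1))"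
proof -
  obtain M where M: "CARD('n) = Suc M" "M \<ge> 1"
    using N by (metis Suc_1 Suc_le_D Suc_le_mono One_nat_def)
  show "x $ e (CARD('n) - 1) = \<rho> * cos (\<theta> (CARD('n) - 1))" "x $ e CARD('n) = \<rho> * sin (\<theta> (CARD('n) - 1))"
    using r M(2) unfolding spherical_coords_def \<rho>_def M(1) by simp_all
qed

text \<open>Where the last two coordinates vanish the last angle is arbitrary. In particular it may
  be 0, a value forbidden in the wedge.\<close>

lemma spherical_coords_last_angle_free:
  fixes e :: "nat \<Rightarrow> 'n::finite" and x :: "real ^ 'n"
  assumes N: "CARD('n) \<ge> 2" and r: "spherical_coords e x r \<theta>"
    and 0: "r * (\<Prod>j\<in>{1..<CARD('n) - 1}. sin (\<theta> j)) = 0"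
  shows "spherical_coords e x r (\<theta>(CARD('n) - 1 := 0))"
proof -
  obtain M where M: "CARD('n) = Suc M" "M \<ge> 1"
    using N by (metis Suc_1 Suc_le_D Suc_le_mono One_nat_def)
  have prod: "(\<Prod>j\<in>{1..<i}. sin ((\<theta>(M := 0)) j)) = (\<Prod>j\<in>{1..<i}. sin (\<theta> j))" if "i \<le> M" for i
    using that by (intro prod.cong) auto
  have prod': "(\<Prod>j\<in>{1..<Suc M}. sin (\<eta> j)) = (\<Prod>j\<in>{1..<M}. sin (\<eta> j)) * sin (\<eta> M)" for \<eta> :: "nat \<Rightarrow> real"
    using M(2) by simp
  have x: "\<forall>i\<in>{1..M}. x $ e i = r * (\<Prod>j\<in>{1..<i}. sin (\<theta> j)) * cos (\<theta> i)"
    "x $ e (Suc M) = r * (\<Prod>j\<in>{1..<Suc M}. sin (\<theta> j))"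
    using r by (simp_all add: spherical_coords_def M(1))
  have 0: "r * (\<Prod>j\<in>{1..<M}. sin (\<theta> j)) = 0"
    using 0 by (simp add: M(1))
  show ?thesis
    unfolding spherical_coords_def M(1)
  proof (intro conjI ballI)
    show "(\<theta>(Suc M - 1 := 0)) i \<in> {0..pi}" if "i \<in> {1..Suc M - 2}" for i
      using r that by (auto simp: spherical_coords_def M(1))
    show "0 \<le> r" using r by (simp add: spherical_coords_def)
    show "(\<theta>(Suc M - 1 := 0)) (Suc M - 1) \<in> {0..<2 * pi}"
      by simp
    show "x $ e i = r * (\<Prod>j\<in>{1..<i}. sin ((\<theta>(Suc M - 1 := 0)) j)) * cos ((\<theta>(Suc M - 1 := 0)) i)"
      if "i \<in> {1..Suc M - 1}" for i
    proof (cases "i = M")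
      case True
      then have "x $ e i = 0"
        using x(1) that 0 by simp
      then show ?thesis
        using True prod[of M] 0 by simp
    next
      case False
      then show ?thesis
        using x(1) that prod[of i] by simp
    qed
    show "x $ e (Suc M) = r * (\<Prod>j\<in>{1..<Suc M}. sin ((\<theta>(Suc M - 1 := 0)) j))"
      using x(2) 0 unfolding prod' by (simp add: mult.assoc[symmetric])
  qed
qed

section \<open>Wedges cut out by half-spaces\<close>

text \<open>Up to a positive factor the two inequalities say \<open>sin t > 0\<close> and
  \<open>sin (t - pi / k) < 0\<close> for the last angle \<open>t\<close>. As
  \<open>pi / k <= pi\<close>, this means that \<open>t\<close> lies between 0 and
  \<open>pi / k\<close>.\<close>

lemma wedge_eq_half_planes:
  fixes e :: "nat \<Rightarrow> 'n::finite" and \<Omega> :: "(real ^ 'n) set"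
  assumes N: "CARD('n) \<ge> 2" and \<Omega>: "domain_of_revolutions e l \<Omega>" and k: "k \<ge> 1"
  shows "wedge e \<Omega> k = {x \<in> \<Omega>. 0 < x $ e CARD('n) \<and>
    x $ e CARD('n) * cos (pi / real k) - x $ e (CARD('n) - 1) * sin (pi / real k) < 0}"
proof -
  let ?N = "CARD('n)"
  have pk: "0 < pi / real k" "pi / real k \<le> pi"
    using k by (auto simp: field_simps)
  have key: "(0 < x $ e ?N \<and> x $ e ?N * cos (pi / real k) - x $ e (?N - 1) * sin (pi / real k) < 0) \<longleftrightarrow>
      r * (\<Prod>j\<in>{1..<?N - 1}. sin (\<theta> j)) > 0 \<and> 0 < \<theta> (?N - 1) \<and> \<theta> (?N - 1) < pi / real k"
    if r: "spherical_coords e x r \<theta>" for x r \<theta>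
  proof -
    define \<rho> t where "\<rho> = r * (\<Prod>j\<in>{1..<?N - 1}. sin (\<theta> j))" and "t = \<theta> (?N - 1)"
    have \<rho>: "\<rho> \<ge> 0"
      using spherical_prefix_nonneg[OF r, of "?N - 1"] by (simp add: \<rho>_def)
    have t: "0 \<le> t" "t < 2 * pi"
      using r by (auto simp: spherical_coords_def t_def)
    have x: "x $ e (?N - 1) = \<rho> * cos t" "x $ e ?N = \<rho> * sin t"
      using spherical_coords_last_two[OF N r] by (simp_all add: \<rho>_def t_def)
    have diff: "x $ e ?N * cos (pi / real k) - x $ e (?N - 1) * sin (pi / real k) = \<rho> * sin (t - pi / real k)"
      unfolding x by (simp add: sin_diff algebra_simps)
    have "(0 < \<rho> * sin t \<and> \<rho> * sin (t - pi / real k) < 0) \<longleftrightarrow> \<rho> > 0 \<and> 0 < t \<and> t < pi / real k"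
    proof
      assume *: "0 < \<rho> * sin t \<and> \<rho> * sin (t - pi / real k) < 0"
      then have "\<rho> > 0" using \<rho> by (cases "\<rho> = 0") auto
      then have s: "sin t > 0" "sin (t - pi / real k) < 0"
        using * by (simp_all add: zero_less_mult_iff mult_less_0_iff)
      have "t \<noteq> 0" using s by auto
      moreover have "t < pi"
        using s(1) sin_le_zero[of t] t by (meson not_le)
      moreover have "t < pi / real k"
      proof (rule ccontr)
        assume "\<not> t < pi / real k"
        then have "sin (t - pi / real k) \<ge> 0"
          using pk \<open>t < pi\<close> by (intro sin_ge_zero) auto
        with s show False by simp
      qed
      ultimately show "\<rho> > 0 \<and> 0 < t \<and> t < pi / real k"
        using t \<open>\<rho> > 0\<close> by auto
    next
      assume *: "\<rho> > 0 \<and> 0 < t \<and> t < pi / real k"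
      then have "sin t > 0"
        using pk by (intro sin_gt_zero) auto
      moreover have "sin (pi / real k - t) > 0"
        using pk * by (intro sin_gt_zero) auto
      then have "sin (t - pi / real k) < 0"
        using sin_minus[of "pi / real k - t"] by simp
      ultimately show "0 < \<rho> * sin t \<and> \<rho> * sin (t - pi / real k) < 0"
        using * by (simp add: mult_pos_neg)
    qed
    then show ?thesis
      unfolding diff unfolding x unfolding \<rho>_def t_def .
  qed
  show ?thesis
  proof (intro Set.set_eqI iffI)
    fix x assume x: "x \<in> wedge e \<Omega> k"
    then have xw: "x \<in> \<Omega>" "\<And>r \<theta>. spherical_coords e x r \<theta> \<Longrightarrow> 0 < \<theta> (?N - 1) \<and> \<theta> (?N - 1) < pi / real k"
      by (auto simp: wedge_def)
    then obtain r \<theta> where r: "spherical_coords e x r \<theta>"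
      using \<Omega> unfolding domain_of_revolutions_def by blast
    \<comment> \<open>Otherwise the last angle could be set to 0, against membership in the
      wedge.\<close>
    have "0 \<noteq> r * (\<Prod>j\<in>{1..<?N - 1}. sin (\<theta> j))"
      using xw(2)[OF spherical_coords_last_angle_free[OF N r]] by auto
    with spherical_prefix_nonneg[OF r order_refl] have "r * (\<Prod>j\<in>{1..<?N - 1}. sin (\<theta> j)) > 0"
      by (rule le_neq_trans)
    then show "x \<in> {x \<in> \<Omega>. 0 < x $ e ?N \<and> x $ e ?N * cos (pi / real k) - x $ e (?N - 1) * sin (pi / real k) < 0}"
      using xw(1) xw(2)[OF r] key[OF r] by blast
  next
    fix x assume "x \<in> {x \<in> \<Omega>. 0 < x $ e ?N \<and> x $ e ?N * cos (pi / real k) - x $ e (?N - 1) * sin (pi / real k) < 0}"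
    then show "x \<in> wedge e \<Omega> k"
      unfolding wedge_def using key by blast
  qed
qed

lemma open_wedge:
  fixes e :: "nat \<Rightarrow> 'n::finite" and \<Omega> :: "(real ^ 'n) set"
  assumes N: "CARD('n) \<ge> 2" and \<Omega>: "domain_of_revolutions e l \<Omega>" and k: "k \<ge> 1"
  shows "open (wedge e \<Omega> k)"
proof -
  have "open \<Omega>"
    using \<Omega> by (simp add: domain_of_revolutions_def bounded_domain_def)
  then show ?thesis
    unfolding wedge_eq_half_planes[OF assms]
    by (intro open_Collect_conj open_Collect_less continuous_intros) (simp add: open_Collect_conj)
qed

section \<open>Isometries and disjoint supports\<close>

text \<open>
  Uniqueness of translation-invariant measures: the double integral of
  \<open>\<lambda>(x, y). 1\<^sub>A (R x) 1\<^sub>B (R x - y)\<close> is evaluated in both orders.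
\<close>

lemma lborel_distr_orthogonal:
  fixes R :: "'a::euclidean_space \<Rightarrow> 'a"
  assumes R: "orthogonal_transformation R"
  shows "distr lborel borel R = lborel"
proof (rule measure_eqI)
  have linR: "linear R"
    using R by (rule orthogonal_transformation_linear)
  have "continuous_on UNIV R"
    using linR by (rule linear_continuous_on[OF linear_conv_bounded_linear[THEN iffD1]])
  then have Rm [measurable]: "R \<in> borel_measurable borel"
    by (rule borel_measurable_continuous_onI)
  have shift: "(\<integral>\<^sup>+x. f (c + x) \<partial>lborel) = (\<integral>\<^sup>+x. f x \<partial>lborel)"
    if [measurable]: "f \<in> borel_measurable borel" for f :: "'a \<Rightarrow> ennreal" and c
  proof -
    have "(\<integral>\<^sup>+x. f x \<partial>lborel) = (\<integral>\<^sup>+x. f x \<partial>distr lborel borel ((+) c))"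
      by (simp add: lborel_distr_plus)
    also have "\<dots> = (\<integral>\<^sup>+x. f (c + x) \<partial>lborel)"
      by (rule nn_integral_distr) auto
    finally show ?thesis ..
  qed
  fix A assume "A \<in> sets (distr lborel borel R)"
  then have A [measurable]: "A \<in> sets borel" by simp
  \<comment> \<open>\<open>B\<close> is invariant under \<open>R\<close> and under the change of
    sign; its measure is positive and finite and is cancelled at the end.\<close>
  define B where "B = ball (0 :: 'a) 1"
  have B [measurable]: "B \<in> sets borel"
    by (simp add: B_def)
  obtain R' where R': "R (R' y) = y" for y
    using orthogonal_transformation_surj[OF R] by (metis surj_def)
  have B_sym: "indicator B (x - y) = (indicator B (- x + y) :: ennreal)" for x y
    by (simp add: B_def indicator_def norm_minus_commute)
  have "(\<integral>\<^sup>+x. indicator A (R x) \<partial>lborel) * (\<integral>\<^sup>+y. indicator B y \<partial>lborel) =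
      (\<integral>\<^sup>+x. indicator A (R x) * (\<integral>\<^sup>+y. indicator B y \<partial>lborel) \<partial>lborel)"
    by (rule nn_integral_multc[symmetric]) measurable
  also have "\<dots> = (\<integral>\<^sup>+x. \<integral>\<^sup>+y. indicator A (R x) * indicator B (R x - y) \<partial>lborel \<partial>lborel)"
  proof (rule nn_integral_cong)
    fix x
    have "(\<integral>\<^sup>+y. indicator B (R x - y) \<partial>lborel) = (\<integral>\<^sup>+y. indicator B y \<partial>lborel)"
      unfolding B_sym by (rule shift) measurable
    then show "indicator A (R x) * (\<integral>\<^sup>+y. indicator B y \<partial>lborel) =
        (\<integral>\<^sup>+y. indicator A (R x) * indicator B (R x - y) \<partial>lborel)"
      by (subst nn_integral_cmult) auto
  qed
  also have "\<dots> = (\<integral>\<^sup>+y. \<integral>\<^sup>+x. indicator A (R x) * indicator B (R x - y) \<partial>lborel \<partial>lborel)"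
    by (rule lborel_pair.Fubini') measurable
  also have "\<dots> = (\<integral>\<^sup>+y. \<integral>\<^sup>+x. indicator A (R x + y) * indicator B (R x) \<partial>lborel \<partial>lborel)"
  proof (rule nn_integral_cong)
    fix y
    have "(\<integral>\<^sup>+x. indicator A (R (R' y + x)) * indicator B (R (R' y + x) - y) \<partial>lborel) =
        (\<integral>\<^sup>+x. indicator A (R x) * indicator B (R x - y) \<partial>lborel)"
      by (rule shift[of "\<lambda>x. indicator A (R x) * indicator B (R x - y)"]) measurable
    then show "(\<integral>\<^sup>+x. indicator A (R x) * indicator B (R x - y) \<partial>lborel) =
        (\<integral>\<^sup>+x. indicator A (R x + y) * indicator B (R x) \<partial>lborel)"
      by (simp add: linear_add[OF linR] R' add.commute)
  qed
  also have "\<dots> = (\<integral>\<^sup>+x. \<integral>\<^sup>+y. indicator A (R x + y) * indicator B (R x) \<partial>lborel \<partial>lborel)"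
    by (rule lborel_pair.Fubini'[symmetric]) measurable
  also have "\<dots> = (\<integral>\<^sup>+x. (\<integral>\<^sup>+y. indicator A y \<partial>lborel) * indicator B (R x) \<partial>lborel)"
  proof (rule nn_integral_cong)
    fix x
    have "(\<integral>\<^sup>+y. indicator A (R x + y) \<partial>lborel) = (\<integral>\<^sup>+y. indicator A y \<partial>lborel)"
      by (rule shift) measurable
    then show "(\<integral>\<^sup>+y. indicator A (R x + y) * indicator B (R x) \<partial>lborel) = (\<integral>\<^sup>+y. indicator A y \<partial>lborel) * indicator B (R x)"
      by (subst nn_integral_multc) auto
  qed
  also have "\<dots> = (\<integral>\<^sup>+y. indicator A y \<partial>lborel) * (\<integral>\<^sup>+x. indicator B (R x) \<partial>lborel)"
    by (rule nn_integral_cmult) measurable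
  also have "(\<lambda>x. indicator B (R x) :: ennreal) = indicator B"
    using orthogonal_transformation_norm[OF R] by (auto simp: B_def indicator_def fun_eq_iff)
  finally have "(\<integral>\<^sup>+x. indicator A (R x) \<partial>lborel) * emeasure lborel B = emeasure lborel A * emeasure lborel B"
    by simp
  moreover have "emeasure lborel B \<noteq> 0"
    using content_ball_pos[of 1 "0 :: 'a"] by (auto simp: B_def measure_def)
  moreover have "emeasure lborel B \<noteq> \<infinity>"
    using emeasure_lborel_ball_finite[of "0 :: 'a" 1] by (auto simp: B_def)
  ultimately have "(\<integral>\<^sup>+x. indicator A (R x) \<partial>lborel) = emeasure lborel A"
    using ennreal_mult_cancel_left[of "emeasure lborel B"]
    unfolding mult.commute[of _ "emeasure lborel B"] by simp
  moreover have "emeasure (distr lborel borel R) A = (\<integral>\<^sup>+x. indicator A x \<partial>distr lborel borel R)"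
    by simp
  then have "emeasure (distr lborel borel R) A = (\<integral>\<^sup>+x. indicator A (R x) \<partial>lborel)"
    by (subst (asm) nn_integral_distr) auto
  ultimately show "emeasure (distr lborel borel R) A = emeasure lborel A"
    by simp
qed simp

lemma integral_orthogonal_compose:
  fixes R :: "real ^ 'n::finite \<Rightarrow> real ^ 'n" and g :: "real ^ 'n \<Rightarrow> real"
  assumes R: "orthogonal_transformation R" and g: "continuous_on UNIV g"
  shows "(LINT x|lebesgue. g (R x)) = (LINT x|lebesgue. g x)"
proof -
  have Rc: "continuous_on UNIV R"
    using orthogonal_transformation_linear[OF R]
    by (rule linear_continuous_on[OF linear_conv_bounded_linear[THEN iffD1]])
  have gR: "continuous_on UNIV (\<lambda>x. g (R x))"
    by (rule continuous_on_compose2[OF g Rc]) simp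
  have "(LINT x|lborel. g x) = (LINT x|distr lborel borel R. g x)"
    by (simp add: lborel_distr_orthogonal[OF R])
  also have "\<dots> = (LINT x|lborel. g (R x))"
    using borel_measurable_continuous_onI[OF Rc] borel_measurable_continuous_onI[OF g]
    by (intro integral_distr) auto
  finally show ?thesis
    by (simp add: integral_lebesgue_lborel[OF g] integral_lebesgue_lborel[OF gR])
qed

lemma smooth_compose_linear: "linear R \<Longrightarrow> smooth f \<Longrightarrow> smooth (\<lambda>x. f (R x))"
  by (simp add: smooth_def Ck_compose_linear)

lemma nabla_compose_linear:
  assumes R: "linear R" and adj: "\<And>u h. u \<bullet> R h = R' u \<bullet> h" and f: "smooth f"
  shows "nabla (\<lambda>x. f (R x)) x = R' (nabla f (R x))"
proof (rule nabla_eqI)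
  have "((\<lambda>x. f (R x)) has_derivative (\<lambda>h. nabla f (R x) \<bullet> R h)) (at x)"
    by (rule has_derivative_compose[OF linear_imp_has_derivative[OF R] smooth_has_derivative[OF f]])
  then show "((\<lambda>x. f (R x)) has_derivative (\<lambda>h. R' (nabla f (R x)) \<bullet> h)) (at x)"
    unfolding adj .
qed

lemma mass_compose_orthogonal:
  fixes R :: "real ^ 'n::finite \<Rightarrow> real ^ 'n"
  assumes R: "orthogonal_transformation R" and f: "smooth f" and p: "p > 0"
  shows "mass p (\<lambda>x. f (R x)) = mass p f"
  unfolding mass_def
  by (rule integral_orthogonal_compose[OF R continuous_on_norm_powr[OF smooth_continuous[OF f] p]])

text \<open>The chain rule applies the adjoint of \<open>R\<close> to the gradient; for an
  orthogonal map this is the inverse, which preserves norms.\<close>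

lemma dirichlet_compose_orthogonal:
  fixes R :: "real ^ 'n::finite \<Rightarrow> real ^ 'n"
  assumes R: "orthogonal_transformation R" and f: "smooth f" and p: "p > 0"
  shows "dirichlet p (\<lambda>x. f (R x)) = dirichlet p f"
proof -
  have adj: "u \<bullet> R h = inv_into UNIV R u \<bullet> h" for u h
  proof -
    have "u \<bullet> R h = R (inv_into UNIV R u) \<bullet> R h"
      using surj_f_inv_f[OF orthogonal_transformation_surj[OF R], of u] by simp
    also have "\<dots> = inv_into UNIV R u \<bullet> h"
      using R by (simp add: orthogonal_transformation_def)
    finally show ?thesis .
  qed
  have "norm (nabla (\<lambda>x. f (R x)) x) = norm (nabla f (R x))" for x
    using nabla_compose_linear[OF orthogonal_transformation_linear[OF R] adj f, of x]
      orthogonal_transformation_norm[OF orthogonal_transformation_inv[OF R]] by simp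
  then have "dirichlet p (\<lambda>x. f (R x)) = (LINT x|lebesgue. norm (nabla f (R x)) powr p)"
    by (simp add: dirichlet_def)
  also have "\<dots> = dirichlet p f"
    unfolding dirichlet_def
    by (rule integral_orthogonal_compose[OF R continuous_on_norm_powr[OF smooth_continuous_nabla[OF f] p]])
  finally show ?thesis .
qed

lemma norm_sum_powr_disjoint:
  fixes y :: "'i \<Rightarrow> 'b::real_normed_vector"
  assumes "finite I" and disj: "\<And>i j. i \<in> I \<Longrightarrow> j \<in> I \<Longrightarrow> i \<noteq> j \<Longrightarrow> y i = 0 \<or> y j = 0"
  shows "norm (\<Sum>i\<in>I. a i *\<^sub>R y i) powr p = (\<Sum>i\<in>I. \<bar>a i\<bar> powr p * norm (y i) powr p)"
proof (cases "\<exists>i\<in>I. y i \<noteq> 0")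
  case True
  then obtain i where i: "i \<in> I" "y i \<noteq> 0" by blast
  then have 0: "y j = 0" if "j \<in> I - {i}" for j
    using disj[of i j] that by auto
  have "(\<Sum>i\<in>I. a i *\<^sub>R y i) = a i *\<^sub>R y i"
    using assms(1) i 0 by (simp add: sum.remove[of I i])
  moreover have "(\<Sum>i\<in>I. \<bar>a i\<bar> powr p * norm (y i) powr p) = \<bar>a i\<bar> powr p * norm (y i) powr p"
    using assms(1) i 0 by (simp add: sum.remove[of I i])
  ultimately show ?thesis
    by (simp add: powr_mult)
qed simp

lemma smooth_sum: "(\<And>i. i \<in> I \<Longrightarrow> smooth (f i)) \<Longrightarrow> smooth (\<lambda>x. \<Sum>i\<in>I. f i x)"
  by (simp add: smooth_def Ck_sum)

lemma nabla_sum_cmult: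
  assumes "\<And>i. i \<in> I \<Longrightarrow> smooth (f i)"
  shows "nabla (\<lambda>x. \<Sum>i\<in>I. a i * f i x) x = (\<Sum>i\<in>I. a i *\<^sub>R nabla (f i) x)"
proof (rule nabla_eqI)
  have "((\<lambda>x. \<Sum>i\<in>I. a i * f i x) has_derivative (\<lambda>h. \<Sum>i\<in>I. a i * (nabla (f i) x \<bullet> h))) (at x)"
    by (intro has_derivative_sum has_derivative_mult_right smooth_has_derivative assms)
  then show "((\<lambda>x. \<Sum>i\<in>I. a i * f i x) has_derivative (\<lambda>h. (\<Sum>i\<in>I. a i *\<^sub>R nabla (f i) x) \<bullet> h)) (at x)"
    by (simp add: inner_sum_left)
qed

text \<open>At each point at most one summand has a nonzero value or gradient, so
  \<open>p\<close>-th powers of norms add up. Hence summands with a common Rayleigh quotient pass it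
  on to their nontrivial combinations.\<close>

lemma mass_dirichlet_disjoint_sum:
  assumes "finite I" "p > 0" and f: "\<And>i. i \<in> I \<Longrightarrow> f i \<in> test_functions U"
    and disj: "\<And>i j x. i \<in> I \<Longrightarrow> j \<in> I \<Longrightarrow> i \<noteq> j \<Longrightarrow> (f i x = 0 \<and> nabla (f i) x = 0) \<or> (f j x = 0 \<and> nabla (f j) x = 0)"
  shows "mass p (\<lambda>x. \<Sum>i\<in>I. a i * f i x) = (\<Sum>i\<in>I. \<bar>a i\<bar> powr p * mass p (f i))"
    and "dirichlet p (\<lambda>x. \<Sum>i\<in>I. a i * f i x) = (\<Sum>i\<in>I. \<bar>a i\<bar> powr p * dirichlet p (f i))"
proof -
  have "norm (\<Sum>i\<in>I. a i * f i x) powr p = (\<Sum>i\<in>I. \<bar>a i\<bar> powr p * norm (f i x) powr p)" for x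
    using norm_sum_powr_disjoint[OF assms(1), of "\<lambda>i. f i x" a p] disj by fastforce
  moreover have "norm (\<Sum>i\<in>I. a i *\<^sub>R nabla (f i) x) powr p = (\<Sum>i\<in>I. \<bar>a i\<bar> powr p * norm (nabla (f i) x) powr p)" for x
    using norm_sum_powr_disjoint[OF assms(1), of "\<lambda>i. nabla (f i) x" a p] disj by blast
  moreover have "integrable lebesgue (\<lambda>x. norm (f i x) powr p)" "integrable lebesgue (\<lambda>x. norm (nabla (f i) x) powr p)"
    if "i \<in> I" for i
    using test_function_integrable_powr[OF f[OF that] assms(2)] .
  moreover have "smooth (f i)" if "i \<in> I" for i
    using f[OF that] by (rule test_functions_smooth)
  ultimately show "mass p (\<lambda>x. \<Sum>i\<in>I. a i * f i x) = (\<Sum>i\<in>I. \<bar>a i\<bar> powr p * mass p (f i))"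
    "dirichlet p (\<lambda>x. \<Sum>i\<in>I. a i * f i x) = (\<Sum>i\<in>I. \<bar>a i\<bar> powr p * dirichlet p (f i))"
    using f by (simp_all add: mass_def dirichlet_def nabla_sum_cmult del: real_norm_def)
qed

section \<open>Rotated wedges\<close>

definition plane_rotation :: "'n \<Rightarrow> 'n \<Rightarrow> real \<Rightarrow> real ^ 'n::finite \<Rightarrow> real ^ 'n" where
  "plane_rotation a b t x = (\<chi> j. if j = a then cos t * x $ a - sin t * x $ b
     else if j = b then sin t * x $ a + cos t * x $ b else x $ j)"

lemma plane_rotation_nth:
  "plane_rotation a b t x $ a = cos t * x $ a - sin t * x $ b"
  "a \<noteq> b \<Longrightarrow> plane_rotation a b t x $ b = sin t * x $ a + cos t * x $ b"
  "j \<noteq> a \<Longrightarrow> j \<noteq> b \<Longrightarrow> plane_rotation a b t x $ j = x $ j"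
  by (simp_all add: plane_rotation_def)

lemma linear_plane_rotation: "linear (plane_rotation a b t)"
  by (rule linearI) (simp_all add: plane_rotation_def vec_eq_iff algebra_simps)

lemma plane_rotation_add:
  assumes "a \<noteq> b"
  shows "plane_rotation a b s (plane_rotation a b t x) = plane_rotation a b (s + t) x"
  using assms by (simp add: plane_rotation_def vec_eq_iff cos_add sin_add algebra_simps)

lemma plane_rotation_id: "cos t = 1 \<Longrightarrow> plane_rotation a b t x = x"
  using sin_cos_squared_add[of t] by (simp add: plane_rotation_def vec_eq_iff)

lemma inner_plane_rotation:
  fixes u h :: "real ^ 'n::finite"
  assumes "a \<noteq> b"
  shows "u \<bullet> plane_rotation a b t h = plane_rotation a b (- t) u \<bullet> h"
proof -
  have split: "(\<Sum>j\<in>UNIV. f j) = f a + f b + (\<Sum>j\<in>UNIV - {a, b}. f j)" for f :: "'n \<Rightarrow> real"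
    using assms by (subst sum.subset_diff[of "{a, b}"]) auto
  have rest: "(\<Sum>j\<in>UNIV - {a, b}. u $ j * plane_rotation a b t h $ j) = (\<Sum>j\<in>UNIV - {a, b}. u $ j * h $ j)"
    "(\<Sum>j\<in>UNIV - {a, b}. plane_rotation a b (- t) u $ j * h $ j) = (\<Sum>j\<in>UNIV - {a, b}. u $ j * h $ j)"
    by (intro sum.cong; simp add: plane_rotation_nth)+
  have "u \<bullet> plane_rotation a b t h = u $ a * plane_rotation a b t h $ a + u $ b * plane_rotation a b t h $ b +
      (\<Sum>j\<in>UNIV - {a, b}. u $ j * h $ j)"
    by (simp add: inner_vec_def split[of "\<lambda>j. u $ j * plane_rotation a b t h $ j"] rest)
  also have "\<dots> = plane_rotation a b (- t) u $ a * h $ a + plane_rotation a b (- t) u $ b * h $ b +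
      (\<Sum>j\<in>UNIV - {a, b}. u $ j * h $ j)"
    using assms by (simp add: plane_rotation_nth algebra_simps)
  also have "\<dots> = plane_rotation a b (- t) u \<bullet> h"
    by (simp add: inner_vec_def split[of "\<lambda>j. plane_rotation a b (- t) u $ j * h $ j"] rest)
  finally show ?thesis .
qed

lemma orthogonal_plane_rotation:
  assumes "a \<noteq> b"
  shows "orthogonal_transformation (plane_rotation a b t)"
  unfolding orthogonal_transformation_def
  using assms by (simp add: linear_plane_rotation inner_plane_rotation plane_rotation_add plane_rotation_id)

lemma continuous_on_plane_rotation:
  fixes g :: "'c::metric_space \<Rightarrow> real" and h :: "'c \<Rightarrow> real ^ 'n::finite"
  assumes "continuous_on S g" "continuous_on S h"
  shows "continuous_on S (\<lambda>z. plane_rotation a b (g z) (h z))"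
  unfolding plane_rotation_def
proof (rule continuous_on_vec_lambda)
  fix j
  have c: "continuous_on S (\<lambda>z. h z $ i)" for i
    using assms(2) by (rule continuous_on_component)
  consider "j = a" | "j \<noteq> a" "j = b" | "j \<noteq> a" "j \<noteq> b" by blast
  then show "continuous_on S (\<lambda>z. if j = a then cos (g z) * h z $ a - sin (g z) * h z $ b
     else if j = b then sin (g z) * h z $ a + cos (g z) * h z $ b else h z $ j)"
    by cases (simp_all add: c continuous_on_add continuous_on_diff continuous_on_mult continuous_on_cos[OF assms(1)] continuous_on_sin[OF assms(1)])
qed

text \<open>Reduction modulo \<open>2 * pi\<close>: the first sine puts the representative into the
  upper half-plane, the second then below \<open>c\<close>.\<close>

lemma sin_sector:
  assumes "sin \<gamma> > 0" "sin (\<gamma> - c) < 0" "0 < c" "c \<le> pi"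
  shows "\<exists>n::int. 0 < \<gamma> - 2 * pi * of_int n \<and> \<gamma> - 2 * pi * of_int n < c"
proof -
  define n where "n = \<lfloor>\<gamma> / (2 * pi)\<rfloor>"
  define g where "g = \<gamma> - 2 * pi * of_int n"
  have "of_int n \<le> \<gamma> / (2 * pi)" "\<gamma> / (2 * pi) < of_int n + 1"
    by (simp_all add: n_def)
  then have g: "0 \<le> g" "g < 2 * pi"
    by (simp_all add: g_def field_simps)
  have sin_shift: "sin (z - 2 * pi * of_int n) = sin z" for z
    by (simp add: sin_diff)
  have s: "sin g > 0"
    using assms(1) sin_shift[of \<gamma>] by (simp add: g_def)
  have s': "sin (g - c) < 0"
    using assms(2) sin_shift[of "\<gamma> - c"] by (simp add: g_def algebra_simps)
  have "g \<noteq> 0" using s by auto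
  moreover have "g < pi"
    using s sin_le_zero[of g] g by (meson not_le)
  moreover have "g < c"
  proof (rule ccontr)
    assume "\<not> g < c"
    then have "sin (g - c) \<ge> 0"
      using assms(3) \<open>g < pi\<close> by (intro sin_ge_zero) auto
    with s' show False by simp
  qed
  ultimately show ?thesis
    using g unfolding g_def by (intro exI[of _ n]) auto
qed

text \<open>In polar coordinates the hypothesis places the angle of \<open>(u, v)\<close>, reduced
  by \<open>\<tau> m\<close>, between 0 and \<open>pi / k\<close> modulo \<open>2 * pi\<close>.
  These \<open>2 k\<close> sectors tile the circle up to their boundary rays.\<close>

lemma rotated_sectors_disjoint:
  fixes u v \<theta> :: real and i j k :: nat
  defines "\<tau> \<equiv> \<lambda>m. \<theta> + real m * pi / real k"
  assumes k: "k \<ge> 1" and ij: "i < 2 * k" "j < 2 * k"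
    and sector: "\<And>m. m = i \<or> m = j \<Longrightarrow> 0 < cos (\<tau> m) * v - sin (\<tau> m) * u \<and>
      (cos (\<tau> m) * v - sin (\<tau> m) * u) * cos (pi / real k) - (cos (\<tau> m) * u + sin (\<tau> m) * v) * sin (pi / real k) < 0"
  shows "i = j"
proof -
  define \<rho> where "\<rho> = sqrt (u\<^sup>2 + v\<^sup>2)"
  obtain \<beta> where \<beta>: "u = \<rho> * cos \<beta>" "v = \<rho> * sin \<beta>"
  proof (cases "\<rho> = 0")
    case True
    then have "u = 0" "v = 0"
      by (simp_all add: \<rho>_def sum_power2_eq_zero_iff)
    with True show thesis using that[of 0] by simp
  next
    case False
    have "\<rho>\<^sup>2 = u\<^sup>2 + v\<^sup>2" by (simp add: \<rho>_def)
    moreover have "(u / \<rho>)\<^sup>2 + (v / \<rho>)\<^sup>2 = (u\<^sup>2 + v\<^sup>2) / \<rho>\<^sup>2"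
      by (simp add: power_divide add_divide_distrib)
    moreover have "\<rho>\<^sup>2 / \<rho>\<^sup>2 = 1"
      using False by simp
    ultimately have "(u / \<rho>)\<^sup>2 + (v / \<rho>)\<^sup>2 = 1"
      by presburger
    then obtain t where "u / \<rho> = cos t" "v / \<rho> = sin t"
      using sincos_total_2pi by metis
    then show thesis
      using that[of t] False by (simp add: field_simps)
  qed
  have "\<rho> \<ge> 0" by (simp add: \<rho>_def)
  have c: "0 < pi / real k" "pi / real k \<le> pi"
    using k by (auto simp: field_simps)
  have ex: "\<exists>n::int. 0 < \<beta> - \<tau> m - 2 * pi * of_int n \<and> \<beta> - \<tau> m - 2 * pi * of_int n < pi / real k"
    if m: "m = i \<or> m = j" for m
  proof -
    have "cos (\<tau> m) * v - sin (\<tau> m) * u = \<rho> * sin (\<beta> - \<tau> m)"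
      unfolding \<beta> by (simp add: sin_diff algebra_simps)
    moreover have "cos (\<tau> m) * u + sin (\<tau> m) * v = \<rho> * cos (\<beta> - \<tau> m)"
      unfolding \<beta> by (simp add: cos_diff algebra_simps)
    moreover have "\<rho> * sin (\<beta> - \<tau> m) * cos (pi / real k) - \<rho> * cos (\<beta> - \<tau> m) * sin (pi / real k) =
        \<rho> * sin (\<beta> - \<tau> m - pi / real k)"
      by (subst sin_diff[of "\<beta> - \<tau> m" "pi / real k"]) (simp add: right_diff_distrib)
    ultimately have *: "0 < \<rho> * sin (\<beta> - \<tau> m)" "\<rho> * sin (\<beta> - \<tau> m - pi / real k) < 0"
      using sector[OF m] by simp_all
    then have "\<rho> > 0"
      using \<open>\<rho> \<ge> 0\<close> by (cases "\<rho> = 0") auto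
    with * have "sin (\<beta> - \<tau> m) > 0" "sin (\<beta> - \<tau> m - pi / real k) < 0"
      by (simp_all add: zero_less_mult_iff mult_less_0_iff)
    then show ?thesis
      using c by (intro sin_sector) auto
  qed
  obtain n where n: "0 < \<beta> - \<tau> i - 2 * pi * of_int n" "\<beta> - \<tau> i - 2 * pi * of_int n < pi / real k"
    using ex[of i] by blast
  obtain n' where n': "0 < \<beta> - \<tau> j - 2 * pi * of_int n'" "\<beta> - \<tau> j - 2 * pi * of_int n' < pi / real k"
    using ex[of j] by blast
  \<comment> \<open>The two representatives differ by \<open>q\<close> times \<open>pi / k\<close>,
    but by less than \<open>pi / k\<close>; so \<open>q\<close> is 0, and \<open>i\<close> and
    \<open>j\<close> are congruent modulo \<open>2 k\<close>.\<close>
  define q :: int where "q = int j - int i - 2 * int k * (n - n')"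
  have "(\<beta> - \<tau> i - 2 * pi * of_int n) - (\<beta> - \<tau> j - 2 * pi * of_int n') = of_int q * (pi / real k)"
    using k by (simp add: \<tau>_def q_def field_simps)
  then have "\<bar>of_int q * (pi / real k)\<bar> < 1 * (pi / real k)"
    using n n' by linarith
  then have "\<bar>of_int q :: real\<bar> < 1"
  proof -
    have "\<bar>z\<bar> < 1" if "\<bar>z * w\<bar> < 1 * w" "0 < w" for z w :: real
      using that by (simp add: abs_mult)
    then show ?thesis
      using \<open>\<bar>of_int q * (pi / real k)\<bar> < 1 * (pi / real k)\<close> c(1) by blast
  qed
  then have "q = 0" by linarith
  then have "int j - int i = 2 * int k * (n - n')"
    by (simp add: q_def)
  moreover have "\<bar>int j - int i\<bar> < 2 * int k"
    using ij by linarith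
  ultimately have "\<bar>2 * int k * (n - n')\<bar> < 2 * int k * 1"
    by simp
  then have "\<bar>n - n'\<bar> < 1"
    using k unfolding abs_mult by (simp add: mult_less_cancel_left_pos)
  then show "i = j"
    using \<open>int j - int i = 2 * int k * (n - n')\<close> by simp
qed

lemma sph_exists_nonzero: "x \<in> sph n \<Longrightarrow> \<exists>i\<le>n. x i \<noteq> 0"
  using sum_squares_pos_iff[of x n] by (simp add: sph_def)

text \<open>
  Rotating by \<open>\<pi> / k\<close> shifts the \<open>2 k\<close> coefficients cyclically. The shift has degree \<open>-1\<close>, whereas an odd map
  homotopic to its own composition with the shift would have to have even degree.
\<close>

lemma variational_eigenvalue_le_symmetric:
  fixes e :: "nat \<Rightarrow> 'n::finite" and \<Omega> :: "(real ^ 'n) set" and k :: nat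
  assumes N: "CARD('n) \<ge> 2" and e: "bij_betw e {1..CARD('n)} UNIV" and l: "l \<in> {1..CARD('n) - 1}"
    and \<Omega>: "domain_of_revolutions e l \<Omega>" and p: "p > 1" and k: "k \<ge> 1"
  shows "variational_eigenvalue p \<Omega> (2 * k + 1) \<le> symmetric_eigenvalue e p \<Omega> k"
  unfolding symmetric_eigenvalue_def
proof (rule le_first_eigenvalue[OF open_wedge[OF N \<Omega> k] p])
  fix \<phi> C
  assume \<phi>: "\<phi> \<in> test_functions (wedge e \<Omega> k)" and C: "dirichlet p \<phi> < C * mass p \<phi>" and \<phi>_pos: "mass p \<phi> > 0"
  define a b where "a = e (CARD('n) - 1)" and "b = e CARD('n)"
  have inj: "inj_on e {1..CARD('n)}"
    using e by (rule bij_betw_imp_inj_on)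
  have ab: "a \<noteq> b"
    using inj N unfolding a_def b_def by (subst inj_on_eq_iff[OF inj]) auto
  obtain K0 where K0: "smooth \<phi>" "compact K0" "K0 \<subseteq> wedge e \<Omega> k"
    "\<And>x. x \<notin> K0 \<Longrightarrow> \<phi> x = 0" "\<And>x. x \<notin> K0 \<Longrightarrow> nabla \<phi> x = 0"
    using test_functionsE[OF \<phi>] by metis
  have \<Omega>_open: "open \<Omega>"
    using \<Omega> by (simp add: domain_of_revolutions_def bounded_domain_def)
  define m where "m = 2 * k - 1"
  have km: "2 * k = Suc m" using k by (simp add: m_def)
  define \<tau> where "\<tau> \<theta> i = \<theta> + real i * pi / real k" for \<theta> i
  define f where "f \<theta> i x = \<phi> (plane_rotation a b (- \<tau> \<theta> i) x)" for \<theta> i x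
  define F where "F s x = (\<Sum>i<2 * k. fst s i * f (snd s) i x)" for s :: "(nat \<Rightarrow> real) \<times> real" and x
  define S where "S = sph m \<times> {0..pi / real k}"
  \<comment> \<open>All angles \<open>\<tau> \<theta> i\<close> lie between 0 and
    \<open>2 * pi\<close>, so one compact set contains the supports of the whole family.\<close>
  define K where "K = (\<lambda>z. plane_rotation a b (fst z) (snd z)) ` ({0..2 * pi} \<times> K0)"
  have K: "compact K"
    unfolding K_def using K0(2)
    by (intro compact_continuous_image compact_Times continuous_on_plane_rotation continuous_on_fst continuous_on_snd continuous_on_id) auto
  have K\<Omega>: "K \<subseteq> \<Omega>"
  proof
    fix y assume "y \<in> K"
    then obtain t x where tx: "x \<in> K0" "y = plane_rotation a b t x"
      by (auto simp: K_def)
    have "x \<in> \<Omega>"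
      using tx(1) K0(3) by (auto simp: wedge_def)
    then show "y \<in> \<Omega>"
    proof (rule domain_of_revolutions_invariant[OF N e l \<Omega>])
      show "norm y = norm x"
        using orthogonal_transformation_norm[OF orthogonal_plane_rotation[OF ab]] by (simp add: tx(2))
      show "y $ e j = x $ e j" if "1 \<le> j" "j < l" for j
      proof -
        have "e j \<noteq> a" "e j \<noteq> b"
          using that l N unfolding a_def b_def by (subst inj_on_eq_iff[OF inj]; force)+
        then show ?thesis
          unfolding tx(2) by (rule plane_rotation_nth)
      qed
    qed
  qed
  have \<tau>_range: "\<tau> \<theta> i \<in> {0..2 * pi}" if "\<theta> \<in> {0..pi / real k}" "i < 2 * k" for \<theta> i
  proof -
    have "\<tau> \<theta> i \<le> pi / real k + real (2 * k - 1) * pi / real k"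
      unfolding \<tau>_def using that by (intro add_mono divide_right_mono mult_right_mono) auto
    also have "\<dots> = 2 * pi"
      using k by (simp add: field_simps of_nat_diff)
    finally show ?thesis
      using that by (auto simp: \<tau>_def)
  qed
  have f_smooth: "smooth (f \<theta> i)" for \<theta> i
    unfolding f_def[abs_def] by (rule smooth_compose_linear[OF linear_plane_rotation K0(1)])
  have f_nabla: "nabla (f \<theta> i) x = plane_rotation a b (\<tau> \<theta> i) (nabla \<phi> (plane_rotation a b (- \<tau> \<theta> i) x))" for \<theta> i x
    unfolding f_def[abs_def]
    using nabla_compose_linear[OF linear_plane_rotation inner_plane_rotation[OF ab] K0(1), of "- \<tau> \<theta> i" x] by simp
  have f_zero: "f \<theta> i x = 0" if "\<theta> \<in> {0..pi / real k}" "i < 2 * k" "x \<notin> K" for \<theta> i x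
  proof -
    have "plane_rotation a b (- \<tau> \<theta> i) x \<notin> K0"
    proof
      assume y: "plane_rotation a b (- \<tau> \<theta> i) x \<in> K0"
      have "x = plane_rotation a b (\<tau> \<theta> i) (plane_rotation a b (- \<tau> \<theta> i) x)"
        by (simp add: plane_rotation_add[OF ab] plane_rotation_id)
      then have "x \<in> K"
        unfolding K_def using y \<tau>_range[OF that(1,2)]
        by (intro image_eqI[of _ _ "(\<tau> \<theta> i, plane_rotation a b (- \<tau> \<theta> i) x)"]) auto
      with that(3) show False ..
    qed
    then show ?thesis
      by (simp add: f_def K0(4))
  qed
  have f_test: "f \<theta> i \<in> test_functions \<Omega>" if "\<theta> \<in> {0..pi / real k}" "i < 2 * k" for \<theta> i
    using f_smooth K K\<Omega> f_zero[OF that] by (rule test_functionsI)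
  have sector: "0 < cos (\<tau> \<theta> i) * x $ b - sin (\<tau> \<theta> i) * x $ a \<and>
      (cos (\<tau> \<theta> i) * x $ b - sin (\<tau> \<theta> i) * x $ a) * cos (pi / real k) -
      (cos (\<tau> \<theta> i) * x $ a + sin (\<tau> \<theta> i) * x $ b) * sin (pi / real k) < 0"
    if "f \<theta> i x \<noteq> 0 \<or> nabla (f \<theta> i) x \<noteq> 0" for \<theta> i x
  proof -
    let ?y = "plane_rotation a b (- \<tau> \<theta> i) x"
    have "?y \<in> K0"
    proof (rule ccontr)
      assume "?y \<notin> K0"
      then have "f \<theta> i x = 0" "nabla (f \<theta> i) x = 0"
        unfolding f_nabla by (simp_all add: f_def K0 linear_0[OF linear_plane_rotation])
      with that show False by simp
    qed
    then have "?y \<in> wedge e \<Omega> k"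
      using K0(3) by blast
    then have "0 < ?y $ b \<and> ?y $ b * cos (pi / real k) - ?y $ a * sin (pi / real k) < 0"
      unfolding wedge_eq_half_planes[OF N \<Omega> k] a_def b_def by simp
    then show ?thesis
      using ab by (simp add: plane_rotation_nth)
  qed
  have disj: "(f \<theta> i x = 0 \<and> nabla (f \<theta> i) x = 0) \<or> (f \<theta> j x = 0 \<and> nabla (f \<theta> j) x = 0)"
    if "i \<in> {..<2 * k}" "j \<in> {..<2 * k}" "i \<noteq> j" for \<theta> i j x
  proof (rule ccontr)
    assume "\<not> ?thesis"
    then have nz: "f \<theta> i x \<noteq> 0 \<or> nabla (f \<theta> i) x \<noteq> 0" "f \<theta> j x \<noteq> 0 \<or> nabla (f \<theta> j) x \<noteq> 0"
      by auto
    have "i = j"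
      using rotated_sectors_disjoint[OF k, of i j \<theta> "x $ b" "x $ a"] that sector[OF nz(1)] sector[OF nz(2)]
      unfolding \<tau>_def by blast
    with that(3) show False ..
  qed
  have mass_F: "mass p (F s) = (\<Sum>i<2 * k. \<bar>fst s i\<bar> powr p) * mass p \<phi>"
    and dirichlet_F: "dirichlet p (F s) = (\<Sum>i<2 * k. \<bar>fst s i\<bar> powr p) * dirichlet p \<phi>" if s: "s \<in> S" for s
  proof -
    have s2: "snd s \<in> {0..pi / real k}"
      using s by (auto simp: S_def)
    have "mass p (f (snd s) i) = mass p \<phi>" "dirichlet p (f (snd s) i) = dirichlet p \<phi>" for i
      unfolding f_def[abs_def] using p
      by (auto intro!: mass_compose_orthogonal dirichlet_compose_orthogonal orthogonal_plane_rotation ab K0(1))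
    moreover have "mass p (F s) = (\<Sum>i<2 * k. \<bar>fst s i\<bar> powr p * mass p (f (snd s) i))"
      "dirichlet p (F s) = (\<Sum>i<2 * k. \<bar>fst s i\<bar> powr p * dirichlet p (f (snd s) i))"
      unfolding F_def[abs_def] using p
      by (intro mass_dirichlet_disjoint_sum[where U = \<Omega>] f_test[OF s2] disj; simp)+
    ultimately show "mass p (F s) = (\<Sum>i<2 * k. \<bar>fst s i\<bar> powr p) * mass p \<phi>"
      "dirichlet p (F s) = (\<Sum>i<2 * k. \<bar>fst s i\<bar> powr p) * dirichlet p \<phi>"
      by (simp_all add: sum_distrib_right)
  qed
  have sum_pos: "(\<Sum>i<2 * k. \<bar>fst s i\<bar> powr p) > 0" if s: "s \<in> S" for s
  proof -
    obtain i where "i \<le> m" "fst s i \<noteq> 0"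
      using s sph_exists_nonzero[of "fst s" m] by (auto simp: S_def)
    then show ?thesis
      by (intro sum_pos2[of _ i]) (auto simp: km)
  qed
  have coord: "continuous_on (S \<times> UNIV) (\<lambda>z. fst (fst z) i)" for i
    by (intro continuous_on_coord[of _ "\<lambda>z. fst (fst z)"] continuous_on_fst continuous_on_id)
  have angle: "continuous_on (S \<times> UNIV) (\<lambda>z. \<tau> (snd (fst z)) i)" for i
    unfolding \<tau>_def by (intro continuous_on_add continuous_on_const continuous_on_fst continuous_on_snd continuous_on_id)
  have rot: "continuous_on (S \<times> UNIV) (\<lambda>z. plane_rotation a b (- \<tau> (snd (fst z)) i) (snd z))" for i
    by (intro continuous_on_plane_rotation continuous_on_minus angle continuous_on_snd continuous_on_id)
  have family: "smooth_family S K F"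
    unfolding smooth_family_def
  proof (intro conjI ballI allI impI)
    show "smooth (F s)" for s
      unfolding F_def[abs_def] by (intro smooth_sum smooth_cmult f_smooth)
    show "F s x = 0" if "s \<in> S" "x \<notin> K" for s x
      unfolding F_def using that f_zero by (intro sum.neutral) (auto simp: S_def)
    show "continuous_on (S \<times> UNIV) (\<lambda>z. F (fst z) (snd z))"
      unfolding F_def f_def
      by (intro continuous_on_sum continuous_on_mult coord continuous_on_compose2[OF smooth_continuous[OF K0(1)] rot]) auto
    have "nabla (F s) x = (\<Sum>i<2 * k. fst s i *\<^sub>R nabla (f (snd s) i) x)" for s x
      unfolding F_def[abs_def] by (intro nabla_sum_cmult f_smooth)
    then show "continuous_on (S \<times> UNIV) (\<lambda>z. nabla (F (fst z)) (snd z))"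
      unfolding f_nabla
      by (simp only:) (intro continuous_on_sum continuous_on_scaleR coord continuous_on_plane_rotation angle
          continuous_on_compose2[OF smooth_continuous_nabla[OF K0(1)] rot], auto)
  qed
  show "variational_eigenvalue p \<Omega> (2 * k + 1) \<le> ereal C"
  proof (rule variational_eigenvalue_le_family[OF family _ _ K K\<Omega> \<Omega>_open])
    show "compact S"
      unfolding S_def by (intro compact_Times compact_sph) simp
    show "S \<noteq> {}"
      using sph_nonempty[of m] by (auto simp: S_def)
    show "p > 0" using p by simp
    show "mass p (F s) > 0" if "s \<in> S" for s
      unfolding mass_F[OF that] using sum_pos[OF that] \<phi>_pos by simp
    show "dirichlet p (F s) \<le> C * mass p (F s)" if "s \<in> S" for s
    proof -
      have "(\<Sum>i<2 * k. \<bar>fst s i\<bar> powr p) * dirichlet p \<phi> \<le> (\<Sum>i<2 * k. \<bar>fst s i\<bar> powr p) * (C * mass p \<phi>)"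
        using sum_pos[OF that] C by (intro mult_left_mono) auto
      then show ?thesis
        unfolding mass_F[OF that] dirichlet_F[OF that] by (simp add: mult_ac)
    qed
  next
    fix g
    assume g: "continuous_on S (\<lambda>s. g (F s))" "\<And>s. s \<in> S \<Longrightarrow> g (F s) \<in> sph (2 * k + 1 - 2)"
      "\<And>s. s \<in> S \<Longrightarrow> g (\<lambda>x. - F s x) = (\<lambda>i. - g (F s) i)"
    \<comment> \<open>The target sphere has the dimension of the sphere of coefficients, which makes
      degrees available.\<close>
    have m2: "2 * k + 1 - 2 = m" by (simp add: m_def)
    have S0: "(\<alpha>, t * (pi / real k)) \<in> S" if "\<alpha> \<in> sph m" "t \<in> {0..1}" for \<alpha> t
      using that k by (auto simp: S_def intro: mult_left_le_one_le divide_right_mono)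
    define h where "h = (\<lambda>(t, \<alpha>). g (F (\<alpha>, t * (pi / real k))))"
    define G where "G \<alpha> = g (F (\<alpha>, 0))" for \<alpha>
    have h_in: "h (t, \<alpha>) \<in> sph m" if "t \<in> {0..1}" "\<alpha> \<in> sph m" for t \<alpha>
      using g(2)[OF S0[OF that(2,1)]] unfolding m2 by (simp add: h_def)
    have h_cont: "continuous_on ({0..1} \<times> sph m) h"
    proof -
      have "continuous_on ({0..1} \<times> sph m) (\<lambda>z. (snd z, fst z * (pi / real k)))"
        by (intro continuous_on_Pair continuous_on_mult continuous_on_const continuous_on_fst continuous_on_snd continuous_on_id)
      then have "continuous_on ({0..1} \<times> sph m) (\<lambda>z. g (F (snd z, fst z * (pi / real k))))"
        by (rule continuous_on_compose2[OF g(1)]) (use S0 in auto)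
      then show ?thesis by (simp add: h_def case_prod_unfold)
    qed
    have h0: "h (0, \<alpha>) = G \<alpha>" for \<alpha>
      by (simp add: h_def G_def)
    have Gin: "G \<alpha> \<in> sph m" if "\<alpha> \<in> sph m" for \<alpha>
      using h_in[of 0 \<alpha>] that by (simp add: h0)
    have Gc: "continuous_on (sph m) G"
    proof -
      have "continuous_on (sph m) (\<lambda>\<alpha>. h (0, \<alpha>))"
        by (rule continuous_on_compose2[OF h_cont]) (auto intro!: continuous_on_Pair continuous_on_const continuous_on_id)
      then show ?thesis by (simp add: h0)
    qed
    have Godd: "G (\<lambda>i. - \<alpha> i) = (\<lambda>i. - G \<alpha> i)" if "\<alpha> \<in> sph m" for \<alpha>
    proof -
      have "F (\<lambda>i. - \<alpha> i, 0) = (\<lambda>x. - F (\<alpha>, 0) x)"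
        by (simp add: F_def[abs_def] sum_negf)
      then show ?thesis
        using g(3)[of "(\<alpha>, 0)"] S0[OF that, of 0] by (simp add: G_def)
    qed
    have h1: "h (1, \<alpha>) = G (cycle_coords m \<alpha>)" for \<alpha>
    proof -
      \<comment> \<open>Rotated by another \<open>pi / k\<close>, the last copy has completed a full
        turn and becomes the first one; every other copy takes the place of its successor.\<close>
      have period: "f (pi / real k) m x = f 0 0 x" for x
      proof -
        have "pi / real k + real m * pi / real k = 2 * pi"
          using k by (simp add: m_def field_simps of_nat_diff)
        then show ?thesis
          by (simp add: f_def \<tau>_def plane_rotation_id)
      qed
      have shift: "f (pi / real k) i x = f 0 (Suc i) x" for i x
        by (simp add: f_def \<tau>_def add_divide_distrib distrib_right)
      have "F (\<alpha>, pi / real k) x = F (cycle_coords m \<alpha>, 0) x" for x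
      proof -
        have "F (\<alpha>, pi / real k) x = (\<Sum>i<m. \<alpha> i * f (pi / real k) i x) + \<alpha> m * f (pi / real k) m x"
          by (simp add: F_def km)
        also have "\<dots> = \<alpha> m * f 0 0 x + (\<Sum>i<m. \<alpha> i * f 0 (Suc i) x)"
          unfolding period unfolding shift by simp
        also have "\<dots> = F (cycle_coords m \<alpha>, 0) x"
          unfolding F_def km fst_conv snd_conv sum.lessThan_Suc_shift
          by (simp add: cycle_coords_def Suc_le_eq)
        finally show ?thesis .
      qed
      then have "F (\<alpha>, pi / real k) = F (cycle_coords m \<alpha>, 0)"
        by (rule ext)
      then show ?thesis
        by (simp add: h_def G_def)
    qed
    have "odd (Brouwer_degree2 m G)"
      using Gc Gin Godd by (intro odd_Brouwer_degree2_of_odd_map) auto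
    have "Brouwer_degree2 m G = Brouwer_degree2 m (G \<circ> cycle_coords m)"
      using Brouwer_degree2_homotopy_on[OF h_cont h_in] by (simp add: h0 h1 o_def)
    also have "\<dots> = Brouwer_degree2 m G * Brouwer_degree2 m (cycle_coords m)"
      using Gc Gin
      by (intro Brouwer_degree2_compose) (auto simp: nsphere_eq_top_of_set continuous_on_cycle_coords cycle_coords_in_sph)
    \<comment> \<open>\<open>m = 2 * k - 1\<close> is odd. The degree of \<open>G\<close> therefore
      equals its negative and is 0, hence not odd.\<close>
    also have "Brouwer_degree2 m (cycle_coords m) = -1"
      using k by (simp add: Brouwer_degree2_cycle_coords m_def)
    finally show False
      using \<open>odd (Brouwer_degree2 m G)\<close> by simp
  qed
qed

section \<open>Hidden convexity and rotated half-spaces\<close>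

text \<open>
  A smooth substitute for \<open>(\<Sum>w\<in>W. t w * \<bar>f w x\<bar> powr p) powr (1 / p)\<close>, which it approaches as \<open>d \<rightarrow> 0\<close>.
  It vanishes where all \<open>f w\<close> do, provided that the weights \<open>t w\<close> add up to 1.
\<close>

definition power_mean :: "real \<Rightarrow> real \<Rightarrow> 'w set \<Rightarrow> ('w \<Rightarrow> real ^ 'n::finite \<Rightarrow> real) \<Rightarrow> ('w \<Rightarrow> real) \<Rightarrow> real ^ 'n \<Rightarrow> real" where
  "power_mean p d W f t x = (\<Sum>w\<in>W. t w * ((f w x)\<^sup>2 + d\<^sup>2) powr (p / 2)) powr (1 / p) - d"

locale power_means =
  fixes p d :: real and W :: "'w set" and f :: "'w \<Rightarrow> real ^ 'n::finite \<Rightarrow> real" and K :: "(real ^ 'n) set"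
  assumes p: "p > 1" and d: "d > 0" and finite_W: "finite W"
    and smooth: "\<And>w. w \<in> W \<Longrightarrow> smooth (f w)"
    and K: "compact K" and support: "\<And>w x. w \<in> W \<Longrightarrow> x \<notin> K \<Longrightarrow> f w x = 0"
begin

definition weights :: "('w \<Rightarrow> real) \<Rightarrow> bool" where
  "weights t \<longleftrightarrow> (\<forall>w\<in>W. t w \<ge> 0) \<and> (\<Sum>w\<in>W. t w) = 1"

text \<open>The shift by the square of \<open>d\<close> keeps the base of the real powers positive,
  so they are smooth even at zeros of \<open>f w\<close>.\<close>

definition q :: "'w \<Rightarrow> real ^ 'n \<Rightarrow> real" where
  "q w x = (f w x)\<^sup>2 + d\<^sup>2"

text \<open>For admissible weights this is the \<open>p\<close>-th power of
  \<open>mean t x + d\<close>.\<close>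

definition A :: "('w \<Rightarrow> real) \<Rightarrow> real ^ 'n \<Rightarrow> real" where
  "A t x = (\<Sum>w\<in>W. t w * q w x powr (p / 2))"

abbreviation mean :: "('w \<Rightarrow> real) \<Rightarrow> real ^ 'n \<Rightarrow> real" where
  "mean t \<equiv> power_mean p d W f t"

lemma mean_eq: "mean t x = A t x powr (1 / p) - d"
  by (simp add: power_mean_def A_def q_def)

lemma q_pos: "q w x > 0"
  using d by (simp add: q_def add_nonneg_pos)

lemma d_powr: "(d\<^sup>2) powr (p / 2) = d powr p"
  using d by (simp add: powr_powr flip: powr_numeral)

lemma q_powr_ge: "q w x powr (p / 2) \<ge> d powr p"
  unfolding d_powr[symmetric] using p by (intro powr_mono2) (auto simp: q_def)

lemma A_ge:
  assumes "weights t"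
  shows "A t x \<ge> d powr p"
proof -
  have "d powr p = (\<Sum>w\<in>W. t w * d powr p)"
    using assms by (simp add: weights_def flip: sum_distrib_right)
  also have "\<dots> \<le> A t x"
    unfolding A_def using assms q_powr_ge by (intro sum_mono mult_left_mono) (auto simp: weights_def)
  finally show ?thesis .
qed

lemma A_pos: "weights t \<Longrightarrow> A t x > 0"
  using less_le_trans[of 0 "d powr p" "A t x"] A_ge[of t x] d by simp

lemma mean_nonneg:
  assumes "weights t"
  shows "mean t x \<ge> 0"
proof -
  have "d = (d powr p) powr (1 / p)"
    using d p by (simp add: powr_powr)
  also have "\<dots> \<le> A t x powr (1 / p)"
    using p A_ge[OF assms] by (intro powr_mono2) auto
  finally show ?thesis by (simp add: mean_eq)
qed

text \<open>Functions of weight 0 do not count; this is what later confines a mean to a half-space.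
  Where the others vanish, \<open>A\<close> equals \<open>d powr p\<close>, and the subtraction of
  \<open>d\<close> cancels it.\<close>

lemma mean_eq_0:
  assumes t: "weights t" and 0: "\<And>w. w \<in> W \<Longrightarrow> t w > 0 \<Longrightarrow> f w x = 0"
  shows "mean t x = 0"
proof -
  have "A t x = (\<Sum>w\<in>W. t w * d powr p)"
    unfolding A_def
  proof (rule sum.cong)
    fix w assume w: "w \<in> W"
    show "t w * q w x powr (p / 2) = t w * d powr p"
    proof (cases "t w > 0")
      case True
      then show ?thesis using 0[OF w] by (simp add: q_def d_powr)
    next
      case False
      then have "t w = 0" using t w by (auto simp: weights_def intro: antisym)
      then show ?thesis by simp
    qed
  qed simp
  also have "\<dots> = d powr p"
    using t by (simp add: weights_def flip: sum_distrib_right)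
  finally show ?thesis
    using d p by (simp add: mean_eq powr_powr)
qed

lemma Ck_q: "w \<in> W \<Longrightarrow> Ck m (q w)"
  unfolding q_def[abs_def] power2_eq_square
  using smooth[of w] by (intro Ck_add Ck_mult Ck_const) (auto simp: smooth_def)

lemma smooth_mean:
  assumes "weights t"
  shows "smooth (mean t)"
proof -
  have "Ck m (A t)" for m
    unfolding A_def[abs_def] by (intro Ck_sum Ck_cmult Ck_powr q_pos Ck_q)
  then have "Ck m (\<lambda>x. A t x powr (1 / p) - d)" for m
    by (intro Ck_diff Ck_const Ck_powr A_pos assms)
  then show ?thesis
    unfolding smooth_def by (simp flip: mean_eq)
qed

lemma nabla_mean:
  assumes t: "weights t"
  shows "nabla (mean t) x = A t x powr (1 / p - 1) *\<^sub>R
    (\<Sum>w\<in>W. (t w * (q w x powr (p / 2 - 1) * f w x)) *\<^sub>R nabla (f w) x)"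
proof (rule nabla_eqI)
  let ?G = "\<Sum>w\<in>W. (t w * (q w x powr (p / 2 - 1) * f w x)) *\<^sub>R nabla (f w) x"
  have dq: "(q w has_derivative (\<lambda>h. ((2 * f w x) *\<^sub>R nabla (f w) x) \<bullet> h)) (at x)" if "w \<in> W" for w
  proof -
    have "((\<lambda>x. (f w x)\<^sup>2) has_derivative (\<lambda>h. ((2 * f w x) *\<^sub>R nabla (f w) x) \<bullet> h)) (at x)"
      using has_derivative_real_compose[OF DERIV_pow[of 2] smooth_has_derivative[OF smooth[OF that]]] by simp
    from has_derivative_add[OF this has_derivative_const[of "d\<^sup>2"]] show ?thesis
      by (simp add: q_def[abs_def])
  qed
  have "((\<lambda>x. q w x powr (p / 2)) has_derivative
      (\<lambda>h. (((p / 2) * q w x powr (p / 2 - 1)) *\<^sub>R ((2 * f w x) *\<^sub>R nabla (f w) x)) \<bullet> h)) (at x)" if "w \<in> W" for w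
    by (rule has_derivative_real_compose[OF has_real_derivative_powr[OF q_pos] dq[OF that]])
  then have "((\<lambda>x. \<Sum>w\<in>W. t w * q w x powr (p / 2)) has_derivative
      (\<lambda>h. \<Sum>w\<in>W. t w * ((((p / 2) * q w x powr (p / 2 - 1)) *\<^sub>R ((2 * f w x) *\<^sub>R nabla (f w) x)) \<bullet> h))) (at x)"
    by (intro has_derivative_sum has_derivative_mult_right)
  moreover have "(\<Sum>w\<in>W. t w * ((((p / 2) * q w x powr (p / 2 - 1)) *\<^sub>R ((2 * f w x) *\<^sub>R nabla (f w) x)) \<bullet> h)) = (p *\<^sub>R ?G) \<bullet> h" for h
    by (simp add: inner_sum_left sum_distrib_left mult_ac)
  ultimately have dA: "(A t has_derivative (\<lambda>h. (p *\<^sub>R ?G) \<bullet> h)) (at x)"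
    by (simp add: A_def[abs_def])
  have "((\<lambda>x. A t x powr (1 / p)) has_derivative (\<lambda>h. ((1 / p * A t x powr (1 / p - 1)) *\<^sub>R (p *\<^sub>R ?G)) \<bullet> h)) (at x)"
    by (rule has_derivative_real_compose[OF has_real_derivative_powr[OF A_pos[OF t]] dA])
  from has_derivative_diff[OF this has_derivative_const[of d]]
  show "(mean t has_derivative (\<lambda>h. (A t x powr (1 / p - 1) *\<^sub>R ?G) \<bullet> h)) (at x)"
    using p by (simp add: mean_eq[abs_def])
qed

lemma nabla_mean_eq_0:
  assumes t: "weights t" and 0: "\<And>w. w \<in> W \<Longrightarrow> t w > 0 \<Longrightarrow> f w x = 0"
  shows "nabla (mean t) x = 0"
proof -
  have "(t w * (q w x powr (p / 2 - 1) * f w x)) *\<^sub>R nabla (f w) x = 0" if w: "w \<in> W" for w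
  proof (cases "t w > 0")
    case False
    then have "t w = 0" using t w by (auto simp: weights_def intro: antisym)
    then show ?thesis by simp
  qed (use 0[OF w] in simp)
  then have "(\<Sum>w\<in>W. (t w * (q w x powr (p / 2 - 1) * f w x)) *\<^sub>R nabla (f w) x) = 0"
    by (rule sum.neutral[OF ballI])
  then show ?thesis
    unfolding nabla_mean[OF t] by simp
qed

text \<open>Jensen's inequality for the convex combination with weights \<open>t w * q w x powr (p / 2) / A t x\<close>.\<close>

lemma norm_nabla_mean_powr_le:
  assumes t: "weights t"
  shows "norm (nabla (mean t) x) powr p \<le> (\<Sum>w\<in>W. t w * norm (nabla (f w) x) powr p)"
proof -
  have A: "A t x > 0" by (rule A_pos[OF t])
  define s where "s w = t w * q w x powr (p / 2) / A t x" for w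
  \<comment> \<open>Arranged such that \<open>A t x * (s w * y w)\<close> bounds the norm of a
    summand, since \<open>\<bar>f w x\<bar>\<close> is at most the root of \<open>q w x\<close>,
    while \<open>A t x * (s w * y w powr p)\<close> is exactly the wanted term.\<close>
  define y where "y w = norm (nabla (f w) x) / q w x powr (1 / 2)" for w
  have s: "s w \<ge> 0" if "w \<in> W" for w
    using t that A by (auto simp: s_def weights_def)
  have s1: "(\<Sum>w\<in>W. s w) = 1"
    using A by (simp add: s_def A_def flip: sum_divide_distrib)
  have W: "W \<noteq> {}"
    using s1 by auto
  have y: "y w \<ge> 0" for w by (simp add: y_def)
  have f_le: "\<bar>f w x\<bar> \<le> q w x powr (1 / 2)" for w
    unfolding powr_half_sqrt[OF less_imp_le[OF q_pos]] by (intro real_le_rsqrt) (simp add: q_def)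
  have "norm (nabla (mean t) x) \<le> A t x powr (1 / p - 1) * (\<Sum>w\<in>W. norm ((t w * (q w x powr (p / 2 - 1) * f w x)) *\<^sub>R nabla (f w) x))"
    unfolding nabla_mean[OF t] norm_scaleR[of "A t x powr (1 / p - 1)"]
    by (simp only: abs_of_nonneg[OF powr_ge_zero]) (intro mult_left_mono norm_sum powr_ge_zero)
  also have "\<dots> \<le> A t x powr (1 / p - 1) * (\<Sum>w\<in>W. A t x * (s w * y w))"
  proof (intro mult_left_mono sum_mono)
    fix w assume w: "w \<in> W"
    have "norm ((t w * (q w x powr (p / 2 - 1) * f w x)) *\<^sub>R nabla (f w) x) =
        t w * q w x powr (p / 2 - 1) * (\<bar>f w x\<bar> * norm (nabla (f w) x))"
      using t w by (simp add: abs_mult weights_def)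
    also have "\<dots> \<le> t w * q w x powr (p / 2 - 1) * (q w x powr (1 / 2) * norm (nabla (f w) x))"
      using t w f_le by (intro mult_left_mono mult_right_mono) (auto simp: weights_def)
    also have "\<dots> = t w * q w x powr (p / 2) * (norm (nabla (f w) x) / q w x powr (1 / 2))"
    proof -
      have "q w x powr (p / 2 - 1) * q w x powr (1 / 2) = q w x powr (p / 2) / q w x powr (1 / 2)"
        using q_pos[of w x] by (simp flip: powr_add powr_diff)
      then show ?thesis
        by (simp add: mult.assoc[symmetric]) (simp add: mult.assoc)
    qed
    also have "\<dots> = A t x * (s w * y w)"
      using A by (simp add: s_def y_def)
    finally show "norm ((t w * (q w x powr (p / 2 - 1) * f w x)) *\<^sub>R nabla (f w) x) \<le> A t x * (s w * y w)" .
  qed simp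
  also have "\<dots> = A t x powr (1 / p) * (\<Sum>w\<in>W. s w * y w)"
    using A by (simp add: powr_diff flip: sum_distrib_left)
  finally have "norm (nabla (mean t) x) powr p \<le> (A t x powr (1 / p) * (\<Sum>w\<in>W. s w * y w)) powr p"
    using p by (intro powr_mono2) auto
  also have "\<dots> = A t x * (\<Sum>w\<in>W. s w *\<^sub>R y w) powr p"
    using A p s y by (simp add: powr_mult powr_powr sum_nonneg)
  also have "\<dots> \<le> A t x * (\<Sum>w\<in>W. s w * y w powr p)"
    using p s s1 y A
    by (intro mult_left_mono convex_on_sum[OF finite_W W powr_convex_nonneg]) auto
  also have "\<dots> = (\<Sum>w\<in>W. t w * norm (nabla (f w) x) powr p)"
    unfolding sum_distrib_left
  proof (rule sum.cong)
    fix w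
    have "y w powr p = norm (nabla (f w) x) powr p / q w x powr (p / 2)"
      using q_pos[of w x] by (simp add: y_def powr_divide powr_powr)
    then show "A t x * (s w * y w powr p) = t w * norm (nabla (f w) x) powr p"
      using A q_pos[of w x] by (simp add: s_def)
  qed simp
  finally show ?thesis .
qed

lemma test_f: "w \<in> W \<Longrightarrow> f w \<in> test_functions K"
  using smooth K subset_refl support by (rule test_functionsI)

lemma test_mean: "weights t \<Longrightarrow> mean t \<in> test_functions K"
  by (rule test_functionsI[OF smooth_mean K subset_refl]) (auto intro: mean_eq_0 support)

lemma dirichlet_mean_le:
  assumes t: "weights t"
  shows "dirichlet p (mean t) \<le> (\<Sum>w\<in>W. t w * dirichlet p (f w))"
proof -
  have p0: "p > 0" using p by simp
  have int: "integrable lebesgue (\<lambda>x. norm (nabla (f w) x) powr p)" if "w \<in> W" for w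
    using test_function_integrable_powr[OF test_f[OF that] p0] by simp
  have "dirichlet p (mean t) \<le> (LINT x|lebesgue. (\<Sum>w\<in>W. t w * norm (nabla (f w) x) powr p))"
    unfolding dirichlet_def
    by (intro integral_mono norm_nabla_mean_powr_le[OF t] test_function_integrable_powr[OF test_mean[OF t] p0]
        Bochner_Integration.integrable_sum integrable_mult_right int)
  also have "\<dots> = (\<Sum>w\<in>W. t w * dirichlet p (f w))"
    unfolding dirichlet_def by (subst Bochner_Integration.integral_sum) (auto intro: int)
  finally show ?thesis .
qed

text \<open>The weighted powers of the \<open>f w\<close> sum to at most \<open>A t x\<close>, the
  \<open>p\<close>-th power of \<open>mean t x + d\<close>, and \<open>powr_add_le\<close> separates
  \<open>d\<close>. Everything vanishes outside \<open>K\<close>, so the error is controlled by the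
  measure of \<open>K\<close>.\<close>

lemma mass_mean_ge:
  assumes t: "weights t" and s: "0 < s" "s < 1"
  shows "(\<Sum>w\<in>W. t w * mass p (f w)) \<le>
    (1 - s) powr (1 - p) * mass p (mean t) + s powr (1 - p) * d powr p * measure lebesgue K"
proof -
  have p0: "p > 0" using p by simp
  have int: "integrable lebesgue (\<lambda>x. norm (f w x) powr p)" if "w \<in> W" for w
    using test_function_integrable_powr[OF test_f[OF that] p0] by simp
  have int_m: "integrable lebesgue (\<lambda>x. norm (mean t x) powr p)"
    using test_function_integrable_powr[OF test_mean[OF t] p0] by simp
  have int_K: "integrable lebesgue (indicator K :: _ \<Rightarrow> real)"
    using lmeasurable_compact[OF K] by (simp add: lmeasurable_iff_integrable)
  have pointwise: "(\<Sum>w\<in>W. t w * norm (f w x) powr p) \<le>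
      (1 - s) powr (1 - p) * norm (mean t x) powr p + s powr (1 - p) * d powr p * indicator K x" for x
  proof (cases "x \<in> K")
    case True
    have "(\<Sum>w\<in>W. t w * norm (f w x) powr p) \<le> A t x"
      unfolding A_def
    proof (intro sum_mono mult_left_mono)
      fix w assume "w \<in> W"
      have "norm (f w x) powr p = (\<bar>f w x\<bar> powr 2) powr (p / 2)"
        unfolding powr_powr by simp
      also have "\<bar>f w x\<bar> powr 2 = (f w x)\<^sup>2"
        by simp
      also have "((f w x)\<^sup>2) powr (p / 2) \<le> q w x powr (p / 2)"
        using p by (intro powr_mono2) (auto simp: q_def)
      finally show "norm (f w x) powr p \<le> q w x powr (p / 2)" .
    qed (use t in \<open>auto simp: weights_def\<close>)
    also have "A t x = (mean t x + d) powr p"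
      using p A_pos[OF t, of x] by (simp add: mean_eq powr_powr)
    also have "\<dots> \<le> (1 - s) powr (1 - p) * mean t x powr p + s powr (1 - p) * d powr p"
      using p s mean_nonneg[OF t] d by (intro powr_add_le) auto
    finally show ?thesis
      using True mean_nonneg[OF t, of x] by simp
  next
    case False
    then show ?thesis
      using support by simp
  qed
  have "(\<Sum>w\<in>W. t w * mass p (f w)) = (LINT x|lebesgue. (\<Sum>w\<in>W. t w * norm (f w x) powr p))"
    unfolding mass_def by (subst Bochner_Integration.integral_sum) (auto intro: int simp del: real_norm_def)
  also have "\<dots> \<le> (LINT x|lebesgue. (1 - s) powr (1 - p) * norm (mean t x) powr p + s powr (1 - p) * d powr p * indicator K x)"
    by (intro integral_mono pointwise Bochner_Integration.integrable_sum Bochner_Integration.integrable_add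
        integrable_mult_right int int_m int_K)
  also have "\<dots> = (1 - s) powr (1 - p) * mass p (mean t) + s powr (1 - p) * d powr p * measure lebesgue K"
    unfolding mass_def
    by (subst Bochner_Integration.integral_add) (auto simp del: real_norm_def intro!: integrable_mult_right int_m int_K)
  finally show ?thesis .
qed

lemma smooth_family_mean:
  fixes t :: "'s::metric_space \<Rightarrow> 'w \<Rightarrow> real"
  assumes t: "\<And>s. s \<in> S \<Longrightarrow> weights (t s)" and tc: "\<And>w. w \<in> W \<Longrightarrow> continuous_on S (\<lambda>s. t s w)"
  shows "smooth_family S K (\<lambda>s. mean (t s))"
  unfolding smooth_family_def
proof (intro conjI ballI allI impI)
  show "smooth (mean (t s))" if "s \<in> S" for s
    by (rule smooth_mean[OF t[OF that]])
  show "mean (t s) x = 0" if "s \<in> S" "x \<notin> K" for s x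
    using t[OF that(1)] by (rule mean_eq_0) (rule support[OF _ that(2)])
  have tc': "continuous_on (S \<times> UNIV) (\<lambda>z. t (fst z) w)" if "w \<in> W" for w
    by (rule continuous_on_compose2[OF tc[OF that] continuous_on_fst[OF continuous_on_id]]) auto
  have fc: "continuous_on (S \<times> UNIV) (\<lambda>z. f w (snd z))" and nc: "continuous_on (S \<times> UNIV) (\<lambda>z. nabla (f w) (snd z))"
    if "w \<in> W" for w
    using continuous_on_compose2[OF smooth_continuous[OF smooth[OF that]] continuous_on_snd[OF continuous_on_id]]
      continuous_on_compose2[OF smooth_continuous_nabla[OF smooth[OF that]] continuous_on_snd[OF continuous_on_id]]
    by simp_all
  have qc: "continuous_on (S \<times> UNIV) (\<lambda>z. q w (snd z))" if "w \<in> W" for w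
    unfolding q_def by (intro continuous_on_add continuous_on_power continuous_on_const fc that)
  have qp: "continuous_on (S \<times> UNIV) (\<lambda>z. q w (snd z) powr c)" if "w \<in> W" for w c
    using q_pos by (intro continuous_on_powr continuous_on_const qc that) (auto simp: less_imp_neq[THEN not_sym])
  have Ac: "continuous_on (S \<times> UNIV) (\<lambda>z. A (t (fst z)) (snd z))"
    unfolding A_def by (intro continuous_on_sum continuous_on_mult tc' qp)
  have Ap: "continuous_on (S \<times> UNIV) (\<lambda>z. A (t (fst z)) (snd z) powr c)" for c
    using A_pos[OF t] by (intro continuous_on_powr continuous_on_const Ac) (auto simp: less_imp_neq[THEN not_sym])
  show "continuous_on (S \<times> UNIV) (\<lambda>z. mean (t (fst z)) (snd z))"
    unfolding mean_eq by (intro continuous_on_diff continuous_on_const Ap)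
  have "continuous_on (S \<times> UNIV) (\<lambda>z. A (t (fst z)) (snd z) powr (1 / p - 1) *\<^sub>R
      (\<Sum>w\<in>W. (t (fst z) w * (q w (snd z) powr (p / 2 - 1) * f w (snd z))) *\<^sub>R nabla (f w) (snd z)))"
    by (intro continuous_on_scaleR continuous_on_sum continuous_on_mult Ap tc' qp fc nc)
  then show "continuous_on (S \<times> UNIV) (\<lambda>z. nabla (mean (t (fst z))) (snd z))"
    by (rule continuous_on_eq) (use t nabla_mean in auto)
qed

end

section \<open>Reflections between half-spaces\<close>

text \<open>The reflection along \<open>d\<close>. Division by 0 makes it the identity for
  \<open>d = 0\<close>, so the case of two equal directions needs no separate map.\<close>

definition householder :: "'a::real_inner \<Rightarrow> 'a \<Rightarrow> 'a" where
  "householder d x = x - (2 * (x \<bullet> d) / (d \<bullet> d)) *\<^sub>R d"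

lemma linear_householder: "linear (householder d)"
proof (rule linearI)
  show "householder d (x + y) = householder d x + householder d y" for x y
    unfolding householder_def inner_add_left distrib_left add_divide_distrib scaleR_add_left by simp
  show "householder d (r *\<^sub>R x) = r *\<^sub>R householder d x" for r x
  proof -
    have "2 * (r * (x \<bullet> d)) / (d \<bullet> d) = r * (2 * (x \<bullet> d) / (d \<bullet> d))"
      by simp
    then show ?thesis
      unfolding householder_def inner_scaleR_left scaleR_diff_right scaleR_scaleR by (rule arg_cong)
  qed
qed

lemma orthogonal_householder: "orthogonal_transformation (householder d)"
proof -
  have "householder d x \<bullet> householder d y = x \<bullet> y" for x y
  proof (cases "d = 0")
    case False
    then have n: "d \<bullet> d \<noteq> 0" by simp
    have expand: "(x - \<alpha> *\<^sub>R d) \<bullet> (y - \<beta> *\<^sub>R d) = x \<bullet> y - \<beta> * (x \<bullet> d) - \<alpha> * (y \<bullet> d) + \<alpha> * (\<beta> * (d \<bullet> d))" for \<alpha> \<beta>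
      by (simp add: inner_diff_left inner_diff_right inner_commute[of d y] right_diff_distrib)
    have "2 * (y \<bullet> d) / (d \<bullet> d) * (d \<bullet> d) = 2 * (y \<bullet> d)"
      using n by simp
    then show ?thesis
      unfolding householder_def expand by simp
  qed (simp add: householder_def)
  then show ?thesis
    by (simp add: orthogonal_transformation_def linear_householder)
qed

lemma householder_involution: "householder d (householder d x) = x"
proof (cases "d = 0")
  case False
  then have "d \<bullet> d \<noteq> 0" by simp
  then have "householder d x \<bullet> d = - (x \<bullet> d)"
    by (simp add: householder_def inner_diff_left)
  then show ?thesis
    by (simp add: householder_def[of d "householder d x"]) (simp add: householder_def)
qed (simp add: householder_def)

text \<open>The reflection along \<open>u - w\<close> exchanges the unit vectors \<open>u\<close>
  and \<open>w\<close>. Composition with it moves a function from the half-space of \<open>u\<close>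
  to that of \<open>w\<close>.\<close>

lemma inner_householder:
  assumes "norm u = 1" "norm w = 1"
  shows "householder (u - w) x \<bullet> u = x \<bullet> w"
proof (cases "u = w")
  case False
  have uu: "u \<bullet> u = 1" "w \<bullet> w = 1"
    using assms by (simp_all add: norm_eq_1)
  then have dd: "(u - w) \<bullet> (u - w) = 2 * (1 - u \<bullet> w)" and du: "(u - w) \<bullet> u = 1 - u \<bullet> w"
    by (simp_all add: inner_diff_left inner_diff_right inner_commute[of w u])
  have "(u - w) \<bullet> (u - w) \<noteq> 0"
    using False by simp
  then have nz: "1 - u \<bullet> w \<noteq> 0"
    using dd by simp
  have "householder (u - w) x \<bullet> u = x \<bullet> u - 2 * (x \<bullet> (u - w)) / (2 * (1 - u \<bullet> w)) * (1 - u \<bullet> w)"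
    by (simp only: householder_def inner_diff_left[of x] inner_scaleR_left dd du)
  also have "2 * (x \<bullet> (u - w)) / (2 * (1 - u \<bullet> w)) * (1 - u \<bullet> w) = x \<bullet> (u - w)"
  proof -
    have "2 * r / (2 * t) * t = r" if "t \<noteq> 0" for r t :: real
      using that by simp
    then show ?thesis
      using nz by blast
  qed
  finally show ?thesis
    by (simp add: inner_diff_right)
qed (simp add: householder_def)

text \<open>Coefficient \<open>i\<close> belongs to the rotating coordinate \<open>l + i\<close>.
  For \<open>D = CARD('n) - l\<close> this realises \<open>sph D\<close> as the unit sphere in the
  span of the rotating coordinates.\<close>

definition embed_tail :: "(nat \<Rightarrow> 'n::finite) \<Rightarrow> nat \<Rightarrow> nat \<Rightarrow> (nat \<Rightarrow> real) \<Rightarrow> real ^ 'n" where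
  "embed_tail e l D v = (\<Sum>i\<le>D. v i *\<^sub>R axis (e (l + i)) 1)"

lemma embed_tail_uminus: "embed_tail e l D (\<lambda>i. - v i) = - embed_tail e l D v"
  by (simp add: embed_tail_def sum_negf)

lemma continuous_on_embed_tail: "continuous_on S (embed_tail e l D)"
  unfolding embed_tail_def[abs_def]
  by (intro continuous_on_sum continuous_on_scaleR continuous_on_apply continuous_on_const)

lemma norm_embed_tail:
  assumes inj: "inj_on e {l..l + D}" and v: "v \<in> sph D"
  shows "norm (embed_tail e l D v) = 1"
proof -
  have inner: "axis (e (l + i)) (1::real) \<bullet> axis (e (l + j)) 1 = (if i = j then 1 else 0)" if "i \<le> D" "j \<le> D" for i j
    using inj_on_eq_iff[OF inj, of "l + i" "l + j"] that by (simp add: inner_axis_axis)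
  have "embed_tail e l D v \<bullet> embed_tail e l D v =
      (\<Sum>i\<le>D. \<Sum>j\<le>D. v i * v j * (axis (e (l + i)) (1::real) \<bullet> axis (e (l + j)) 1))"
    unfolding embed_tail_def inner_sum_left
    unfolding inner_sum_right inner_scaleR_left inner_scaleR_right by (simp only: mult_ac)
  also have "\<dots> = (\<Sum>i\<le>D. \<Sum>j\<le>D. v i * v j * (if i = j then 1 else 0))"
    by (intro sum.cong refl arg_cong2[of _ _ _ _ "(*)"] inner) auto
  also have "\<dots> = (\<Sum>i\<le>D. (v i)\<^sup>2)"
    by (simp add: power2_eq_square if_distrib cong: if_cong)
  also have "\<dots> = 1"
    using v by (simp add: sph_def)
  finally show ?thesis
    by (simp add: norm_eq_1)
qed

lemma embed_tail_nth_eq_0: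
  assumes inj: "inj_on e {1..l + D}" and "1 \<le> j" "j < l"
  shows "embed_tail e l D v $ e j = 0"
proof -
  have "e (l + i) \<noteq> e j" if "i \<le> D" for i
    using inj_on_eq_iff[OF inj, of "l + i" j] that assms by simp
  then have "(v i *\<^sub>R axis (e (l + i)) (1::real)) $ e j = 0" if "i \<in> {..D}" for i
    using that by (simp add: axis_def) metis
  then show ?thesis
    unfolding embed_tail_def sum_component by (intro sum.neutral ballI)
qed

text \<open>\<open>s\<close> is fixed first, such that the factor
  \<open>(1 - s) powr (p - 1)\<close> uses up only part of the gap between \<open>D\<close> and
  \<open>C * m\<close>; then \<open>d\<close> is made small enough for the error term to fit into
  the rest.\<close>

lemma choose_regularization:
  fixes C D m p V :: real
  assumes p: "p > 1" and C: "0 \<le> D" "D < C * m" and m: "m > 0" and V: "V \<ge> 0"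
  obtains s d where "0 < s" "s < 1" "d > 0"
    "\<And>M. m \<le> (1 - s) powr (1 - p) * M + s powr (1 - p) * d powr p * V \<Longrightarrow> M > 0 \<and> D \<le> C * M"
proof -
  have C0: "C > 0"
    using C m by (metis le_less_trans zero_less_mult_pos2)
  have "((\<lambda>s. C * (1 - s) powr (p - 1) * m) \<longlongrightarrow> C * (1 - 0) powr (p - 1) * m) (at_right 0)"
    by (intro tendsto_intros) auto
  moreover have "C * (1 - 0) powr (p - 1) * m > D"
    using C by simp
  ultimately have "\<forall>\<^sub>F s in at_right 0. C * (1 - s) powr (p - 1) * m > D"
    by (rule order_tendstoD(1))
  moreover have "\<forall>\<^sub>F s in at_right (0::real). s < 1 \<and> s > 0"
    by (auto simp: eventually_at_right_field intro: exI[of _ 1])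
  ultimately have "\<forall>\<^sub>F s in at_right 0. C * (1 - s) powr (p - 1) * m > D \<and> s < 1 \<and> s > 0"
    by eventually_elim simp
  then obtain s where s: "C * (1 - s) powr (p - 1) * m > D" "s < 1" "s > 0"
    using eventually_happens[of _ "at_right (0::real)"] by auto
  define g where "g = C * (1 - s) powr (p - 1)"
  have g: "g > 0" using C0 s by (simp add: g_def)
  \<comment> \<open>The affordable loss of mass: the first bound keeps \<open>m - k\<close>
    positive, the second ensures \<open>D <= g * (m - k)\<close>.\<close>
  define k where "k = min (m / 2) ((g * m - D) / g)"
  have k: "k > 0" "k < m" "k \<le> (g * m - D) / g"
    using m g s by (auto simp: k_def g_def)
  have Dg: "D \<le> g * (m - k)"
    using k(3) g by (simp add: field_simps)
  \<comment> \<open>Makes the error term at most \<open>k\<close>; \<open>V + 1\<close> is used as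
    the measure \<open>V\<close> may be 0.\<close>
  define d where "d = (k * s powr (p - 1) / (V + 1)) powr (1 / p)"
  have d: "d > 0" using k s V by (simp add: d_def)
  have "d powr p = k * s powr (p - 1) / (V + 1)"
    using k s V p by (simp add: d_def powr_powr)
  then have "s powr (1 - p) * d powr p * V = (s powr (1 - p) * s powr (p - 1)) * (k * (V / (V + 1)))"
    by simp
  also have "s powr (1 - p) * s powr (p - 1) = 1"
    using s by (simp flip: powr_add)
  also have "1 * (k * (V / (V + 1))) \<le> 1 * (k * 1)"
    using k V by (intro mult_left_mono) auto
  finally have small: "s powr (1 - p) * d powr p * V \<le> k"
    by simp
  show thesis
  proof (rule that[OF s(3,2) d])
    fix M assume "m \<le> (1 - s) powr (1 - p) * M + s powr (1 - p) * d powr p * V"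
    then have "m - k \<le> (1 - s) powr (1 - p) * M"
      using small by simp
    then have "(1 - s) powr (p - 1) * (m - k) \<le> (1 - s) powr (p - 1) * ((1 - s) powr (1 - p) * M)"
      by (intro mult_left_mono) auto
    also have "\<dots> = M"
    proof -
      have "(1 - s) powr (p - 1) * (1 - s) powr (1 - p) = 1"
        using s by (simp flip: powr_add)
      then show ?thesis by (simp flip: mult.assoc)
    qed
    finally have M: "(1 - s) powr (p - 1) * (m - k) \<le> M" .
    moreover have "(1 - s) powr (p - 1) * (m - k) > 0"
      using k s by simp
    ultimately have "M > 0" by linarith
    moreover have "g * (m - k) \<le> C * M"
      using M C0 unfolding g_def mult.assoc by (intro mult_left_mono) auto
    ultimately show "M > 0 \<and> D \<le> C * M"
      using Dg by linarith
  qed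
qed

text \<open>
  For every unit vector \<open>v\<close> in the rotating coordinates the family contains a power mean \<open>\<psi> v\<close> of reflected
  copies of \<open>\<phi>\<close> supported where \<open>x \<bullet> v > 0\<close>. It joins the odd map \<open>v \<mapsto> \<psi> v - \<psi> (- v)\<close> to \<open>\<psi>\<close> and then, by
  averaging, to a constant; an odd self-map of the sphere cannot be null-homotopic.
\<close>

lemma variational_eigenvalue_le_symmetric_half:
  fixes e :: "nat \<Rightarrow> 'n::finite" and \<Omega> :: "(real ^ 'n) set"
  assumes N: "CARD('n) \<ge> 2" and e: "bij_betw e {1..CARD('n)} UNIV" and l: "l \<in> {1..CARD('n) - 1}"
    and \<Omega>: "domain_of_revolutions e l \<Omega>" and p: "p > 1"
  shows "variational_eigenvalue p \<Omega> (CARD('n) - l + 2) \<le> symmetric_eigenvalue e p \<Omega> 1"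
  unfolding symmetric_eigenvalue_def
proof (rule le_first_eigenvalue[OF open_wedge[OF N \<Omega> order_refl] p])
  fix \<phi> C
  assume \<phi>: "\<phi> \<in> test_functions (wedge e \<Omega> 1)" and C: "dirichlet p \<phi> < C * mass p \<phi>" and \<phi>_pos: "mass p \<phi> > 0"
  have p0: "p > 0" using p by simp
  define D where "D = CARD('n) - l"
  have lD: "l + D = CARD('n)" "D \<ge> 1"
    using l by (auto simp: D_def)
  define b where "b = e CARD('n)"
  define E :: "real ^ 'n" where "E = axis b 1"
  have inj: "inj_on e {1..l + D}"
    using e unfolding lD by (rule bij_betw_imp_inj_on)
  have inj': "inj_on e {l..l + D}"
    using inj l by (auto intro: inj_on_subset)
  have E1: "norm E = 1" by (simp add: E_def)
  have E0: "E $ e j = 0" if "1 \<le> j" "j < l" for j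
    using inj_on_eq_iff[OF inj, of j "l + D"] that l lD by (auto simp: E_def b_def axis_def)
  have innerE: "x \<bullet> E = x $ b" for x
    by (simp add: E_def inner_axis)
  obtain K0 where K0: "smooth \<phi>" "compact K0" "K0 \<subseteq> wedge e \<Omega> 1"
    "\<And>x. x \<notin> K0 \<Longrightarrow> \<phi> x = 0" "\<And>x. x \<notin> K0 \<Longrightarrow> nabla \<phi> x = 0"
    using test_functionsE[OF \<phi>] by metis
  have \<Omega>_open: "open \<Omega>"
    using \<Omega> by (simp add: domain_of_revolutions_def bounded_domain_def)
  have K0b: "x \<in> \<Omega>" "x $ b > 0" if "x \<in> K0" for x
    using that K0(3) unfolding wedge_eq_half_planes[OF N \<Omega> order_refl] b_def by auto
  have "K0 \<noteq> {}"
  proof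
    assume "K0 = {}"
    then have "mass p \<phi> = 0"
      using K0(4) by (simp add: mass_def)
    with \<phi>_pos show False by simp
  qed
  moreover have "continuous_on K0 (\<lambda>x. x $ b)"
    by (intro continuous_on_component continuous_on_id)
  ultimately obtain x0 where x0: "x0 \<in> K0" "\<And>x. x \<in> K0 \<Longrightarrow> x0 $ b \<le> x $ b"
    using continuous_attains_inf[OF K0(2)] by blast
  define c where "c = x0 $ b"
  have c: "c > 0" using K0b(2)[OF x0(1)] by (simp add: c_def)
  obtain M where M: "M > 0" "\<And>x. x \<in> K0 \<Longrightarrow> norm x \<le> M"
    using compact_imp_bounded[OF K0(2)] unfolding bounded_pos by auto
  \<comment> \<open>On \<open>K0\<close> the inner product with \<open>E\<close> is at least
    \<open>c\<close> and the norm at most \<open>M\<close>. Changing a direction by less than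
    \<open>c / M\<close> thus keeps the inner product positive.\<close>
  define \<eta> where "\<eta> = c / M"
  have \<eta>: "\<eta> > 0" using c M by (simp add: \<eta>_def)
  define emb where "emb = embed_tail e l D"
  have emb1: "norm (emb v) = 1" if "v \<in> sph D" for v
    unfolding emb_def by (rule norm_embed_tail[OF inj' that])
  have "compact (emb ` sph D)"
    unfolding emb_def by (intro compact_continuous_image continuous_on_embed_tail compact_sph)
  \<comment> \<open>A finite net of directions with mesh \<open>\<eta>\<close>; a copy of
    \<open>\<phi>\<close> is reflected into the half-space of each.\<close>
  then obtain W where W: "W \<subseteq> emb ` sph D" "finite W" "emb ` sph D \<subseteq> (\<Union>w\<in>W. ball w \<eta>)"
    by (rule compactE_image[where C = "emb ` sph D" and f = "\<lambda>w. ball w \<eta>"]) (use \<eta> in auto)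
  have W0: "w $ e j = 0" if "w \<in> W" "1 \<le> j" "j < l" for w j
    using that W(1) embed_tail_nth_eq_0[OF inj] by (auto simp: emb_def)
  have W1: "norm w = 1" if "w \<in> W" for w
    using that W(1) emb1 by auto
  define f where "f w x = \<phi> (householder (E - w) x)" for w x
  define K where "K = (\<Union>w\<in>W. householder (E - w) ` K0)"
  have K: "compact K"
    unfolding K_def using W(2) K0(2)
    by (intro compact_UN compact_continuous_image linear_continuous_on linear_conv_bounded_linear[THEN iffD1] linear_householder)
  have K\<Omega>: "K \<subseteq> \<Omega>"
  proof
    fix y assume "y \<in> K"
    then obtain w x where wx: "w \<in> W" "x \<in> K0" "y = householder (E - w) x"
      by (auto simp: K_def)
    show "y \<in> \<Omega>"
    proof (rule domain_of_revolutions_invariant[OF N e l \<Omega> K0b(1)[OF wx(2)]])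
      show "norm y = norm x"
        unfolding wx(3) by (rule orthogonal_transformation_norm[OF orthogonal_householder])
      show "y $ e j = x $ e j" if "1 \<le> j" "j < l" for j
        unfolding wx(3) householder_def using E0[OF that] W0[OF wx(1) that] by simp
    qed
  qed
  have f_smooth: "smooth (f w)" for w
    unfolding f_def[abs_def] by (rule smooth_compose_linear[OF linear_householder K0(1)])
  have f_support: "f w x = 0" if "w \<in> W" "x \<notin> K" for w x
  proof -
    have "householder (E - w) x \<notin> K0"
    proof
      assume "householder (E - w) x \<in> K0"
      then have "householder (E - w) (householder (E - w) x) \<in> K"
        unfolding K_def using that(1) by blast
      with that(2) show False by (simp add: householder_involution)
    qed
    then show ?thesis by (simp add: f_def K0(4))
  qed
  have f_mass: "mass p (f w) = mass p \<phi>" "dirichlet p (f w) = dirichlet p \<phi>" for w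
    unfolding f_def[abs_def]
    by (rule mass_compose_orthogonal[OF orthogonal_householder K0(1) p0]
        dirichlet_compose_orthogonal[OF orthogonal_householder K0(1) p0])+
  \<comment> \<open>The choice depends only on \<open>\<phi>\<close>, \<open>C\<close> and
    \<open>K\<close>, so one regularisation serves all weights.\<close>
  obtain s d where sd: "0 < s" "s < 1" "d > 0"
    "\<And>M. mass p \<phi> \<le> (1 - s) powr (1 - p) * M + s powr (1 - p) * d powr p * measure lebesgue K \<Longrightarrow>
      M > 0 \<and> dirichlet p \<phi> \<le> C * M"
    using choose_regularization[OF p dirichlet_nonneg C \<phi>_pos measure_nonneg] by blast
  interpret P: power_means p d W f K
  proof
    show "p > 1" "d > 0" "finite W" "compact K"
      by (fact p sd(3) W(2) K)+
    show "smooth (f w)" for w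
      by (rule f_smooth)
    show "f w x = 0" if "w \<in> W" "x \<notin> K" for w x
      using that by (rule f_support)
  qed
  have mean_bounds: "mass p (P.mean t) > 0" "dirichlet p (P.mean t) \<le> C * mass p (P.mean t)" if t: "P.weights t" for t
  proof -
    have t1: "(\<Sum>w\<in>W. t w) = 1"
      using t by (simp add: P.weights_def)
    have "mass p \<phi> \<le> (1 - s) powr (1 - p) * mass p (P.mean t) + s powr (1 - p) * d powr p * measure lebesgue K"
      using P.mass_mean_ge[OF t sd(1,2)] t1 by (simp add: f_mass flip: sum_distrib_right)
    then have *: "mass p (P.mean t) > 0 \<and> dirichlet p \<phi> \<le> C * mass p (P.mean t)"
      by (rule sd(4))
    have "dirichlet p (P.mean t) \<le> dirichlet p \<phi>"
      using P.dirichlet_mean_le[OF t] t1 by (simp add: f_mass flip: sum_distrib_right)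
    with * show "mass p (P.mean t) > 0" "dirichlet p (P.mean t) \<le> C * mass p (P.mean t)"
      by auto
  qed
  \<comment> \<open>\<open>T v\<close> normalises these hat functions to a partition of unity on
    \<open>sph D\<close>, subordinate to the balls of the net; its values are the weights of the
    mean.\<close>
  define h where "h v w = max 0 (\<eta> - norm (emb v - w))" for v w
  define T where "T v w = h v w / (\<Sum>w\<in>W. h v w)" for v w
  have h_nonneg: "h v w \<ge> 0" for v w by (simp add: h_def)
  have h_sum: "(\<Sum>w\<in>W. h v w) > 0" if v: "v \<in> sph D" for v
  proof -
    obtain w where "w \<in> W" "emb v \<in> ball w \<eta>"
      using W(3) v by blast
    then show ?thesis
      using W(2) h_nonneg by (intro sum_pos2[of W w]) (auto simp: h_def dist_norm norm_minus_commute)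
  qed
  have T_weights: "P.weights (T v)" if "v \<in> sph D" for v
    unfolding P.weights_def
  proof
    show "\<forall>w\<in>W. 0 \<le> T v w"
      using h_nonneg h_sum[OF that] by (simp add: T_def)
    show "(\<Sum>w\<in>W. T v w) = 1"
      using h_sum[OF that] by (simp add: T_def flip: sum_divide_distrib)
  qed
  have T_cont: "continuous_on (sph D) (\<lambda>v. T v w)" for w
  proof -
    have "continuous_on (sph D) (\<lambda>v. h v w)" for w
      unfolding h_def emb_def
      by (intro continuous_on_max continuous_on_const continuous_on_diff continuous_on_norm continuous_on_embed_tail)
    then show ?thesis
      unfolding T_def using h_sum by (intro continuous_on_divide continuous_on_sum) force+
  qed
  have positive_side: "x \<bullet> emb v > 0" if v: "v \<in> sph D" and w: "w \<in> W" "T v w > 0" "f w x \<noteq> 0" for v w x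
  proof -
    let ?y = "householder (E - w) x"
    have y: "?y \<in> K0"
      using w(3) K0(4) by (auto simp: f_def)
    have "c \<le> ?y $ b"
      using x0(2)[OF y] by (simp add: c_def)
    also have "\<dots> = x \<bullet> w"
      using inner_householder[OF E1 W1[OF w(1)]] by (simp flip: innerE)
    finally have xw: "c \<le> x \<bullet> w" .
    have "norm x = norm ?y"
      by (rule orthogonal_transformation_norm[OF orthogonal_householder, symmetric])
    then have xM: "norm x \<le> M"
      using M(2)[OF y] by simp
    have "h v w \<noteq> 0"
      using w(2) by (auto simp: T_def)
    then have near: "norm (emb v - w) < \<eta>"
      by (auto simp: h_def max_def split: if_splits)
    have "\<bar>x \<bullet> (emb v - w)\<bar> \<le> norm x * norm (emb v - w)"
      by (rule Cauchy_Schwarz_ineq2)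
    also have "\<dots> \<le> M * norm (emb v - w)"
      using xM by (rule mult_right_mono) simp
    also have "\<dots> < M * \<eta>"
      using near M(1) by simp
    also have "\<dots> = c"
      using M(1) by (simp add: \<eta>_def)
    finally have "\<bar>x \<bullet> (emb v - w)\<bar> < c" .
    then show ?thesis
      using xw by (simp add: inner_diff_right)
  qed
  \<comment> \<open>\<open>P.mean (T v)\<close> is the function called \<open>\<psi> v\<close> in
    the overview. The functions for \<open>v\<close> and \<open>- v\<close> are never both nonzero,
    as the half-spaces are opposite.\<close>
  have half_space: "P.mean (T v) x = 0 \<and> nabla (P.mean (T v)) x = 0" if v: "v \<in> sph D" and x: "x \<bullet> emb v \<le> 0" for v x
  proof -
    have "f w x = 0" if "w \<in> W" "T v w > 0" for w
      using positive_side[OF v that] x by force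
    then show ?thesis
      using P.mean_eq_0[OF T_weights[OF v]] P.nabla_mean_eq_0[OF T_weights[OF v]] by blast
  qed
  obtain v0 where v0: "v0 \<in> sph D"
    using sph_nonempty[of D] by blast
  \<comment> \<open>The second parameter is a time from 0 to 2. Up to time 1,
    \<open>\<gamma>\<close> fades out the negative part while \<open>\<rho>\<close> is 0; after that
    \<open>\<rho>\<close> moves the weights from \<open>T v\<close> to the fixed
    \<open>T v0\<close>.\<close>
  define \<rho> \<gamma> where "\<rho> r = max 0 (r - 1)" and "\<gamma> r = max 0 (1 - r)" for r :: real
  define \<tau> where "\<tau> z w = (1 - \<rho> (snd z)) * T (fst z) w + \<rho> (snd z) * T v0 w" for z w
  define S where "S = sph D \<times> {0..2::real}"
  define F where "F z x = P.mean (\<tau> z) x - \<gamma> (snd z) * P.mean (T (\<lambda>i. - fst z i)) x" for z x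
  have \<tau>_weights: "P.weights (\<tau> z)" if "z \<in> S" for z
  proof -
    have r: "0 \<le> \<rho> (snd z)" "\<rho> (snd z) \<le> 1" and v: "fst z \<in> sph D"
      using that by (auto simp: S_def \<rho>_def)
    show ?thesis
      using r T_weights[OF v] T_weights[OF v0]
      by (auto simp: P.weights_def \<tau>_def sum.distrib simp flip: sum_distrib_left)
  qed
  have fst_c: "continuous_on S (\<lambda>z. T (fst z) w)" for w
    by (rule continuous_on_compose2[OF T_cont continuous_on_fst[OF continuous_on_id]]) (auto simp: S_def)
  have neg_c: "continuous_on S (\<lambda>z. T (\<lambda>i. - fst z i) w)" for w
    by (rule continuous_on_compose2[OF T_cont])
      (auto simp: S_def uminus_in_sph intro!: continuous_on_coordinatewise_then_product continuous_on_minus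
        continuous_on_coord[OF continuous_on_fst[OF continuous_on_id]])
  have \<rho>_c: "continuous_on S (\<lambda>z. \<rho> (snd z))" and \<gamma>_c: "continuous_on S (\<lambda>z. \<gamma> (snd z))"
    unfolding \<rho>_def \<gamma>_def
    by (intro continuous_on_max continuous_on_const continuous_on_diff continuous_on_snd continuous_on_id)+
  have \<tau>_c: "continuous_on S (\<lambda>z. \<tau> z w)" for w
    unfolding \<tau>_def by (intro continuous_on_add continuous_on_mult continuous_on_diff continuous_on_const \<rho>_c fst_c)
  have neg_weights: "P.weights (T (\<lambda>i. - fst z i))" if "z \<in> S" for z
    using that by (intro T_weights uminus_in_sph) (auto simp: S_def)
  have family: "smooth_family S K F"
    unfolding F_def
    by (intro smooth_family_diff smooth_family_cmult P.smooth_family_mean \<tau>_weights \<tau>_c neg_weights neg_c \<gamma>_c)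
  have F_late: "F z = P.mean (\<tau> z)" if "snd z \<ge> 1" for z
    using that by (simp add: F_def[abs_def] \<gamma>_def)
  have \<tau>_early: "\<tau> z = T (fst z)" if "snd z \<le> 1" for z
    using that by (simp add: \<tau>_def[abs_def] \<rho>_def)
  have bounds: "mass p (F z) > 0 \<and> dirichlet p (F z) \<le> C * mass p (F z)" if z: "z \<in> S" for z
  proof (cases "snd z \<ge> 1")
    case True
    then show ?thesis
      unfolding F_late[OF True] using mean_bounds[OF \<tau>_weights[OF z]] by simp
  next
    case False
    have v: "fst z \<in> sph D" "(\<lambda>i. - fst z i) \<in> sph D"
      using z by (auto simp: S_def uminus_in_sph)
    \<comment> \<open>\<open>False\<close> indexes the positive part and \<open>True\<close> the
      negative one, so that the formula for disjoint sums applies.\<close>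
    define a where "a i = (if i then - \<gamma> (snd z) else 1)" for i :: bool
    define G where "G i = P.mean (T (if i then (\<lambda>j. - fst z j) else fst z))" for i :: bool
    have FG: "F z = (\<lambda>x. \<Sum>i\<in>UNIV. a i * G i x)"
      using False by (simp add: F_def[abs_def] \<tau>_early UNIV_bool a_def G_def)
    have G_weights: "P.weights (T (if i then (\<lambda>j. - fst z j) else fst z))" for i
      using v T_weights by simp
    have G_test: "G i \<in> test_functions K" for i
      unfolding G_def by (rule P.test_mean[OF G_weights])
    have disj: "(G i x = 0 \<and> nabla (G i) x = 0) \<or> (G j x = 0 \<and> nabla (G j) x = 0)" if "i \<noteq> j" for i j x
    proof (cases "x \<bullet> emb (fst z) \<le> 0")
      case True
      then have "G False x = 0 \<and> nabla (G False) x = 0"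
        unfolding G_def using half_space[OF v(1)] by simp
      with that show ?thesis by (cases i; cases j) auto
    next
      case False
      then have "x \<bullet> emb (\<lambda>i. - fst z i) \<le> 0"
        by (simp add: emb_def embed_tail_uminus)
      then have "G True x = 0 \<and> nabla (G True) x = 0"
        unfolding G_def using half_space[OF v(2)] by simp
      with that show ?thesis by (cases i; cases j) auto
    qed
    have sums: "mass p (F z) = (\<Sum>i\<in>UNIV. \<bar>a i\<bar> powr p * mass p (G i))"
      "dirichlet p (F z) = (\<Sum>i\<in>UNIV. \<bar>a i\<bar> powr p * dirichlet p (G i))"
      unfolding FG by (rule mass_dirichlet_disjoint_sum[OF finite p0 G_test disj]; assumption)+
    have G_bounds: "mass p (G i) > 0" "dirichlet p (G i) \<le> C * mass p (G i)" for i
      unfolding G_def by (rule mean_bounds[OF G_weights])+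
    have "mass p (F z) > 0"
      unfolding sums(1) using G_bounds(1)
      by (intro sum_pos2[of _ False]) (auto simp: a_def mass_nonneg)
    moreover have "dirichlet p (F z) \<le> (\<Sum>i\<in>UNIV. \<bar>a i\<bar> powr p * (C * mass p (G i)))"
      unfolding sums(2) by (intro sum_mono mult_left_mono G_bounds) simp
    then have "dirichlet p (F z) \<le> C * mass p (F z)"
      unfolding sums(1) sum_distrib_left by (simp add: mult_ac)
    ultimately show ?thesis ..
  qed
  show "variational_eigenvalue p \<Omega> (CARD('n) - l + 2) \<le> ereal C"
  proof (rule variational_eigenvalue_le_family[OF family _ _ K K\<Omega> \<Omega>_open p0])
    show "compact S"
      unfolding S_def by (intro compact_Times compact_sph) simp
    show "S \<noteq> {}"
      using v0 by (auto simp: S_def)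
    show "mass p (F z) > 0" "dirichlet p (F z) \<le> C * mass p (F z)" if "z \<in> S" for z
      using bounds[OF that] by auto
  next
    fix g
    assume g: "continuous_on S (\<lambda>s. g (F s))" "\<And>s. s \<in> S \<Longrightarrow> g (F s) \<in> sph (CARD('n) - l + 2 - 2)"
      "\<And>s. s \<in> S \<Longrightarrow> g (\<lambda>x. - F s x) = (\<lambda>i. - g (F s) i)"
    have D2: "CARD('n) - l + 2 - 2 = D" by (simp add: D_def)
    have in_S: "(v, 2 * t) \<in> S" if "v \<in> sph D" "t \<in> {0..1}" for v t
      using that by (auto simp: S_def)
    define H where "H = (\<lambda>(t, v). g (F (v, 2 * t)))"
    have H_in: "H (t, v) \<in> sph D" if "t \<in> {0..1}" "v \<in> sph D" for t v
      using g(2)[OF in_S[OF that(2,1)]] unfolding D2 by (simp add: H_def)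
    have H_cont: "continuous_on ({0..1} \<times> sph D) H"
    proof -
      have "continuous_on ({0..1} \<times> sph D) (\<lambda>z. (snd z, 2 * fst z :: real))"
        by (intro continuous_on_Pair continuous_on_mult continuous_on_const continuous_on_fst continuous_on_snd continuous_on_id)
      then have "continuous_on ({0..1} \<times> sph D) (\<lambda>z. g (F (snd z, 2 * fst z)))"
        by (rule continuous_on_compose2[OF g(1)]) (use in_S in auto)
      then show ?thesis by (simp add: H_def case_prod_unfold)
    qed
    define G where "G v = H (0, v)" for v
    have G_cont: "continuous_on (sph D) G"
      unfolding G_def
      by (rule continuous_on_compose2[OF H_cont]) (auto intro!: continuous_on_Pair continuous_on_const continuous_on_id)
    have G_odd: "G (\<lambda>i. - v i) = (\<lambda>i. - G v i)" if v: "v \<in> sph D" for v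
    proof -
      have "F (\<lambda>i. - v i, 0) = (\<lambda>x. - F (v, 0) x)"
        by (simp add: F_def[abs_def] \<tau>_early \<gamma>_def)
      then show ?thesis
        using g(3)[of "(v, 0)"] in_S[OF v, of 0] by (simp add: G_def H_def)
    qed
    have "odd (Brouwer_degree2 D G)"
      using G_cont H_in G_odd by (intro odd_Brouwer_degree2_of_odd_map) (auto simp: G_def)
    moreover have "Brouwer_degree2 D G = Brouwer_degree2 D (\<lambda>v. H (1, v))"
      using Brouwer_degree2_homotopy_on[OF H_cont H_in] by (simp add: G_def[abs_def])
    \<comment> \<open>At time 2 nothing depends on \<open>v\<close> any more: the end of the
      homotopy is constant and has degree 0, which is even.\<close>
    moreover have "H (1, v) = g (P.mean (T v0))" for v
    proof -
      have "\<tau> (v, 2) = T v0"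
        by (simp add: \<tau>_def[abs_def] \<rho>_def)
      then show ?thesis
        by (simp add: H_def F_late)
    qed
    ultimately show False
      by (simp add: Brouwer_degree2_const)
  qed
qed

theorem proposition1p3:
  fixes e :: "nat \<Rightarrow> 'n::finite"
    and \<Omega> :: "(real ^ 'n) set"
    and l k :: nat
    and p :: real
  assumes "CARD('n) \<ge> 2"
    and "bij_betw e {1..CARD('n)} UNIV"
    and "l \<in> {1..CARD('n) - 1}"
    and "domain_of_revolutions e l \<Omega>"
    and "p > 1"
    and "k \<ge> 1"
  shows "(\<forall>j\<in>{2..<CARD('n) - l + 2}.
            variational_eigenvalue p \<Omega> j \<le> variational_eigenvalue p \<Omega> (j + 1)) \<and>
         variational_eigenvalue p \<Omega> (CARD('n) - l + 2) \<le> symmetric_eigenvalue e p \<Omega> 1 \<and>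
         variational_eigenvalue p \<Omega> (2 * k) \<le> variational_eigenvalue p \<Omega> (2 * k + 1) \<and>
         variational_eigenvalue p \<Omega> (2 * k + 1) \<le> symmetric_eigenvalue e p \<Omega> k"
proof (intro conjI ballI)
  show "variational_eigenvalue p \<Omega> j \<le> variational_eigenvalue p \<Omega> (j + 1)" for j
    by (rule variational_eigenvalue_mono) simp
  show "variational_eigenvalue p \<Omega> (CARD('n) - l + 2) \<le> symmetric_eigenvalue e p \<Omega> 1"
    by (rule variational_eigenvalue_le_symmetric_half[OF assms(1-5)])
  show "variational_eigenvalue p \<Omega> (2 * k) \<le> variational_eigenvalue p \<Omega> (2 * k + 1)"
    by (rule variational_eigenvalue_mono) simp
  show "variational_eigenvalue p \<Omega> (2 * k + 1) \<le> symmetric_eigenvalue e p \<Omega> k"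
    by (rule variational_eigenvalue_le_symmetric[OF assms])
qed

end
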